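(* Let $\mathcal{G}=(G^0,\mathcal{G}^1,r,s)$ be an ultragraph. Then the gauge action $\gamma$ on the ultragraph $C^*$-algebra $C^*(\mathcal{G})$ is saturated if and only if the complex Leavitt path algebra $L_{\mathbb{C}}(\mathcal{G})$ is strongly $\mathbb{Z}$-graded with respect to the grading $\{L_{\mathbb{C}}(\mathcal{G})_m\}_{m\in\mathbb{Z}}$.
   Context: An ultragraph $\mathcal{G}=(G^0,\mathcal{G}^1,r,s)$ consists of two countable sets $G^0$ (vertices) and $\mathcal{G}^1$ (edges), a map $s:\mathcal{G}^1\to G^0$ and a map $r:\mathcal{G}^1\to P(G^0)\setminus\{\emptyset\}$, where $P(G^0)$ is the power set of $G^0$. $\mathcal{G}^0$ is the smallest subset of $P(G^0)$ that contains $\{v\}$ for all $v\in G^0$, contains $r(e)$ for all $e\in\mathcal{G}^1$, and is closed under finite unions and non-empty finite intersections. $L_{\mathbb{C}}(\mathcal{G})$ is the universal $\mathbb{C}$-algebra with generators $\{s_e,s_e^*:e\in\mathcal{G}^1\}\cup\{p_A:A\in\mathcal{G}^0\}$ and relations: (1) $p_\emptyset=0$, $p_Ap_B=p_{A\cap B}$, $p_{A\cup B}=p_A+p_B-p_{A\cap B}$ for all $A,B\in\mathcal{G}^0$; (2) $p_{s(e)}s_e=s_ep_{r(e)}=s_e$ and $p_{r(e)}s_e^*=s_e^*p_{s(e)}=s_e^*$ for all $e\in\mathcal{G}^1$; (3) $s_e^*s_f=\delta_{e,f}p_{r(e)}$ for all $e,f\in\mathcal{G}^1$; (4) $p_v=\sum_{s(e)=v}s_es_e^*$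 whenever $0<|s^{-1}(v)|<\infty$. Here $p_v$ means $p_{\{v\}}$. A finite path is either an element of $\mathcal{G}^0$ (of length $0$) or a sequence of edges $e_1\cdots e_n$ (of length $n$) with $s(e_{i+1})\in r(e_i)$ for $1\le i<n$; $\mathcal{G}^*$ is the set of finite paths. For $\alpha=e_1\cdots e_n$, $s_\alpha=s_{e_1}\cdots s_{e_n}$ and $s_\alpha^*=s_{e_n}^*\cdots s_{e_1}^*$; for $A\in\mathcal{G}^0$, $s_A=s_A^*=p_A$. The $\mathbb{Z}$-grading: $L_{\mathbb{C}}(\mathcal{G})_m$ is the set of finite sums $\sum_i\lambda_is_{\alpha_i}p_{A_i}s_{\beta_i}^*$ with $\lambda_i\in\mathbb{C}$, $\alpha_i,\beta_i\in\mathcal{G}^*$, $A_i\in\mathcal{G}^0$, $|\alpha_i|-|\beta_i|=m$. A grading $T=\bigoplus_nT_n$ is strong if $T_mT_n=T_{m+n}$ for all $m,n\in\mathbb{Z}$, where $T_mT_n$ denotes the set of finite sums of products. $C^*(\mathcal{G})$ is the universal $C^*$-algebra generated by projections $\{p_A:A\in\mathcal{G}^0\}$ and partial isometries $\{s_e:e\in\mathcal{G}^1\}$ with mutually orthogonal ranges, satisfying: $p_\emptyset=0$, $p_Ap_B=p_{A\cap B}$, $p_{A\cup B}=p_A+p_B-p_{A\cap B}$; $s_e^*s_e=p_{r(e)}$; $s_es_e^*\le p_{s(e)}$; and $p_v=\sum_{s(e)=v}s_es_e^*$ whenever $0<|s^{-1}(v)|<\infty$. The gauge action is the action $\gamma$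 of $S^1=\{z\in\mathbb{C}:|z|=1\}$ on $C^*(\mathcal{G})$ by automorphisms with $\gamma_z(s_e)=zs_e$ and $\gamma_z(p_A)=p_A$. An action of a compact abelian group $H$ on a $C^*$-algebra $A$ is saturated if for every character $\tau:H\to S^1$, with eigenspace $A_\tau=\{a\in A: h\cdot a=\tau(h)a\ \forall h\in H\}$, the product $A_\tau^*A_\tau$ (linear span of products) is dense in the fixed point algebra $A^H$. For the gauge action, the eigenspaces are $C^*(\mathcal{G})_n=\{a:\gamma_z(a)=z^na\ \forall z\in S^1\}$, $n\in\mathbb{Z}$, and the fixed point algebra is $C^*(\mathcal{G})_0$. *)

theory Defs
  imports "HOL-Analysis.Analysis" "HOL-Algebra.Module"
begin

section \<open>Complex algebras, not necessarily unital\<close>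

definition complex_ring :: "complex ring" where
  "complex_ring = \<lparr>carrier = UNIV, mult = (*), one = 1, zero = 0, add = (+)\<rparr>"

text \<open>The library record for algebras has a field for a unit; no axiom below mentions it.\<close>

locale complex_algebra = module complex_ring A
  for A :: "(complex, 'a, 'm) module_scheme" (structure) +
  assumes m_closed: "\<lbrakk>x \<in> carrier A; y \<in> carrier A\<rbrakk> \<Longrightarrow> x \<otimes> y \<in> carrier A"
    and m_assoc: "\<lbrakk>x \<in> carrier A; y \<in> carrier A; z \<in> carrier A\<rbrakk> \<Longrightarrow> (x \<otimes> y) \<otimes> z = x \<otimes> (y \<otimes> z)"
    and l_distr: "\<lbrakk>x \<in> carrier A; y \<in> carrier A; z \<in> carrier A\<rbrakk>
      \<Longrightarrow> (x \<oplus> y) \<otimes> z = (x \<otimes> z) \<oplus> (y \<otimes> z)"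
    and r_distr: "\<lbrakk>x \<in> carrier A; y \<in> carrier A; z \<in> carrier A\<rbrakk>
      \<Longrightarrow> z \<otimes> (x \<oplus> y) = (z \<otimes> x) \<oplus> (z \<otimes> y)"
    and smult_mult_left: "\<lbrakk>x \<in> carrier A; y \<in> carrier A\<rbrakk> \<Longrightarrow> (c \<odot> x) \<otimes> y = c \<odot> (x \<otimes> y)"
    and smult_mult_right: "\<lbrakk>x \<in> carrier A; y \<in> carrier A\<rbrakk> \<Longrightarrow> x \<otimes> (c \<odot> y) = c \<odot> (x \<otimes> y)"

definition finite_sums :: "(complex, 'a, 'm) module_scheme \<Rightarrow> 'a set \<Rightarrow> 'a set" where
  "finite_sums A S = {finsum A f {..<n} | f n. f \<in> {..<n::nat} \<rightarrow> S}"

definition set_prod :: "(complex, 'a, 'm) module_scheme \<Rightarrow> 'a set \<Rightarrow> 'a set \<Rightarrow> 'a set" where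
  "set_prod A S T = {x \<otimes>\<^bsub>A\<^esub> y | x y. x \<in> S \<and> y \<in> T}"

definition linear_span :: "(complex, 'a, 'm) module_scheme \<Rightarrow> 'a set \<Rightarrow> 'a set" where
  "linear_span A S = finite_sums A {c \<odot>\<^bsub>A\<^esub> x | c x. x \<in> S}"

definition linear_subspace :: "(complex, 'a, 'm) module_scheme \<Rightarrow> 'a set \<Rightarrow> bool" where
  "linear_subspace A S \<longleftrightarrow> S \<subseteq> carrier A \<and> \<zero>\<^bsub>A\<^esub> \<in> S
     \<and> (\<forall>x\<in>S. \<forall>y\<in>S. x \<oplus>\<^bsub>A\<^esub> y \<in> S) \<and> (\<forall>c. \<forall>x\<in>S. c \<odot>\<^bsub>A\<^esub> x \<in> S)"

definition graded :: "(complex, 'a, 'm) module_scheme \<Rightarrow> (int \<Rightarrow> 'a set) \<Rightarrow> bool" where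
  "graded A T \<longleftrightarrow>
     (\<forall>n. linear_subspace A (T n))
   \<and> (\<forall>x\<in>carrier A. \<exists>!f. (\<forall>n. f n \<in> T n) \<and> finite {n. f n \<noteq> \<zero>\<^bsub>A\<^esub>}
         \<and> x = finsum A f {n. f n \<noteq> \<zero>\<^bsub>A\<^esub>})
   \<and> (\<forall>m n. set_prod A (T m) (T n) \<subseteq> T (m + n))"

definition strongly_graded :: "(complex, 'a, 'm) module_scheme \<Rightarrow> (int \<Rightarrow> 'a set) \<Rightarrow> bool" where
  "strongly_graded A T \<longleftrightarrow>
     graded A T \<and> (\<forall>m n. finite_sums A (set_prod A (T m) (T n)) = T (m + n))"


section \<open>The universal algebra with given generators and relations\<close>

datatype 'g alg_term =
    Gen 'g
  | Zero
  | Add "'g alg_term" "'g alg_term"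
  | Mult "'g alg_term" "'g alg_term"
  | Scale complex "'g alg_term"

inductive alg_eq :: "('g alg_term \<times> 'g alg_term) set \<Rightarrow> 'g alg_term \<Rightarrow> 'g alg_term \<Rightarrow> bool"
  for R where
  rel: "(t, u) \<in> R \<Longrightarrow> alg_eq R t u"
| refl: "alg_eq R t t"
| sym: "alg_eq R t u \<Longrightarrow> alg_eq R u t"
| trans: "alg_eq R t u \<Longrightarrow> alg_eq R u w \<Longrightarrow> alg_eq R t w"
| cong_add: "alg_eq R t t' \<Longrightarrow> alg_eq R u u' \<Longrightarrow> alg_eq R (Add t u) (Add t' u')"
| cong_mult: "alg_eq R t t' \<Longrightarrow> alg_eq R u u' \<Longrightarrow> alg_eq R (Mult t u) (Mult t' u')"
| cong_scale: "alg_eq R t t' \<Longrightarrow> alg_eq R (Scale c t) (Scale c t')"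
| add_assoc: "alg_eq R (Add (Add t u) w) (Add t (Add u w))"
| add_commute: "alg_eq R (Add t u) (Add u t)"
| add_zero: "alg_eq R (Add t Zero) t"
| add_inverse: "alg_eq R (Add t (Scale (-1) t)) Zero"
| scale_add_right: "alg_eq R (Scale c (Add t u)) (Add (Scale c t) (Scale c u))"
| scale_add_left: "alg_eq R (Scale (c + d) t) (Add (Scale c t) (Scale d t))"
| scale_scale: "alg_eq R (Scale c (Scale d t)) (Scale (c * d) t)"
| scale_one: "alg_eq R (Scale 1 t) t"
| mult_assoc: "alg_eq R (Mult (Mult t u) w) (Mult t (Mult u w))"
| distrib_left: "alg_eq R (Mult t (Add u w)) (Add (Mult t u) (Mult t w))"
| distrib_right: "alg_eq R (Mult (Add t u) w) (Add (Mult t w) (Mult u w))"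
| scale_mult_left: "alg_eq R (Mult (Scale c t) u) (Scale c (Mult t u))"
| scale_mult_right: "alg_eq R (Mult t (Scale c u)) (Scale c (Mult t u))"

definition alg_class ::
  "'g set \<Rightarrow> ('g alg_term \<times> 'g alg_term) set \<Rightarrow> 'g alg_term \<Rightarrow> 'g alg_term set" where
  "alg_class X R t = {u. set_alg_term u \<subseteq> X \<and> alg_eq R t u}"

text \<open>Each operation takes the union of the classes of all results on representatives; these
  classes coincide.\<close>

definition universal_algebra ::
  "'g set \<Rightarrow> ('g alg_term \<times> 'g alg_term) set \<Rightarrow> (complex, 'g alg_term set) module" where
  "universal_algebra X R =
     \<lparr>carrier = {alg_class X R t | t. set_alg_term t \<subseteq> X},
      mult = (\<lambda>x y. \<Union>t\<in>x. \<Union>u\<in>y. alg_class X R (Mult t u)),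
      one = undefined,
      zero = alg_class X R Zero,
      add = (\<lambda>x y. \<Union>t\<in>x. \<Union>u\<in>y. alg_class X R (Add t u)),
      smult = (\<lambda>c x. \<Union>t\<in>x. alg_class X R (Scale c t))\<rparr>"


section \<open>Ultragraphs\<close>

record ('v, 'e) ultragraph =
  verts :: "'v set"
  edges :: "'e set"
  rng :: "'e \<Rightarrow> 'v set"
  src :: "'e \<Rightarrow> 'v"

locale ultragraph =
  fixes G :: "('v, 'e) ultragraph"
  assumes countable_verts: "countable (verts G)"
    and countable_edges: "countable (edges G)"
    and src_in_verts: "e \<in> edges G \<Longrightarrow> src G e \<in> verts G"
    and rng_subset: "e \<in> edges G \<Longrightarrow> rng G e \<subseteq> verts G"
    and rng_nonempty: "e \<in> edges G \<Longrightarrow> rng G e \<noteq> {}"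

text \<open>The union of the empty family is admitted, so that the empty set always belongs to the
  collection.\<close>

inductive_set gverts :: "('v, 'e) ultragraph \<Rightarrow> 'v set set"
  for G :: "('v, 'e) ultragraph" where
  vertex: "v \<in> verts G \<Longrightarrow> {v} \<in> gverts G"
| range: "e \<in> edges G \<Longrightarrow> rng G e \<in> gverts G"
| Union: "finite F \<Longrightarrow> (\<And>A. A \<in> F \<Longrightarrow> A \<in> gverts G) \<Longrightarrow> \<Union>F \<in> gverts G"
| Inter: "finite F \<Longrightarrow> F \<noteq> {} \<Longrightarrow> (\<And>A. A \<in> F \<Longrightarrow> A \<in> gverts G) \<Longrightarrow> \<Inter>F \<in> gverts G"

definition out_edges :: "('v, 'e) ultragraph \<Rightarrow> 'v \<Rightarrow> 'e set" where
  "out_edges G v = {e \<in> edges G. src G e = v}"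

datatype ('v, 'e) upath = SetPath "'v set" | EdgePath "'e list"

fun finite_path :: "('v, 'e) ultragraph \<Rightarrow> ('v, 'e) upath \<Rightarrow> bool" where
  "finite_path G (SetPath A) \<longleftrightarrow> A \<in> gverts G"
| "finite_path G (EdgePath es) \<longleftrightarrow> es \<noteq> [] \<and> set es \<subseteq> edges G
     \<and> (\<forall>i. Suc i < length es \<longrightarrow> src G (es ! Suc i) \<in> rng G (es ! i))"

fun path_length :: "('v, 'e) upath \<Rightarrow> nat" where
  "path_length (SetPath A) = 0"
| "path_length (EdgePath es) = length es"


section \<open>The Leavitt path algebra\<close>

datatype ('v, 'e) lpa_gen = Edge 'e | Ghost 'e | Proj "'v set"

definition lpa_gens :: "('v, 'e) ultragraph \<Rightarrow> ('v, 'e) lpa_gen set" where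
  "lpa_gens G = Edge ` edges G \<union> Ghost ` edges G \<union> Proj ` gverts G"

text \<open>The sum in the last relation runs over an enumeration of the finite nonempty set of
  edges with source \<open>v\<close>.\<close>

inductive_set lpa_rels ::
  "('v, 'e) ultragraph \<Rightarrow> (('v, 'e) lpa_gen alg_term \<times> ('v, 'e) lpa_gen alg_term) set"
  for G :: "('v, 'e) ultragraph" where
  proj_empty: "(Gen (Proj {}), Zero) \<in> lpa_rels G"
| proj_Int: "\<lbrakk>A \<in> gverts G; B \<in> gverts G\<rbrakk>
    \<Longrightarrow> (Mult (Gen (Proj A)) (Gen (Proj B)), Gen (Proj (A \<inter> B))) \<in> lpa_rels G"
| proj_Un: "\<lbrakk>A \<in> gverts G; B \<in> gverts G\<rbrakk>
    \<Longrightarrow> (Gen (Proj (A \<union> B)),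
         Add (Add (Gen (Proj A)) (Gen (Proj B))) (Scale (-1) (Gen (Proj (A \<inter> B))))) \<in> lpa_rels G"
| src_edge: "e \<in> edges G
    \<Longrightarrow> (Mult (Gen (Proj {src G e})) (Gen (Edge e)), Gen (Edge e)) \<in> lpa_rels G"
| edge_rng: "e \<in> edges G
    \<Longrightarrow> (Mult (Gen (Edge e)) (Gen (Proj (rng G e))), Gen (Edge e)) \<in> lpa_rels G"
| rng_ghost: "e \<in> edges G
    \<Longrightarrow> (Mult (Gen (Proj (rng G e))) (Gen (Ghost e)), Gen (Ghost e)) \<in> lpa_rels G"
| ghost_src: "e \<in> edges G
    \<Longrightarrow> (Mult (Gen (Ghost e)) (Gen (Proj {src G e})), Gen (Ghost e)) \<in> lpa_rels G"
| ghost_edge: "\<lbrakk>e \<in> edges G; f \<in> edges G\<rbrakk>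
    \<Longrightarrow> (Mult (Gen (Ghost e)) (Gen (Edge f)),
         if e = f then Gen (Proj (rng G e)) else Zero) \<in> lpa_rels G"
| vertex_sum: "\<lbrakk>v \<in> verts G; es \<noteq> []; distinct es; set es = out_edges G v\<rbrakk>
    \<Longrightarrow> (Gen (Proj {v}),
         foldr (\<lambda>e t. Add (Mult (Gen (Edge e)) (Gen (Ghost e))) t) es Zero) \<in> lpa_rels G"

definition leavitt ::
  "('v, 'e) ultragraph \<Rightarrow> (complex, ('v, 'e) lpa_gen alg_term set) module" where
  "leavitt G = universal_algebra (lpa_gens G) (lpa_rels G)"

definition lpa_gen :: "('v, 'e) ultragraph \<Rightarrow> ('v, 'e) lpa_gen \<Rightarrow> ('v, 'e) lpa_gen alg_term set" where
  "lpa_gen G g = alg_class (lpa_gens G) (lpa_rels G) (Gen g)"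

text \<open>Left-to-right product of a nonempty list; there need not be a unit for the empty list.\<close>

fun list_prod :: "(complex, 'a, 'm) module_scheme \<Rightarrow> 'a list \<Rightarrow> 'a" where
  "list_prod A [] = undefined"
| "list_prod A [x] = x"
| "list_prod A (x # y # xs) = x \<otimes>\<^bsub>A\<^esub> list_prod A (y # xs)"

fun path_elt :: "('v, 'e) ultragraph \<Rightarrow> ('v, 'e) upath \<Rightarrow> ('v, 'e) lpa_gen alg_term set" where
  "path_elt G (SetPath A) = lpa_gen G (Proj A)"
| "path_elt G (EdgePath es) = list_prod (leavitt G) (map (\<lambda>e. lpa_gen G (Edge e)) es)"

fun ghost_path_elt :: "('v, 'e) ultragraph \<Rightarrow> ('v, 'e) upath \<Rightarrow> ('v, 'e) lpa_gen alg_term set" where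
  "ghost_path_elt G (SetPath A) = lpa_gen G (Proj A)"
| "ghost_path_elt G (EdgePath es) =
     list_prod (leavitt G) (map (\<lambda>e. lpa_gen G (Ghost e)) (rev es))"

definition leavitt_component ::
  "('v, 'e) ultragraph \<Rightarrow> int \<Rightarrow> ('v, 'e) lpa_gen alg_term set set" where
  "leavitt_component G m = finite_sums (leavitt G)
     {c \<odot>\<^bsub>leavitt G\<^esub> (path_elt G \<alpha> \<otimes>\<^bsub>leavitt G\<^esub> lpa_gen G (Proj A) \<otimes>\<^bsub>leavitt G\<^esub> ghost_path_elt G \<beta>)
       | c \<alpha> A \<beta>. finite_path G \<alpha> \<and> finite_path G \<beta> \<and> A \<in> gverts G
           \<and> int (path_length \<alpha>) - int (path_length \<beta>) = m}"


section \<open>C*-algebras\<close>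

record 'a cstar = "(complex, 'a) module" +
  adj :: "'a \<Rightarrow> 'a"
  nrm :: "'a \<Rightarrow> real"

text \<open>The library notion of a metric constrains the distance function outside the
  carrier as well; hence the default value.\<close>

definition cdist :: "'a cstar \<Rightarrow> 'a \<Rightarrow> 'a \<Rightarrow> real" where
  "cdist A x y = (if x \<in> carrier A \<and> y \<in> carrier A then nrm A (x \<ominus>\<^bsub>A\<^esub> y) else 0)"

abbreviation norm_topology :: "'a cstar \<Rightarrow> 'a topology" where
  "norm_topology A \<equiv> Metric_space.mtopology (carrier A) (cdist A)"

locale cstar_algebra = complex_algebra A
  for A :: "'a cstar" (structure) +
  assumes adj_closed: "x \<in> carrier A \<Longrightarrow> adj A x \<in> carrier A"
    and adj_adj: "x \<in> carrier A \<Longrightarrow> adj A (adj A x) = x"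
    and adj_add: "\<lbrakk>x \<in> carrier A; y \<in> carrier A\<rbrakk> \<Longrightarrow> adj A (x \<oplus> y) = adj A x \<oplus> adj A y"
    and adj_smult: "x \<in> carrier A \<Longrightarrow> adj A (c \<odot> x) = cnj c \<odot> adj A x"
    and adj_mult: "\<lbrakk>x \<in> carrier A; y \<in> carrier A\<rbrakk> \<Longrightarrow> adj A (x \<otimes> y) = adj A y \<otimes> adj A x"
    and nrm_nonneg: "x \<in> carrier A \<Longrightarrow> 0 \<le> nrm A x"
    and nrm_eq_zero: "x \<in> carrier A \<Longrightarrow> nrm A x = 0 \<longleftrightarrow> x = \<zero>"
    and nrm_triangle: "\<lbrakk>x \<in> carrier A; y \<in> carrier A\<rbrakk> \<Longrightarrow> nrm A (x \<oplus> y) \<le> nrm A x + nrm A y"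
    and nrm_smult: "x \<in> carrier A \<Longrightarrow> nrm A (c \<odot> x) = cmod c * nrm A x"
    and nrm_mult: "\<lbrakk>x \<in> carrier A; y \<in> carrier A\<rbrakk> \<Longrightarrow> nrm A (x \<otimes> y) \<le> nrm A x * nrm A y"
    and cstar_identity: "x \<in> carrier A \<Longrightarrow> nrm A (adj A x \<otimes> x) = (nrm A x)\<^sup>2"
    and complete: "Metric_space.mcomplete (carrier A) (cdist A)"

definition cstar_le :: "'a cstar \<Rightarrow> 'a \<Rightarrow> 'a \<Rightarrow> bool" where
  "cstar_le A x y \<longleftrightarrow> (\<exists>z\<in>carrier A. y \<ominus>\<^bsub>A\<^esub> x = adj A z \<otimes>\<^bsub>A\<^esub> z)"

definition projection :: "'a cstar \<Rightarrow> 'a \<Rightarrow> bool" where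
  "projection A x \<longleftrightarrow> x \<in> carrier A \<and> x \<otimes>\<^bsub>A\<^esub> x = x \<and> adj A x = x"

definition partial_isometry :: "'a cstar \<Rightarrow> 'a \<Rightarrow> bool" where
  "partial_isometry A x \<longleftrightarrow> x \<in> carrier A \<and> x \<otimes>\<^bsub>A\<^esub> adj A x \<otimes>\<^bsub>A\<^esub> x = x"

definition star_hom :: "'a cstar \<Rightarrow> 'b cstar \<Rightarrow> ('a \<Rightarrow> 'b) \<Rightarrow> bool" where
  "star_hom A B \<phi> \<longleftrightarrow> \<phi> \<in> carrier A \<rightarrow> carrier B
     \<and> (\<forall>x\<in>carrier A. \<forall>y\<in>carrier A. \<phi> (x \<oplus>\<^bsub>A\<^esub> y) = \<phi> x \<oplus>\<^bsub>B\<^esub> \<phi> y)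
     \<and> (\<forall>c. \<forall>x\<in>carrier A. \<phi> (c \<odot>\<^bsub>A\<^esub> x) = c \<odot>\<^bsub>B\<^esub> \<phi> x)
     \<and> (\<forall>x\<in>carrier A. \<forall>y\<in>carrier A. \<phi> (x \<otimes>\<^bsub>A\<^esub> y) = \<phi> x \<otimes>\<^bsub>B\<^esub> \<phi> y)
     \<and> (\<forall>x\<in>carrier A. \<phi> (adj A x) = adj B (\<phi> x))"

definition closed_star_subalgebra :: "'a cstar \<Rightarrow> 'a set \<Rightarrow> bool" where
  "closed_star_subalgebra A S \<longleftrightarrow> linear_subspace A S
     \<and> (\<forall>x\<in>S. \<forall>y\<in>S. x \<otimes>\<^bsub>A\<^esub> y \<in> S) \<and> (\<forall>x\<in>S. adj A x \<in> S)
     \<and> closedin (norm_topology A) S"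


section \<open>Group actions on C*-algebras\<close>

text \<open>A topological group is given by a group \<open>H\<close> and a topology \<open>T\<close> on its carrier.\<close>

definition cstar_action ::
  "('h, 'n) monoid_scheme \<Rightarrow> 'h topology \<Rightarrow> 'a cstar \<Rightarrow> ('h \<Rightarrow> 'a \<Rightarrow> 'a) \<Rightarrow> bool" where
  "cstar_action H T A \<gamma> \<longleftrightarrow>
     (\<forall>h\<in>carrier H. star_hom A A (\<gamma> h) \<and> bij_betw (\<gamma> h) (carrier A) (carrier A))
   \<and> (\<forall>g\<in>carrier H. \<forall>h\<in>carrier H. \<forall>x\<in>carrier A. \<gamma> (g \<otimes>\<^bsub>H\<^esub> h) x = \<gamma> g (\<gamma> h x))
   \<and> (\<forall>x\<in>carrier A. continuous_map T (norm_topology A) (\<lambda>h. \<gamma> h x))"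

definition circle_group :: "complex monoid" where
  "circle_group = \<lparr>carrier = sphere 0 1, mult = (*), one = 1\<rparr>"

abbreviation circle_topology :: "complex topology" where
  "circle_topology \<equiv> top_of_set (sphere 0 1)"

definition characters ::
  "('h, 'n) monoid_scheme \<Rightarrow> 'h topology \<Rightarrow> ('h \<Rightarrow> complex) set" where
  "characters H T = {\<tau>. \<tau> \<in> hom H circle_group \<and> continuous_map T circle_topology \<tau>}"

definition eigenspace ::
  "('h, 'n) monoid_scheme \<Rightarrow> 'a cstar \<Rightarrow> ('h \<Rightarrow> 'a \<Rightarrow> 'a) \<Rightarrow> ('h \<Rightarrow> complex) \<Rightarrow> 'a set" where
  "eigenspace H A \<gamma> \<tau> = {a \<in> carrier A. \<forall>h\<in>carrier H. \<gamma> h a = \<tau> h \<odot>\<^bsub>A\<^esub> a}"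

definition fixed_algebra ::
  "('h, 'n) monoid_scheme \<Rightarrow> 'a cstar \<Rightarrow> ('h \<Rightarrow> 'a \<Rightarrow> 'a) \<Rightarrow> 'a set" where
  "fixed_algebra H A \<gamma> = {a \<in> carrier A. \<forall>h\<in>carrier H. \<gamma> h a = a}"

definition saturated ::
  "('h, 'n) monoid_scheme \<Rightarrow> 'h topology \<Rightarrow> 'a cstar \<Rightarrow> ('h \<Rightarrow> 'a \<Rightarrow> 'a) \<Rightarrow> bool" where
  "saturated H T A \<gamma> \<longleftrightarrow> (\<forall>\<tau>\<in>characters H T.
     let S = linear_span A (set_prod A (adj A ` eigenspace H A \<gamma> \<tau>) (eigenspace H A \<gamma> \<tau>))
     in S \<subseteq> fixed_algebra H A \<gamma> \<and> fixed_algebra H A \<gamma> \<subseteq> Abstract_Topology.closure_of (norm_topology A) S)"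


section \<open>The C*-algebra of an ultragraph\<close>

locale ck_family = cstar_algebra A
  for G :: "('v, 'e) ultragraph" and A :: "'a cstar" (structure)
    and s :: "'e \<Rightarrow> 'a" and p :: "'v set \<Rightarrow> 'a" +
  assumes proj: "B \<in> gverts G \<Longrightarrow> projection A (p B)"
    and isom: "e \<in> edges G \<Longrightarrow> partial_isometry A (s e)"
    and orthogonal_ranges: "\<lbrakk>e \<in> edges G; f \<in> edges G; e \<noteq> f\<rbrakk>
      \<Longrightarrow> (s e \<otimes> adj A (s e)) \<otimes> (s f \<otimes> adj A (s f)) = \<zero>"
    and p_empty: "p {} = \<zero>"
    and p_Int: "\<lbrakk>B \<in> gverts G; C \<in> gverts G\<rbrakk> \<Longrightarrow> p B \<otimes> p C = p (B \<inter> C)"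
    and p_Un: "\<lbrakk>B \<in> gverts G; C \<in> gverts G\<rbrakk> \<Longrightarrow> p (B \<union> C) = p B \<oplus> p C \<ominus> p (B \<inter> C)"
    and source_projection: "e \<in> edges G \<Longrightarrow> adj A (s e) \<otimes> s e = p (rng G e)"
    and range_projection: "e \<in> edges G \<Longrightarrow> cstar_le A (s e \<otimes> adj A (s e)) (p {src G e})"
    and vertex_sum: "\<lbrakk>v \<in> verts G; finite (out_edges G v); out_edges G v \<noteq> {}\<rbrakk>
      \<Longrightarrow> p {v} = (\<Oplus>e\<in>out_edges G v. s e \<otimes> adj A (s e))"

text \<open>
  The universal C*-algebra is characterised by its universal property, so that a statement about
  it is made for every model \<open>A\<close>, whatever the type of its elements.

  HOL cannot quantify over the type of the elements of the target algebra \<open>B\<close>. This costs nothing: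
  a family in \<open>B\<close> has countably many members and so generates a separable C*-algebra, which has a
  faithful representation on the square-summable sequences. Every such algebra therefore
  has an isomorphic copy whose elements are operators on complex sequences, that is, elements of
  the type below.
\<close>

type_synonym sequence_operator = "(nat \<Rightarrow> complex) \<Rightarrow> nat \<Rightarrow> complex"

locale universal_ck_family = ck_family G A s p
  for G :: "('v, 'e) ultragraph" and A :: "'a cstar" (structure)
    and s :: "'e \<Rightarrow> 'a" and p :: "'v set \<Rightarrow> 'a" +
  assumes generated: "\<lbrakk>closed_star_subalgebra A S; s ` edges G \<subseteq> S; p ` gverts G \<subseteq> S\<rbrakk>
      \<Longrightarrow> S = carrier A"
    and universal: "\<And>(B :: sequence_operator cstar) t q. ck_family G B t q \<Longrightarrow>
      \<exists>\<phi>. star_hom A B \<phi> \<and> (\<forall>e\<in>edges G. \<phi> (s e) = t e) \<and> (\<forall>C\<in>gverts G. \<phi> (p C) = q C)"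

definition gauge_action ::
  "('v, 'e) ultragraph \<Rightarrow> 'a cstar \<Rightarrow> ('e \<Rightarrow> 'a) \<Rightarrow> ('v set \<Rightarrow> 'a) \<Rightarrow> (complex \<Rightarrow> 'a \<Rightarrow> 'a) \<Rightarrow> bool"
  where
  "gauge_action G A s p \<gamma> \<longleftrightarrow> cstar_action circle_group circle_topology A \<gamma>
     \<and> (\<forall>z\<in>sphere 0 1. (\<forall>e\<in>edges G. \<gamma> z (s e) = z \<odot>\<^bsub>A\<^esub> s e) \<and> (\<forall>B\<in>gverts G. \<gamma> z (p B) = p B))"

end

theory Submission
  imports Defs
begin

text \<open>
  The canonical map \<open>\<pi>\<close> from the Leavitt path algebra \<open>L\<close> to the C*-algebra sends \<open>L\<^sub>n\<close> to a dense
  subspace of the \<open>n\<close>-th spectral subspace (average over finitely many points of the circle), and the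
  characters of the circle are the maps \<open>z \<mapsto> z\<^sup>n\<close>. So the gauge action is saturated if and only if
  \<open>\<pi>(I\<^sub>n)\<close> is dense in the fixed point algebra for all \<open>n\<close>, where \<open>I\<^sub>n\<close> is the ideal of \<open>L\<^sub>0\<close> spanned by
  the products of elements of \<open>L\<close> of degrees \<open>- n\<close> and \<open>n\<close>. The grading is strong if and only if every
  \<open>p\<^sub>A\<close> lies in every \<open>I\<^sub>n\<close>, because these elements are local units; this gives one direction.

  For the other one, choose \<open>y\<close> in \<open>p\<^sub>A I\<^sub>n p\<^sub>A\<close> with \<open>\<pi>(y)\<close> at distance less than \<open>1\<close> from \<open>\<pi>(p\<^sub>A)\<close>. Then
  \<open>\<pi>(y)\<close> is invertible in the corner of \<open>\<pi>(p\<^sub>A)\<close>. As \<open>L\<^sub>0\<close> is locally finite-dimensional, \<open>y\<close> is a root of a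
  polynomial, so the inverse is a polynomial in \<open>\<pi>(y)\<close> and \<open>\<pi>(p\<^sub>A)\<close> lies in \<open>\<pi>(I\<^sub>n)\<close>. Finally \<open>\<pi>\<close> is injective
  on \<open>L\<^sub>0\<close>: an ideal with nonzero intersection with \<open>L\<^sub>0\<close> contains some \<open>p\<^sub>v\<close>, and \<open>\<pi>(p\<^sub>v)\<close> is not zero, as a representation by
  partial isometries of the space of square-summable sequences shows.
\<close>

section \<open>Unitization\<close>

text \<open>Neither algebra need have a unit, yet the estimates use elements such as
  \<open>1 - q\<close> and \<open>1 + x\<close>. Both algebras are therefore embedded in
  \<open>unitization\<close>, whose elements act on them by multiplication and where sets of finite
  sums become spans.

  The obstacle on the analytic side: the range condition of a Cuntz-Krieger family is only an order
  relation, \<open>p - q = star z * z\<close>, while the Leavitt relations demand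
  \<open>p * s = s\<close>. The passage rests on the classical fact that \<open>star c * c\<close>
  is negative only for \<open>c = 0\<close>. Neither this nor the contractivity of
  star-homomorphisms is derived from spectra: square roots come from a convergent iteration, bounds
  from unitaries and from the growth of powers.

  The inverse in the corner is never formed. A polynomial relation is written from its lowest
  nonzero coefficient on, so a power of the image of \<open>y\<close> splits off; this power can be
  cancelled because the image has distance less than 1 from the unit of the corner.\<close>

lemma carrier_complex_ring [simp]: "carrier complex_ring = UNIV"
  and mult_complex_ring [simp]: "mult complex_ring = (*)"
  and add_complex_ring [simp]: "add complex_ring = (+)"
  and one_complex_ring [simp]: "one complex_ring = 1"
  and zero_complex_ring [simp]: "zero complex_ring = 0"
  by (simp_all add: complex_ring_def)

context complex_algebra
begin

lemma scale_closed [simp]: "x \<in> carrier A \<Longrightarrow> c \<odot> x \<in> carrier A"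
  using smult_closed[of c x] by simp

lemma scale_add_right: "x \<in> carrier A \<Longrightarrow> y \<in> carrier A \<Longrightarrow> c \<odot> (x \<oplus> y) = c \<odot> x \<oplus> c \<odot> y"
  using smult_r_distr[of c x y] by simp

lemma scale_add_left: "x \<in> carrier A \<Longrightarrow> (c + d) \<odot> x = c \<odot> x \<oplus> d \<odot> x"
  using smult_l_distr[of c d x] by simp

lemma scale_scale: "x \<in> carrier A \<Longrightarrow> c \<odot> (d \<odot> x) = (c * d) \<odot> x"
  using smult_assoc1[of c d x] by simp

lemma scale_1 [simp]: "x \<in> carrier A \<Longrightarrow> 1 \<odot> x = x"
  using smult_one[of x] by simp

lemma scale_0 [simp]: "x \<in> carrier A \<Longrightarrow> 0 \<odot> x = \<zero>"
  using smult_l_null[of x] by simp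

lemma scale_zero [simp]: "c \<odot> \<zero> = \<zero>"
  using smult_r_null[of c] by simp

lemma scale_minus_1: "x \<in> carrier A \<Longrightarrow> (- 1) \<odot> x = \<ominus> x"
proof -
  assume x: "x \<in> carrier A"
  have "x \<oplus> (- 1) \<odot> x = (1 + (- 1)) \<odot> x"
    using x by (subst scale_add_left) simp_all
  then have "x \<oplus> (- 1) \<odot> x = \<zero>" using x by simp
  then show ?thesis using x
    by (metis M.minus_equality M.minus_minus M.a_inv_closed scale_closed)
qed

lemma mult_zero_left [simp]: "x \<in> carrier A \<Longrightarrow> \<zero> \<otimes> x = \<zero>"
  using smult_mult_left[of \<zero> x 0] m_closed by simp

lemma mult_zero_right [simp]: "x \<in> carrier A \<Longrightarrow> x \<otimes> \<zero> = \<zero>"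
  using smult_mult_right[of x \<zero> 0] m_closed by simp

end

text \<open>Unitizations of all algebras on one type are put together in a single type, which can then
  be an instance of \<open>ring_1\<close>: an element is a scalar with one element of each algebra.\<close>

typedef ('a, 'm) unitization =
  "{(c :: complex, f :: (complex, 'a, 'm) module_scheme \<Rightarrow> 'a).
     \<forall>A. if complex_algebra A then f A \<in> carrier A else f A = undefined}"
proof
  show "(0, \<lambda>A. if complex_algebra A then \<zero>\<^bsub>A\<^esub> else undefined)
    \<in> {(c, f). \<forall>A. if complex_algebra A then f A \<in> carrier A else f A = undefined}"
    by (auto intro!: abelian_group.a_inv_closed abelian_monoid.zero_closed
        simp: complex_algebra_def module_def abelian_group_def)
qed

setup_lifting type_definition_unitization

lemma complex_algebra_abelian_group: "complex_algebra A \<Longrightarrow> abelian_group A"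
  by (simp add: complex_algebra_def module_def)

lemma complex_algebra_abelian_monoid: "complex_algebra A \<Longrightarrow> abelian_monoid A"
  by (simp add: complex_algebra_abelian_group abelian_group.axioms(1))

lemma zero_in_carrier: "complex_algebra A \<Longrightarrow> \<zero>\<^bsub>A\<^esub> \<in> carrier A"
  using complex_algebra_abelian_monoid abelian_monoid.zero_closed by blast

instantiation unitization :: (type, type) ring_1
begin

lift_definition zero_unitization :: "('a, 'b) unitization"
  is "(0, \<lambda>A. if complex_algebra A then \<zero>\<^bsub>A\<^esub> else undefined)"
  by (auto simp: zero_in_carrier)

lift_definition one_unitization :: "('a, 'b) unitization"
  is "(1, \<lambda>A. if complex_algebra A then \<zero>\<^bsub>A\<^esub> else undefined)"
  by (auto simp: zero_in_carrier)

lift_definition plus_unitization ::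
  "('a, 'b) unitization \<Rightarrow> ('a, 'b) unitization \<Rightarrow> ('a, 'b) unitization"
  is "\<lambda>(c, f) (d, g). (c + d, \<lambda>A. if complex_algebra A then f A \<oplus>\<^bsub>A\<^esub> g A else undefined)"
  by (auto simp: complex_algebra_abelian_group abelian_group.axioms(1) abelian_monoid.a_closed)

lift_definition uminus_unitization :: "('a, 'b) unitization \<Rightarrow> ('a, 'b) unitization"
  is "\<lambda>(c, f). (- c, \<lambda>A. if complex_algebra A then \<ominus>\<^bsub>A\<^esub> f A else undefined)"
  by (auto simp: complex_algebra_abelian_group abelian_group.a_inv_closed)

definition minus_unitization ::
  "('a, 'b) unitization \<Rightarrow> ('a, 'b) unitization \<Rightarrow> ('a, 'b) unitization"
  where "minus_unitization x y = x + - y"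

lift_definition times_unitization ::
  "('a, 'b) unitization \<Rightarrow> ('a, 'b) unitization \<Rightarrow> ('a, 'b) unitization"
  is "\<lambda>(c, f) (d, g). (c * d, \<lambda>A. if complex_algebra A
       then c \<odot>\<^bsub>A\<^esub> g A \<oplus>\<^bsub>A\<^esub> d \<odot>\<^bsub>A\<^esub> f A \<oplus>\<^bsub>A\<^esub> f A \<otimes>\<^bsub>A\<^esub> g A else undefined)"
  by (auto intro!: abelian_monoid.a_closed complex_algebra.scale_closed complex_algebra.m_closed
      complex_algebra_abelian_monoid)

context
  fixes A :: "(complex, 'a, 'b) module_scheme" (structure)
  assumes A: "complex_algebra A"
begin

interpretation complex_algebra A by (rule A)

lemma unitization_mult_assoc:
  assumes "x \<in> carrier A" "y \<in> carrier A" "z \<in> carrier A"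
  shows "(c * d) \<odot> z \<oplus> e \<odot> (c \<odot> y \<oplus> d \<odot> x \<oplus> x \<otimes> y) \<oplus> (c \<odot> y \<oplus> d \<odot> x \<oplus> x \<otimes> y) \<otimes> z
    = c \<odot> (d \<odot> z \<oplus> e \<odot> y \<oplus> y \<otimes> z) \<oplus> (d * e) \<odot> x \<oplus> x \<otimes> (d \<odot> z \<oplus> e \<odot> y \<oplus> y \<otimes> z)"
  using assms
  by (simp add: scale_add_right scale_scale l_distr r_distr smult_mult_left smult_mult_right
      m_assoc m_closed M.a_ac mult.commute mult.left_commute)

lemma unitization_distrib_right:
  assumes "x \<in> carrier A" "y \<in> carrier A" "z \<in> carrier A"
  shows "(c + d) \<odot> z \<oplus> e \<odot> (x \<oplus> y) \<oplus> (x \<oplus> y) \<otimes> z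
    = (c \<odot> z \<oplus> e \<odot> x \<oplus> x \<otimes> z) \<oplus> (d \<odot> z \<oplus> e \<odot> y \<oplus> y \<otimes> z)"
  using assms by (simp add: scale_add_right scale_add_left l_distr m_closed M.a_ac)

lemma unitization_distrib_left:
  assumes "x \<in> carrier A" "y \<in> carrier A" "z \<in> carrier A"
  shows "c \<odot> (y \<oplus> z) \<oplus> (d + e) \<odot> x \<oplus> x \<otimes> (y \<oplus> z)
    = (c \<odot> y \<oplus> d \<odot> x \<oplus> x \<otimes> y) \<oplus> (c \<odot> z \<oplus> e \<odot> x \<oplus> x \<otimes> z)"
  using assms by (simp add: scale_add_right scale_add_left r_distr m_closed M.a_ac)

lemma unitization_abelian:
  assumes "x \<in> carrier A"
  shows "y \<in> carrier A \<Longrightarrow> z \<in> carrier A \<Longrightarrow> x \<oplus> y \<oplus> z = x \<oplus> (y \<oplus> z)"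
    "y \<in> carrier A \<Longrightarrow> x \<oplus> y = y \<oplus> x" "\<zero> \<oplus> x = x" "\<ominus> x \<oplus> x = \<zero>"
    "1 \<odot> x \<oplus> c \<odot> \<zero> \<oplus> \<zero> \<otimes> x = x" "c \<odot> \<zero> \<oplus> 1 \<odot> x \<oplus> x \<otimes> \<zero> = x"
  using assms by (simp_all add: M.a_ac M.r_neg)

end

instance
proof
  fix a b c :: "('a, 'b) unitization"
  show "a + b + c = a + (b + c)"
    by transfer (auto simp: fun_eq_iff unitization_abelian(1))
  show "a + b = b + a"
    by transfer (auto simp: fun_eq_iff unitization_abelian(2))
  show "0 + a = a"
    by transfer (auto simp: fun_eq_iff unitization_abelian(3))
  show "- a + a = 0"
    by transfer (auto simp: fun_eq_iff unitization_abelian(4))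
  show "a - b = a + - b" by (simp add: minus_unitization_def)
  show "a * b * c = a * (b * c)"
    by transfer (auto simp: fun_eq_iff unitization_mult_assoc algebra_simps)
  show "1 * a = a"
    by transfer (auto simp: fun_eq_iff unitization_abelian(5))
  show "a * 1 = a"
    by transfer (auto simp: fun_eq_iff unitization_abelian(6))
  show "(a + b) * c = a * c + b * c"
    by transfer (auto simp: fun_eq_iff unitization_distrib_right algebra_simps)
  show "a * (b + c) = a * b + a * c"
    by transfer (auto simp: fun_eq_iff unitization_distrib_left algebra_simps)
  show "(0 :: ('a, 'b) unitization) \<noteq> 1" by transfer simp
qed

end

text \<open>The scalar \<open>c\<close> times the unit. Left multiplication by it is the scalar
  multiplication of the unitization, so no separate operation for scalars is introduced.\<close>

lift_definition ofc :: "complex \<Rightarrow> ('a, 'm) unitization"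
  is "\<lambda>c. (c, \<lambda>A. if complex_algebra A then \<zero>\<^bsub>A\<^esub> else undefined)"
  by (auto simp: zero_in_carrier)

lift_definition scalar_part :: "('a, 'm) unitization \<Rightarrow> complex" is fst .

lift_definition coordinate :: "(complex, 'a, 'm) module_scheme \<Rightarrow> ('a, 'm) unitization \<Rightarrow> 'a"
  is "\<lambda>A (c, f). f A" .

lift_definition emb :: "(complex, 'a, 'm) module_scheme \<Rightarrow> 'a \<Rightarrow> ('a, 'm) unitization"
  is "\<lambda>A x. (0, \<lambda>B. if complex_algebra B then if B = A \<and> x \<in> carrier A then x else \<zero>\<^bsub>B\<^esub> else undefined)"
  by (auto simp: zero_in_carrier)

lemma ofc_add: "ofc (c + d) = ofc c + ofc d"
  by transfer (auto simp: fun_eq_iff unitization_abelian(3) zero_in_carrier)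

lemma ofc_0 [simp]: "ofc 0 = 0"
  by transfer simp

lemma ofc_1 [simp]: "ofc 1 = 1"
  by transfer simp

context complex_algebra
begin

lemma coordinate_closed [simp]: "coordinate A u \<in> carrier A"
  using complex_algebra_axioms by transfer auto

lemma coordinate_emb [simp]: "x \<in> carrier A \<Longrightarrow> coordinate A (emb A x) = x"
  using complex_algebra_axioms by transfer auto

lemma coordinate_0 [simp]: "coordinate A 0 = \<zero>"
  using complex_algebra_axioms by transfer auto

lemma coordinate_add: "coordinate A (u + v) = coordinate A u \<oplus> coordinate A v"
  using complex_algebra_axioms by transfer auto

lemma coordinate_uminus: "coordinate A (- u) = \<ominus> coordinate A u"
  using complex_algebra_axioms by transfer auto

lemma coordinate_diff: "coordinate A (u - v) = coordinate A u \<ominus> coordinate A v"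
  unfolding minus_unitization_def coordinate_add coordinate_uminus M.minus_eq ..

end

lemma unitization_eqI:
  assumes "scalar_part u = scalar_part v" "\<And>A. complex_algebra A \<Longrightarrow> coordinate A u = coordinate A v"
  shows "u = v"
  using assms by transfer (auto simp: fun_eq_iff split: if_splits; metis)

lemma scalar_part_simps [simp]:
  "scalar_part 0 = 0" "scalar_part 1 = 1" "scalar_part (u + v) = scalar_part u + scalar_part v"
  "scalar_part (u * v) = scalar_part u * scalar_part v" "scalar_part (ofc c) = c"
  "scalar_part (emb A x) = 0" "scalar_part (- u) = - scalar_part u"
  by (transfer, auto)+

lemma coordinate_emb_other: "complex_algebra B \<Longrightarrow> B \<noteq> A \<Longrightarrow> coordinate B (emb A x) = \<zero>\<^bsub>B\<^esub>"
  by transfer auto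

lemma coordinate_ofc: "complex_algebra A \<Longrightarrow> coordinate A (ofc c) = \<zero>\<^bsub>A\<^esub>"
  by transfer auto

lemma coordinate_mult: "complex_algebra A \<Longrightarrow> coordinate A (u * v) =
   scalar_part u \<odot>\<^bsub>A\<^esub> coordinate A v \<oplus>\<^bsub>A\<^esub> scalar_part v \<odot>\<^bsub>A\<^esub> coordinate A u \<oplus>\<^bsub>A\<^esub> coordinate A u \<otimes>\<^bsub>A\<^esub> coordinate A v"
  by transfer auto

lemma ofc_mult_coordinate:
  assumes "complex_algebra A" shows "coordinate A (ofc c * u) = c \<odot>\<^bsub>A\<^esub> coordinate A u" "coordinate A (u * ofc c) = c \<odot>\<^bsub>A\<^esub> coordinate A u"
proof -
  interpret complex_algebra A by fact
  show "coordinate A (ofc c * u) = c \<odot>\<^bsub>A\<^esub> coordinate A u" "coordinate A (u * ofc c) = c \<odot>\<^bsub>A\<^esub> coordinate A u"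
    by (simp_all add: coordinate_mult[OF assms] coordinate_ofc[OF assms])
qed

lemma ofc_central: "ofc c * u = u * ofc c"
  by (rule unitization_eqI) (simp_all add: ofc_mult_coordinate mult.commute)

lemma ofc_mult: "ofc (c * d) = ofc c * ofc d"
  by (rule unitization_eqI) (simp_all add: ofc_mult_coordinate coordinate_ofc complex_algebra.scale_zero)

context complex_algebra
begin

lemma emb_scale: "x \<in> carrier A \<Longrightarrow> emb A (c \<odot> x) = ofc c * emb A x"
  by (rule unitization_eqI, simp)
    (metis complex_algebra.scale_zero complex_algebra_axioms scale_closed ofc_mult_coordinate(1) coordinate_emb coordinate_emb_other)

lemma emb_add:
  assumes "x \<in> carrier A" "y \<in> carrier A" shows "emb A (x \<oplus> y) = emb A x + emb A y"
proof (rule unitization_eqI)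
  fix B :: "(complex, 'a, 'm) module_scheme" assume B: "complex_algebra B"
  show "coordinate B (emb A (x \<oplus> y)) = coordinate B (emb A x + emb A y)"
    using assms B complex_algebra.coordinate_add[OF B] unitization_abelian(3)[OF B zero_in_carrier[OF B]]
    by (cases "B = A") (simp_all add: coordinate_emb_other zero_in_carrier)
qed simp

text \<open>The scalar part of such a product vanishes, and so does its coordinate in every other
  algebra: the image of \<open>emb A\<close> is a two-sided ideal. Hence elements such as
  \<open>1 - q\<close> act on it by multiplication.\<close>

lemma emb_mult_range: "\<exists>y\<in>carrier A. u * emb A x = emb A y" "\<exists>y\<in>carrier A. emb A x * u = emb A y"
proof -
  have "u * emb A x = emb A (coordinate A (u * emb A x))"
  proof (rule unitization_eqI)
    fix B :: "(complex, 'a, 'm) module_scheme" assume B: "complex_algebra B"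
    interpret B: complex_algebra B by fact
    show "coordinate B (u * emb A x) = coordinate B (emb A (coordinate A (u * emb A x)))"
      by (cases "B = A") (simp_all add: coordinate_emb_other B coordinate_mult[OF B])
  qed simp
  then show "\<exists>y\<in>carrier A. u * emb A x = emb A y" using coordinate_closed by blast
  have "emb A x * u = emb A (coordinate A (emb A x * u))"
  proof (rule unitization_eqI)
    fix B :: "(complex, 'a, 'm) module_scheme" assume B: "complex_algebra B"
    interpret B: complex_algebra B by fact
    show "coordinate B (emb A x * u) = coordinate B (emb A (coordinate A (emb A x * u)))"
      by (cases "B = A") (simp_all add: coordinate_emb_other B coordinate_mult[OF B])
  qed simp
  then show "\<exists>y\<in>carrier A. emb A x * u = emb A y" using coordinate_closed by blast
qed

lemma emb_mult:
  assumes "x \<in> carrier A" "y \<in> carrier A" shows "emb A (x \<otimes> y) = emb A x * emb A y"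
proof -
  obtain z where z: "z \<in> carrier A" "emb A x * emb A y = emb A z" using emb_mult_range(1) by blast
  then have "z = coordinate A (emb A x * emb A y)" by simp
  also have "\<dots> = x \<otimes> y" using assms m_closed by (simp add: coordinate_mult[OF complex_algebra_axioms])
  finally show ?thesis using z by simp
qed

lemma emb_zero [simp]: "emb A \<zero> = 0"
  using emb_scale[of \<zero> 0] by simp

lemma emb_eq_iff: "x \<in> carrier A \<Longrightarrow> y \<in> carrier A \<Longrightarrow> emb A x = emb A y \<longleftrightarrow> x = y"
  by (metis coordinate_emb)

lemma emb_finsum: "finite I \<Longrightarrow> f \<in> I \<rightarrow> carrier A \<Longrightarrow> emb A (finsum A f I) = (\<Sum>i\<in>I. emb A (f i))"
proof (induction I rule: finite_induct)
  case (insert i I)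
  then have f: "f \<in> I \<rightarrow> carrier A" "f i \<in> carrier A" by auto
  have "finsum A f (insert i I) = f i \<oplus> finsum A f I"
    by (rule M.finsum_insert) (use insert f in auto)
  then show ?case using f insert by (simp add: emb_add M.finsum_closed)
qed simp

end

section \<open>The universal algebra of generators and relations\<close>

text \<open>Spans in this space replace the finite sums and linear spans of the definitions;
  \<open>emb_finite_sums\<close> and \<open>emb_linear_span\<close> translate.\<close>

interpretation vs: vector_space "\<lambda>c x. ofc c * (x :: ('a, 'm) unitization)"
  by unfold_locales (simp_all add: ofc_add ofc_mult algebra_simps)

lemma ofc_minus_1 [simp]: "ofc (- 1) = - 1"
  using ofc_add[of "- 1" 1] by (simp add: eq_neg_iff_add_eq_0)

context
  fixes X :: "'g set" and R :: "('g alg_term \<times> 'g alg_term) set"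
begin

private abbreviation "cls \<equiv> alg_class X R"

lemma alg_class_eq: "alg_eq R t u \<Longrightarrow> cls t = cls u"
  unfolding alg_class_def by (blast intro: alg_eq.sym alg_eq.trans)

lemma mem_alg_class: "set_alg_term t \<subseteq> X \<Longrightarrow> t \<in> cls t"
  by (simp add: alg_class_def alg_eq.refl)

lemma alg_class_eqD: "cls t = cls u \<Longrightarrow> set_alg_term u \<subseteq> X \<Longrightarrow> alg_eq R t u"
  using mem_alg_class[of u] by (auto simp: alg_class_def)

lemma carrier_universal: "carrier (universal_algebra X R) = {cls t | t. set_alg_term t \<subseteq> X}"
  by (simp add: universal_algebra_def)

lemma alg_class_closed [simp]: "set_alg_term t \<subseteq> X \<Longrightarrow> cls t \<in> carrier (universal_algebra X R)"
  by (auto simp: carrier_universal)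

lemma universal_zero: "\<zero>\<^bsub>universal_algebra X R\<^esub> = cls Zero"
  by (simp add: universal_algebra_def)

lemma mem_alg_classD: "u \<in> cls t \<Longrightarrow> alg_eq R t u"
  by (simp add: alg_class_def)

text \<open>All classes in the union agree by congruence, and the index sets are nonempty because a
  term over \<open>X\<close> belongs to its own class.\<close>

lemma universal_add:
  assumes "set_alg_term t \<subseteq> X" "set_alg_term u \<subseteq> X"
  shows "cls t \<oplus>\<^bsub>universal_algebra X R\<^esub> cls u = cls (Add t u)"
proof -
  have "cls t \<oplus>\<^bsub>universal_algebra X R\<^esub> cls u = (\<Union>t'\<in>cls t. \<Union>u'\<in>cls u. cls (Add t u))"
    unfolding universal_algebra_def ring_record_simps
    by (intro SUP_cong HOL.refl HOL.sym[OF alg_class_eq] alg_eq.cong_add mem_alg_classD)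
  then show ?thesis using assms[THEN mem_alg_class] by auto
qed

lemma universal_mult:
  assumes "set_alg_term t \<subseteq> X" "set_alg_term u \<subseteq> X"
  shows "cls t \<otimes>\<^bsub>universal_algebra X R\<^esub> cls u = cls (Mult t u)"
proof -
  have "cls t \<otimes>\<^bsub>universal_algebra X R\<^esub> cls u = (\<Union>t'\<in>cls t. \<Union>u'\<in>cls u. cls (Mult t u))"
    unfolding universal_algebra_def monoid.simps
    by (intro SUP_cong HOL.refl HOL.sym[OF alg_class_eq] alg_eq.cong_mult mem_alg_classD)
  then show ?thesis using assms[THEN mem_alg_class] by auto
qed

lemma universal_smult:
  assumes "set_alg_term t \<subseteq> X"
  shows "c \<odot>\<^bsub>universal_algebra X R\<^esub> cls t = cls (Scale c t)"
proof -
  have "c \<odot>\<^bsub>universal_algebra X R\<^esub> cls t = (\<Union>t'\<in>cls t. cls (Scale c t))"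
    unfolding universal_algebra_def module.simps
    by (intro SUP_cong HOL.refl HOL.sym[OF alg_class_eq] alg_eq.cong_scale mem_alg_classD)
  then show ?thesis using assms[THEN mem_alg_class] by auto
qed

lemmas universal_simps = universal_zero universal_add universal_mult universal_smult

lemma complex_algebra_universal: "complex_algebra (universal_algebra X R)"
proof -
  let ?U = "universal_algebra X R"
  have ex: "\<exists>t. x = cls t \<and> set_alg_term t \<subseteq> X" if "x \<in> carrier ?U" for x
    using that by (auto simp: carrier_universal)
  have "abelian_group ?U"
  proof (rule abelian_groupI)
    fix x y assume "x \<in> carrier ?U" "y \<in> carrier ?U"
    then obtain t u where t: "x = cls t" "set_alg_term t \<subseteq> X" "y = cls u" "set_alg_term u \<subseteq> X"
      using ex by metis
    show "x \<oplus>\<^bsub>?U\<^esub> y \<in> carrier ?U" using t by (simp add: universal_simps)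
    show "x \<oplus>\<^bsub>?U\<^esub> y = y \<oplus>\<^bsub>?U\<^esub> x"
      using t by (simp add: universal_simps alg_class_eq alg_eq.add_commute)
    fix z assume "z \<in> carrier ?U"
    then obtain w where w: "z = cls w" "set_alg_term w \<subseteq> X" using ex by metis
    show "x \<oplus>\<^bsub>?U\<^esub> y \<oplus>\<^bsub>?U\<^esub> z = x \<oplus>\<^bsub>?U\<^esub> (y \<oplus>\<^bsub>?U\<^esub> z)"
      using t w by (simp add: universal_simps alg_class_eq alg_eq.add_assoc)
  next
    show "\<zero>\<^bsub>?U\<^esub> \<in> carrier ?U" by (simp add: universal_simps)
    fix x assume "x \<in> carrier ?U"
    then obtain t where t: "x = cls t" "set_alg_term t \<subseteq> X" using ex by metis
    have "cls (Add Zero t) = cls t" "cls (Add (Scale (- 1) t) t) = cls Zero"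
      by (auto intro!: alg_class_eq intro: alg_eq.trans[OF alg_eq.add_commute] alg_eq.add_zero
          alg_eq.add_inverse)
    then show "\<zero>\<^bsub>?U\<^esub> \<oplus>\<^bsub>?U\<^esub> x = x" "\<exists>y\<in>carrier ?U. y \<oplus>\<^bsub>?U\<^esub> x = \<zero>\<^bsub>?U\<^esub>"
      using t by (auto simp: universal_simps intro!: bexI[of _ "cls (Scale (- 1) t)"])
  qed
  moreover have "cring complex_ring"
  proof (rule cringI)
    show "abelian_group complex_ring"
      by (rule abelian_groupI) (auto simp: algebra_simps intro: exI[of _ "- x" for x])
    show "comm_monoid complex_ring"
      by (rule comm_monoidI) (auto simp: algebra_simps)
  qed (simp add: algebra_simps)
  ultimately have "module complex_ring ?U"
  proof (intro moduleI)
    fix c x assume "x \<in> carrier ?U"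
    then obtain t where t: "x = cls t" "set_alg_term t \<subseteq> X" using ex by metis
    show "c \<odot>\<^bsub>?U\<^esub> x \<in> carrier ?U" using t by (simp add: universal_simps)
    show "(c \<oplus>\<^bsub>complex_ring\<^esub> d) \<odot>\<^bsub>?U\<^esub> x = c \<odot>\<^bsub>?U\<^esub> x \<oplus>\<^bsub>?U\<^esub> d \<odot>\<^bsub>?U\<^esub> x" for d
      using t by (simp add: universal_simps alg_class_eq alg_eq.scale_add_left)
    show "(c \<otimes>\<^bsub>complex_ring\<^esub> d) \<odot>\<^bsub>?U\<^esub> x = c \<odot>\<^bsub>?U\<^esub> (d \<odot>\<^bsub>?U\<^esub> x)" for d
      using t by (simp add: universal_simps alg_class_eq[OF alg_eq.scale_scale])
    show "\<one>\<^bsub>complex_ring\<^esub> \<odot>\<^bsub>?U\<^esub> x = x"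
      using t by (simp add: universal_simps alg_class_eq[OF alg_eq.scale_one])
    fix y assume "y \<in> carrier ?U"
    then obtain u where u: "y = cls u" "set_alg_term u \<subseteq> X" using ex by metis
    show "c \<odot>\<^bsub>?U\<^esub> (x \<oplus>\<^bsub>?U\<^esub> y) = c \<odot>\<^bsub>?U\<^esub> x \<oplus>\<^bsub>?U\<^esub> c \<odot>\<^bsub>?U\<^esub> y"
      using t u by (simp add: universal_simps alg_class_eq[OF alg_eq.scale_add_right])
  qed
  then show ?thesis
  proof (rule complex_algebra.intro, unfold_locales)
    fix x y assume "x \<in> carrier ?U" "y \<in> carrier ?U"
    then obtain t u where t: "x = cls t" "set_alg_term t \<subseteq> X" "y = cls u" "set_alg_term u \<subseteq> X"
      using ex by metis
    show "x \<otimes>\<^bsub>?U\<^esub> y \<in> carrier ?U" using t by (simp add: universal_simps)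
    show "c \<odot>\<^bsub>?U\<^esub> x \<otimes>\<^bsub>?U\<^esub> y = c \<odot>\<^bsub>?U\<^esub> (x \<otimes>\<^bsub>?U\<^esub> y)" for c
      using t by (simp add: universal_simps alg_class_eq[OF alg_eq.scale_mult_left])
    show "x \<otimes>\<^bsub>?U\<^esub> (c \<odot>\<^bsub>?U\<^esub> y) = c \<odot>\<^bsub>?U\<^esub> (x \<otimes>\<^bsub>?U\<^esub> y)" for c
      using t by (simp add: universal_simps alg_class_eq[OF alg_eq.scale_mult_right])
    fix z assume "z \<in> carrier ?U"
    then obtain w where w: "z = cls w" "set_alg_term w \<subseteq> X" using ex by metis
    show "x \<otimes>\<^bsub>?U\<^esub> y \<otimes>\<^bsub>?U\<^esub> z = x \<otimes>\<^bsub>?U\<^esub> (y \<otimes>\<^bsub>?U\<^esub> z)"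
      using t w by (simp add: universal_simps alg_class_eq[OF alg_eq.mult_assoc])
    show "(x \<oplus>\<^bsub>?U\<^esub> y) \<otimes>\<^bsub>?U\<^esub> z = x \<otimes>\<^bsub>?U\<^esub> z \<oplus>\<^bsub>?U\<^esub> y \<otimes>\<^bsub>?U\<^esub> z"
      using t w by (simp add: universal_simps alg_class_eq[OF alg_eq.distrib_right])
    show "z \<otimes>\<^bsub>?U\<^esub> (x \<oplus>\<^bsub>?U\<^esub> y) = z \<otimes>\<^bsub>?U\<^esub> x \<oplus>\<^bsub>?U\<^esub> z \<otimes>\<^bsub>?U\<^esub> y"
      using t w by (simp add: universal_simps alg_class_eq[OF alg_eq.distrib_left])
  qed
qed

end

primrec term_value :: "('g \<Rightarrow> ('a, 'm) unitization) \<Rightarrow> 'g alg_term \<Rightarrow> ('a, 'm) unitization" where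
  "term_value \<theta> (Gen g) = \<theta> g"
| "term_value \<theta> Zero = 0"
| "term_value \<theta> (Add t u) = term_value \<theta> t + term_value \<theta> u"
| "term_value \<theta> (Mult t u) = term_value \<theta> t * term_value \<theta> u"
| "term_value \<theta> (Scale c t) = ofc c * term_value \<theta> t"

text \<open>Soundness of the equational calculus. A derivation may pass through terms with arbitrary
  generators; this does no harm since \<open>\<theta>\<close> is total and the hypothesis covers all
  of \<open>R\<close>.\<close>

lemma term_value_alg_eq:
  assumes R: "\<And>t u. (t, u) \<in> R \<Longrightarrow> term_value \<theta> t = term_value \<theta> u"
    and "alg_eq R t u"
  shows "term_value \<theta> t = term_value \<theta> u"
  using assms(2)
proof induction
  case (scale_mult_right t c u)
  show ?case by simp (metis ofc_central mult.assoc)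
qed (simp_all add: R ofc_add mult.assoc add.assoc semiring_class.distrib_left semiring_class.distrib_right add.commute)

lemma emb_alg_class:
  assumes "set_alg_term t \<subseteq> X"
  shows "emb (universal_algebra X R) (alg_class X R t)
    = term_value (\<lambda>g. emb (universal_algebra X R) (alg_class X R (Gen g))) t"
proof -
  interpret complex_algebra "universal_algebra X R" by (rule complex_algebra_universal)
  show ?thesis
    using assms
  proof (induction t)
    case Zero
    then show ?case using emb_zero by (simp add: universal_zero)
  next
    case (Add t u)
    then show ?case using emb_add[of "alg_class X R t" "alg_class X R u"]
      by (simp add: universal_add)
  next
    case (Mult t u)
    then show ?case using emb_mult[of "alg_class X R t" "alg_class X R u"]
      by (simp add: universal_mult)
  next
    case (Scale c t)
    then show ?case using emb_scale[of "alg_class X R t" c]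
      by (simp add: universal_smult)
  qed simp
qed

context complex_algebra
begin

text \<open>A further summand at index \<open>n\<close> that absorbs its coefficient mirrors the
  induction over the span; this is where \<open>S\<close> has to be closed under scalars.\<close>

lemma emb_finite_sums:
  assumes S: "S \<subseteq> carrier A" and scale: "\<And>c x. x \<in> S \<Longrightarrow> c \<odot> x \<in> S"
  shows "emb A ` finite_sums A S = vs.span (emb A ` S)"
proof (intro equalityI subsetI)
  fix u assume "u \<in> emb A ` finite_sums A S"
  then obtain f and n :: nat where f: "f \<in> {..<n} \<rightarrow> S" "u = emb A (finsum A f {..<n})"
    by (auto simp: finite_sums_def)
  then have "u = (\<Sum>i<n. emb A (f i))" using S by (subst f(2), intro emb_finsum) auto
  also have "\<dots> \<in> vs.span (emb A ` S)" using f(1) by (intro vs.span_sum vs.span_base) auto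
  finally show "u \<in> vs.span (emb A ` S)" .
next
  fix u assume "u \<in> vs.span (emb A ` S)"
  then show "u \<in> emb A ` finite_sums A S"
  proof (induction rule: vs.span_induct_alt)
    case base
    have "\<zero> \<in> finite_sums A S"
      unfolding finite_sums_def by (intro CollectI exI[of _ "\<lambda>_. \<zero>"] exI[of _ "0 :: nat"]) simp
    then show ?case by (metis emb_zero imageI)
  next
    case (step c u v)
    then obtain x f and n :: nat where x: "x \<in> S" "u = emb A x"
      and f: "f \<in> {..<n} \<rightarrow> S" "v = emb A (finsum A f {..<n})"
      by (auto simp: finite_sums_def)
    define g where "g = f(n := c \<odot> x)"
    have g: "g \<in> {..<Suc n} \<rightarrow> S" using f x scale by (auto simp: g_def less_Suc_eq)
    then have gn: "g n \<in> carrier A" using S by auto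
    have "finsum A g {..<n} = finsum A f {..<n}"
      by (rule M.finsum_cong') (use f S in \<open>auto simp: g_def\<close>)
    moreover have "finsum A f {..<n} \<in> carrier A" by (rule M.finsum_closed) (use f S in auto)
    moreover have "finsum A g {..<Suc n} = g n \<oplus> finsum A g {..<n}"
      unfolding lessThan_Suc by (rule M.finsum_insert) (use g S in auto)
    ultimately have "emb A (finsum A g {..<Suc n}) = ofc c * u + v"
      using gn f x S by (simp add: emb_add) (simp add: g_def emb_scale subset_iff)
    then show ?case using g unfolding finite_sums_def
      by (intro image_eqI[of _ _ "finsum A g {..<Suc n}"]) auto
  qed
qed

lemma emb_linear_span:
  assumes S: "S \<subseteq> carrier A"
  shows "emb A ` linear_span A S = vs.span (emb A ` S)"
proof -
  let ?T = "{c \<odot> x | c x. x \<in> S}"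
  have "emb A ` linear_span A S = vs.span (emb A ` ?T)"
    unfolding linear_span_def using S by (intro emb_finite_sums) (auto simp: scale_scale subset_iff, metis)
  also have "\<dots> = vs.span (emb A ` S)"
  proof (rule vs.span_eq[THEN iffD2], intro conjI subsetI)
    fix u assume "u \<in> emb A ` ?T"
    then obtain c x where "x \<in> S" "u = ofc c * emb A x" using S emb_scale by blast
    then show "u \<in> vs.span (emb A ` S)" by (simp add: vs.span_base vs.span_scale)
  next
    fix u assume "u \<in> emb A ` S"
    then obtain x where x: "x \<in> S" "u = emb A x" by auto
    then have "x \<in> ?T" using S by (auto intro!: exI[of _ 1] exI[of _ x])
    then show "u \<in> vs.span (emb A ` ?T)" using x by (intro vs.span_base) auto
  qed
  finally show ?thesis .
qed

lemma set_prod_subset_carrier: "S \<subseteq> carrier A \<Longrightarrow> T \<subseteq> carrier A \<Longrightarrow> set_prod A S T \<subseteq> carrier A"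
  by (auto simp: set_prod_def m_closed subset_iff)

lemma emb_set_prod:
  assumes "S \<subseteq> carrier A" "T \<subseteq> carrier A"
  shows "emb A ` set_prod A S T = {u * v | u v. u \<in> emb A ` S \<and> v \<in> emb A ` T}"
proof -
  have "emb A (x \<otimes> y) = emb A x * emb A y" if "x \<in> S" "y \<in> T" for x y
    using assms that by (intro emb_mult) auto
  then show ?thesis unfolding set_prod_def by (auto 4 4 simp: image_iff)
qed

lemma finite_sums_closed: "S \<subseteq> carrier A \<Longrightarrow> finite_sums A S \<subseteq> carrier A"
  by (auto simp: finite_sums_def intro!: M.finsum_closed)

lemma linear_span_closed: "S \<subseteq> carrier A \<Longrightarrow> linear_span A S \<subseteq> carrier A"
  unfolding linear_span_def by (rule finite_sums_closed) auto

lemma emb_image_eq_iff: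
  "S \<subseteq> carrier A \<Longrightarrow> T \<subseteq> carrier A \<Longrightarrow> emb A ` S = emb A ` T \<longleftrightarrow> S = T"
  using inj_on_image_eq_iff[of "emb A" "carrier A" S T] by (simp add: inj_on_def emb_eq_iff)

end

section \<open>Leavitt families\<close>

text \<open>The element usually written as \<open>s_a p_A\<close> followed by the adjoint of
  \<open>s_b\<close>: the ghosts appear in reverse order, so \<open>b\<close> is read like a path.
  No path condition is imposed; a word that violates it has value 0.\<close>

fun mono_term :: "'e list \<Rightarrow> 'v set \<Rightarrow> 'e list \<Rightarrow> ('v, 'e) lpa_gen alg_term" where
  "mono_term (e # a) A b = Mult (Gen (Edge e)) (mono_term a A b)"
| "mono_term [] A (f # b) = Mult (mono_term [] A b) (Gen (Ghost f))"
| "mono_term [] A [] = Gen (Proj A)"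

context ultragraph
begin

lemma gverts_Int: "A \<in> gverts G \<Longrightarrow> B \<in> gverts G \<Longrightarrow> A \<inter> B \<in> gverts G"
  using gverts.Inter[of "{A, B}" G] by auto

lemma gverts_Un: "A \<in> gverts G \<Longrightarrow> B \<in> gverts G \<Longrightarrow> A \<union> B \<in> gverts G"
  using gverts.Union[of "{A, B}" G] by auto

lemma gverts_empty: "{} \<in> gverts G"
  using gverts.Union[of "{}" G] by auto

lemma gverts_src: "e \<in> edges G \<Longrightarrow> {src G e} \<in> gverts G"
  by (simp add: gverts.vertex src_in_verts)

lemma gverts_subset: "A \<in> gverts G \<Longrightarrow> A \<subseteq> verts G"
  by (induction rule: gverts.induct) (use rng_subset in blast)+

end

text \<open>One setting for all interpretations of the generators: the Leavitt path algebra itself,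
  its image in the C*-algebra, and the rescalings of either by a nonzero scalar.\<close>

locale leavitt_family = ultragraph G
  for G :: "('v, 'e) ultragraph" +
  fixes \<theta> :: "('v, 'e) lpa_gen \<Rightarrow> ('w, 'm) unitization"
  assumes relations: "(t, u) \<in> lpa_rels G \<Longrightarrow> term_value \<theta> t = term_value \<theta> u"
begin

abbreviation S where "S e \<equiv> \<theta> (Edge e)"
abbreviation T where "T e \<equiv> \<theta> (Ghost e)"
abbreviation P where "P A \<equiv> \<theta> (Proj A)"
abbreviation mono where "mono a A b \<equiv> term_value \<theta> (mono_term a A b)"

lemma P_empty [simp]: "P {} = 0"
  using relations[OF lpa_rels.proj_empty] by simp

lemma P_mult: "A \<in> gverts G \<Longrightarrow> B \<in> gverts G \<Longrightarrow> P A * P B = P (A \<inter> B)"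
  using relations[OF lpa_rels.proj_Int] by simp

lemma P_Un: "A \<in> gverts G \<Longrightarrow> B \<in> gverts G \<Longrightarrow> P (A \<union> B) = P A + P B - P (A \<inter> B)"
  using relations[OF lpa_rels.proj_Un] by simp

lemma P_src_S: "e \<in> edges G \<Longrightarrow> P {src G e} * S e = S e"
  using relations[OF lpa_rels.src_edge] by simp

lemma S_P_rng: "e \<in> edges G \<Longrightarrow> S e * P (rng G e) = S e"
  using relations[OF lpa_rels.edge_rng] by simp

lemma P_rng_T: "e \<in> edges G \<Longrightarrow> P (rng G e) * T e = T e"
  using relations[OF lpa_rels.rng_ghost] by simp

lemma T_P_src: "e \<in> edges G \<Longrightarrow> T e * P {src G e} = T e"
  using relations[OF lpa_rels.ghost_src] by simp

lemma T_S: "e \<in> edges G \<Longrightarrow> f \<in> edges G \<Longrightarrow> T e * S f = (if e = f then P (rng G e) else 0)"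
  using relations[OF lpa_rels.ghost_edge, of e f] by (auto split: if_splits)

lemma P_vertex_sum:
  assumes "v \<in> verts G" "finite (out_edges G v)" "out_edges G v \<noteq> {}"
  shows "P {v} = (\<Sum>e\<in>out_edges G v. S e * T e)"
proof -
  obtain es where es: "set es = out_edges G v" "distinct es"
    using finite_distinct_list[OF assms(2)] by blast
  have "term_value \<theta> (foldr (\<lambda>e t. Add (Mult (Gen (Edge e)) (Gen (Ghost e))) t) es Zero)
    = (\<Sum>e\<in>set es. S e * T e)"
    using es(2) by (induction es) auto
  moreover have "es \<noteq> []" using es(1) assms(3) by auto
  ultimately show ?thesis
    using relations[OF lpa_rels.vertex_sum[OF assms(1) _ es(2,1)]] es(1) by simp
qed

lemma P_S:
  assumes "A \<in> gverts G" "e \<in> edges G"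
  shows "P A * S e = (if src G e \<in> A then S e else 0)"
proof -
  have "P A * S e = P (A \<inter> {src G e}) * S e"
    unfolding P_mult[OF assms(1) gverts_src[OF assms(2)], symmetric] mult.assoc P_src_S[OF assms(2)] ..
  then show ?thesis using assms by (simp add: P_src_S Int_insert_right)
qed

lemma T_P:
  assumes "A \<in> gverts G" "e \<in> edges G"
  shows "T e * P A = (if src G e \<in> A then T e else 0)"
proof -
  have "T e * P A = T e * P ({src G e} \<inter> A)"
    unfolding P_mult[OF gverts_src[OF assms(2)] assms(1), symmetric] mult.assoc[symmetric] T_P_src[OF assms(2)] ..
  then show ?thesis using assms by (simp add: T_P_src Int_insert_left)
qed

definition monomials :: "int \<Rightarrow> ('w, 'm) unitization set" where
  "monomials n = {mono a A b | a A b. set a \<subseteq> edges G \<and> set b \<subseteq> edges G \<and> A \<in> gverts G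
     \<and> int (length a) - int (length b) = n}"

definition component :: "int \<Rightarrow> ('w, 'm) unitization set" where
  "component n = vs.span (monomials n)"

lemma monomialsI: "set a \<subseteq> edges G \<Longrightarrow> set b \<subseteq> edges G \<Longrightarrow> A \<in> gverts G \<Longrightarrow>
    int (length a) - int (length b) = n \<Longrightarrow> mono a A b \<in> monomials n"
  by (auto simp: monomials_def)

lemma component_mono: "x \<in> monomials n \<Longrightarrow> x \<in> component n"
  by (simp add: component_def vs.span_base)

lemma component_0 [simp]: "0 \<in> component n"
  and component_add: "x \<in> component n \<Longrightarrow> y \<in> component n \<Longrightarrow> x + y \<in> component n"
  and component_diff: "x \<in> component n \<Longrightarrow> y \<in> component n \<Longrightarrow> x - y \<in> component n"
  and component_scale: "x \<in> component n \<Longrightarrow> ofc c * x \<in> component n"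
  by (simp_all add: component_def vs.span_zero vs.span_add vs.span_diff vs.span_scale)

lemma mult_span_subset:
  assumes "x \<in> vs.span M" "\<And>m. m \<in> M \<Longrightarrow> y * m \<in> vs.span N"
  shows "y * x \<in> vs.span N"
  using assms(1)
proof (induction rule: vs.span_induct_alt)
  case (step c u v)
  have "y * (ofc c * u) = ofc c * (y * u)" by (metis mult.assoc ofc_central)
  then show ?case using step assms(2) by (simp add: semiring_class.distrib_left vs.span_add vs.span_scale)
qed (simp add: vs.span_zero)

lemma span_mult_subset:
  assumes "x \<in> vs.span M" "\<And>m. m \<in> M \<Longrightarrow> m * y \<in> vs.span N"
  shows "x * y \<in> vs.span N"
  using assms(1)
proof (induction rule: vs.span_induct_alt)
  case (step c u v)
  then show ?case using assms(2) by (simp add: semiring_class.distrib_right mult.assoc vs.span_add vs.span_scale)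
qed (simp add: vs.span_zero)

lemma P_mono_Nil: "A \<in> gverts G \<Longrightarrow> B \<in> gverts G \<Longrightarrow> P B * mono [] A b = mono [] (B \<inter> A) b"
  by (induction b) (simp_all add: P_mult mult.assoc[symmetric])

text \<open>\<open>T e\<close> either absorbs \<open>P A\<close> or is killed by it, according to
  its source. The projection that a monomial must contain is then restored by
  \<open>T e = P (rng G e) * T e\<close>.\<close>

lemma T_mono_Nil: "A \<in> gverts G \<Longrightarrow> e \<in> edges G \<Longrightarrow>
    T e * mono [] A b = (if src G e \<in> A then mono [] (rng G e) (b @ [e]) else 0)"
  by (induction b) (simp_all add: T_P mult.assoc[symmetric] P_rng_T)

lemma S_component: "x \<in> component n \<Longrightarrow> e \<in> edges G \<Longrightarrow> S e * x \<in> component (n + 1)"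
  unfolding component_def
proof (rule mult_span_subset, assumption)
  fix m assume "m \<in> monomials n" and e: "e \<in> edges G"
  then obtain a A b where m: "m = mono a A b" "set a \<subseteq> edges G" "set b \<subseteq> edges G" "A \<in> gverts G"
    "int (length a) - int (length b) = n" by (auto simp: monomials_def)
  then have "mono (e # a) A b \<in> monomials (n + 1)" using e by (intro monomialsI) auto
  moreover have "S e * m = mono (e # a) A b" using m by simp
  ultimately have "S e * m \<in> monomials (n + 1)" by metis
  then show "S e * m \<in> vs.span (monomials (n + 1))" by (rule vs.span_base)
qed

lemma P_component: "x \<in> component n \<Longrightarrow> B \<in> gverts G \<Longrightarrow> P B * x \<in> component n"
  unfolding component_def
proof (rule mult_span_subset, assumption)
  fix m assume "m \<in> monomials n" and B: "B \<in> gverts G"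
  then obtain a A b where m: "m = mono a A b" "set a \<subseteq> edges G" "set b \<subseteq> edges G" "A \<in> gverts G"
    "int (length a) - int (length b) = n" by (auto simp: monomials_def)
  show "P B * m \<in> vs.span (monomials n)"
  proof (cases a)
    case Nil
    then show ?thesis using m B
      by (auto simp: P_mono_Nil intro!: vs.span_base monomialsI gverts_Int)
  next
    case (Cons e a')
    then have "P B * m = (if src G e \<in> B then m else 0)"
      using m B by (simp add: mult.assoc[symmetric] P_S)
    then show ?thesis using m by (auto intro!: vs.span_base vs.span_zero monomialsI)
  qed
qed

lemma T_component: "x \<in> component n \<Longrightarrow> e \<in> edges G \<Longrightarrow> T e * x \<in> component (n - 1)"
  unfolding component_def
proof (rule mult_span_subset, assumption)
  fix m assume "m \<in> monomials n" and e: "e \<in> edges G"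
  then obtain a A b where m: "m = mono a A b" "set a \<subseteq> edges G" "set b \<subseteq> edges G" "A \<in> gverts G"
    "int (length a) - int (length b) = n" by (auto simp: monomials_def)
  show "T e * m \<in> vs.span (monomials (n - 1))"
  proof (cases a)
    case Nil
    then show ?thesis using m e
      by (auto simp: T_mono_Nil intro!: vs.span_base vs.span_zero monomialsI gverts.range)
  next
    case (Cons f a')
    then have "T e * m = (if e = f then P (rng G e) * mono a' A b else 0)"
      using m e by (simp add: mult.assoc[symmetric] T_S)
    moreover have "P (rng G e) * mono a' A b \<in> component (n - 1)"
      using m e Cons by (intro P_component component_mono monomialsI gverts.range) auto
    ultimately show ?thesis by (auto simp: component_def vs.span_zero)
  qed
qed

text \<open>The letters of the left factor are multiplied on one at a time, which avoids the usual
  comparison of the two inner words in a product of monomials.\<close>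

lemma mono_component:
  "set a \<subseteq> edges G \<Longrightarrow> set b \<subseteq> edges G \<Longrightarrow> A \<in> gverts G \<Longrightarrow> x \<in> component n
    \<Longrightarrow> mono a A b * x \<in> component (int (length a) - int (length b) + n)"
proof (induction a A b arbitrary: x n rule: mono_term.induct)
  case (1 e a A b)
  then show ?case using S_component[OF "1.IH"[OF _ _ _ "1.prems"(4)], of e] by (simp add: mult.assoc add_ac diff_add_eq add_diff_eq)
next
  case (2 A f b)
  then show ?case using T_component[of x n f] by (fastforce simp: mult.assoc algebra_simps)
qed (simp add: P_component)

lemma component_mult:
  assumes "y \<in> component m" "x \<in> component n" shows "y * x \<in> component (m + n)"
  using assms(1) unfolding component_def[of m]
proof (unfold component_def[of "m + n"], rule span_mult_subset)
  fix z assume "z \<in> monomials m"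
  then show "z * x \<in> vs.span (monomials (m + n))"
    using mono_component[OF _ _ _ assms(2)] by (auto simp: monomials_def component_def)
qed

text \<open>The rightmost factor is a ghost edge, which absorbs the projection at its source, or it
  is the projection \<open>P A\<close> itself.\<close>

lemma right_local_unit:
  assumes "x \<in> monomials n" shows "\<exists>B\<in>gverts G. x * P B = x"
proof -
  obtain a A b where *: "x = mono a A b" "set a \<subseteq> edges G" "set b \<subseteq> edges G" "A \<in> gverts G"
    using assms by (auto simp: monomials_def)
  have "\<exists>B\<in>gverts G. mono a A b * P B = mono a A b"
    using *(2-)
  proof (induction a A b rule: mono_term.induct)
    case (1 e a A b)
    then show ?case by (auto simp: mult.assoc) metis
  next
    case (2 A f b)
    then show ?case by (auto simp: mult.assoc T_P gverts_src intro!: bexI[of _ "{src G f}"])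
  next
    case (3 A)
    then show ?case by (auto simp: P_mult intro!: bexI[of _ A])
  qed
  then show ?thesis using * by simp
qed

text \<open>Let \<open>z\<close> be a monomial of degree \<open>m + n\<close> with
  \<open>z = z * P B\<close>. A decomposition of \<open>P B\<close> into products of degrees
  \<open>- n\<close> and \<open>n\<close> yields one of \<open>z\<close> into degrees
  \<open>m\<close> and \<open>n\<close>, because \<open>z\<close> times an element of degree
  \<open>- n\<close> has degree \<open>m\<close>.\<close>

lemma strongly_graded_iff:
  "(\<forall>m n. vs.span {x * y | x y. x \<in> component m \<and> y \<in> component n} = component (m + n)) \<longleftrightarrow>
   (\<forall>n. \<forall>A\<in>gverts G. P A \<in> vs.span {x * y | x y. x \<in> component (- n) \<and> y \<in> component n})"
  (is "?strong \<longleftrightarrow> ?units")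
proof
  have P: "P A \<in> component 0" if "A \<in> gverts G" for A
    using monomialsI[of "[]" "[]" A 0] that by (auto intro: component_mono)
  {
    assume ?strong
    then show ?units using P by (metis add.left_inverse)
  next
    assume units: ?units
    show ?strong
    proof (intro allI equalityI subsetI)
      fix m n x assume "x \<in> vs.span {x * y | x y. x \<in> component m \<and> y \<in> component n}"
      moreover have "vs.span {x * y | x y. x \<in> component m \<and> y \<in> component n} \<subseteq> component (m + n)"
        by (intro vs.span_minimal) (auto simp: component_mult, simp add: component_def)
      ultimately show "x \<in> component (m + n)" by blast
    next
      fix m n x assume x: "x \<in> component (m + n)"
      have "z \<in> vs.span {x * y | x y. x \<in> component m \<and> y \<in> component n}" if z: "z \<in> monomials (m + n)" for z
      proof -
        obtain B where B: "B \<in> gverts G" "z * P B = z" using right_local_unit[OF z] by blast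
        have "z * P B \<in> vs.span {x * y | x y. x \<in> component m \<and> y \<in> component n}"
        proof (rule mult_span_subset)
          show "P B \<in> vs.span {x * y | x y. x \<in> component (- n) \<and> y \<in> component n}"
            using units B by blast
          fix w assume "w \<in> {x * y | x y. x \<in> component (- n) \<and> y \<in> component n}"
          then obtain x y where w: "w = x * y" "x \<in> component (- n)" "y \<in> component n" by blast
          have "z * x \<in> component m" using component_mult[OF component_mono[OF z] w(2)] by simp
          then show "z * w \<in> vs.span {x * y | x y. x \<in> component m \<and> y \<in> component n}"
            using w by (intro vs.span_base CollectI exI[of _ "z * x"] exI[of _ y]) (simp add: mult.assoc)
        qed
        then show ?thesis using B by simp
      qed
      then have "vs.span (monomials (m + n)) \<subseteq> vs.span {x * y | x y. x \<in> component m \<and> y \<in> component n}"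
        by (intro vs.span_minimal vs.subspace_span) auto
      then show "x \<in> vs.span {x * y | x y. x \<in> component m \<and> y \<in> component n}"
        using x by (auto simp: component_def)
    qed
  }
qed

end

section \<open>The component of degree zero\<close>

context leavitt_family
begin

text \<open>The span of \<open>nest \<A> F n\<close> is a matricial subalgebra when \<open>\<A>\<close> is closed under intersections
  and contains the ranges of the edges in \<open>F\<close>.\<close>

primrec nest :: "'v set set \<Rightarrow> 'e set \<Rightarrow> nat \<Rightarrow> ('w, 'm) unitization set" where
  "nest \<A> F 0 = insert 0 (P ` \<A>)"
| "nest \<A> F (Suc n) = insert 0 (P ` \<A>) \<union> {S e * x * T f | e f x. e \<in> F \<and> f \<in> F \<and> x \<in> nest \<A> F n}"

lemma finite_nest: "finite \<A> \<Longrightarrow> finite F \<Longrightarrow> finite (nest \<A> F n)"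
proof (induction n)
  case (Suc n)
  have "{S e * x * T f | e f x. e \<in> F \<and> f \<in> F \<and> x \<in> nest \<A> F n}
    = (\<lambda>(e, f, x). S e * x * T f) ` (F \<times> F \<times> nest \<A> F n)" by force
  then show ?case using Suc by simp
qed simp

lemma nest_0_subset: "0 \<in> nest \<A> F n" "A \<in> \<A> \<Longrightarrow> P A \<in> nest \<A> F n"
  by (cases n; simp)+

lemma nest_mono: "\<A> \<subseteq> \<A>' \<Longrightarrow> F \<subseteq> F' \<Longrightarrow> n \<le> n' \<Longrightarrow> nest \<A> F n \<subseteq> nest \<A>' F' n'"
proof (induction n arbitrary: n')
  case 0
  then show ?case using nest_0_subset(1)[of \<A>' F' n'] nest_0_subset(2)[of _ \<A>' F' n'] by auto
next
  case (Suc n)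
  then obtain k where k: "n' = Suc k" "n \<le> k" by (cases n') auto
  show ?case using Suc.IH[OF Suc.prems(1,2) k(2)] Suc.prems unfolding k by auto blast
qed

lemma P_nest:
  assumes "x \<in> nest \<A> F n" "A \<in> \<A>" "\<A> \<subseteq> gverts G" "F \<subseteq> edges G"
    and Int: "\<And>A B. A \<in> \<A> \<Longrightarrow> B \<in> \<A> \<Longrightarrow> A \<inter> B \<in> \<A>"
  shows "P A * x \<in> nest \<A> F n" "x * P A \<in> nest \<A> F n"
proof -
  have "x = 0 \<or> (\<exists>B\<in>\<A>. x = P B) \<or> (\<exists>e\<in>F. \<exists>f\<in>F. \<exists>y. x = S e * y * T f)"
    using assms(1) by (cases n) auto
  then consider "x = 0" | B where "B \<in> \<A>" "x = P B" | e f y where "e \<in> F" "f \<in> F" "x = S e * y * T f"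
    by blast
  then have "P A * x \<in> nest \<A> F n \<and> x * P A \<in> nest \<A> F n"
  proof cases
    case 1
    then show ?thesis using nest_0_subset by simp
  next
    case 2
    then have "P A * x = P (A \<inter> B)" "x * P A = P (B \<inter> A)" using assms(2,3) P_mult by blast+
    then show ?thesis using nest_0_subset(2) Int 2 assms(2) by simp
  next
    case 3
    have "A \<in> gverts G" "e \<in> edges G" "f \<in> edges G" using assms 3 by auto
    then have "P A * x = (if src G e \<in> A then x else 0)" "x * P A = (if src G f \<in> A then x else 0)"
      unfolding 3 by (simp add: mult.assoc[symmetric] P_S, simp add: mult.assoc T_P)
    then show ?thesis using assms(1) nest_0_subset by auto
  qed
  then show "P A * x \<in> nest \<A> F n" "x * P A \<in> nest \<A> F n" by auto
qed

lemma S_T_mult: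
  "f \<in> edges G \<Longrightarrow> g \<in> edges G \<Longrightarrow>
   (S e * x * T f) * (S g * y * T h) = (if f = g then S e * ((x * P (rng G f)) * y) * T h else 0)"
  using T_S[of f g] by (simp add: mult.assoc) (metis mult.assoc mult_zero_left mult_zero_right)

lemma nest_mult:
  assumes "\<A> \<subseteq> gverts G" "F \<subseteq> edges G" and Int: "\<And>A B. A \<in> \<A> \<Longrightarrow> B \<in> \<A> \<Longrightarrow> A \<inter> B \<in> \<A>"
    and rng: "\<And>e. e \<in> F \<Longrightarrow> rng G e \<in> \<A>"
  shows "x \<in> nest \<A> F n \<Longrightarrow> y \<in> nest \<A> F n \<Longrightarrow> x * y \<in> nest \<A> F n"
proof (induction n arbitrary: x y)
  case 0
  then show ?case using P_nest(1)[OF _ _ assms(1-3), of y 0] nest_0_subset(1)[of \<A> F 0] by auto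
next
  case (Suc n)
  consider "x = 0" | A where "A \<in> \<A>" "x = P A"
    | e f u where "e \<in> F" "f \<in> F" "x = S e * u * T f" "u \<in> nest \<A> F n"
    using Suc.prems(1) by auto
  then show ?case
  proof cases
    case 1
    then show ?thesis using nest_0_subset(1) by simp
  next
    case 2
    then show ?thesis using P_nest(1)[OF Suc.prems(2) _ assms(1-3)] by blast
  next
    case x: 3
    consider "y = 0" | B where "B \<in> \<A>" "y = P B"
      | g h v where "g \<in> F" "h \<in> F" "y = S g * v * T h" "v \<in> nest \<A> F n"
      using Suc.prems(2) by auto
    then show ?thesis
    proof cases
      case 1
      then show ?thesis using nest_0_subset(1) by simp
    next
      case 2
      then show ?thesis using P_nest(2)[OF Suc.prems(1) _ assms(1-3)] by blast
    next
      case y: 3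
      have "(u * P (rng G f)) * v \<in> nest \<A> F n"
        by (rule Suc.IH[OF Suc.IH[OF x(4) nest_0_subset(2)[OF rng[OF x(2)]]] y(4)])
      then have "S e * ((u * P (rng G f)) * v) * T h \<in> nest \<A> F (Suc n)" using x y by auto
      moreover have "x * y = (if f = g then S e * ((u * P (rng G f)) * v) * T h else 0)"
        unfolding x y using assms(2) x y by (intro S_T_mult) auto
      ultimately show ?thesis using nest_0_subset(1)[of \<A> F "Suc n"] by (cases "f = g") (simp_all only: simp_thms if_True if_False)
    qed
  qed
qed

lemma mono_Cons_right: "mono a A (f # b) = mono a A b * T f"
  by (induction a) (simp_all add: mult.assoc)

lemma mono_nest:
  "length a = length b \<Longrightarrow> set a \<subseteq> F \<Longrightarrow> set b \<subseteq> F \<Longrightarrow> A \<in> \<A> \<Longrightarrow> mono a A b \<in> nest \<A> F (length a)"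
proof (induction a b rule: list_induct2)
  case (Cons e a f b)
  have "mono (e # a) A (f # b) = S e * mono a A b * T f"
    by (simp add: mono_Cons_right mult.assoc)
  then show ?case using Cons by auto
qed simp

text \<open>A given element involves only finitely many sets and edges, and the level
  \<open>n\<close> bounds the length of its words. The last two properties are those that make the
  span a subalgebra, see \<open>nest_mult\<close>.\<close>

lemma component_0_in_nest:
  assumes "x \<in> component 0"
  obtains \<A> F n where "finite \<A>" "\<A> \<subseteq> gverts G" "finite F" "F \<subseteq> edges G" "x \<in> vs.span (nest \<A> F n)"
    "\<And>A B. A \<in> \<A> \<Longrightarrow> B \<in> \<A> \<Longrightarrow> A \<inter> B \<in> \<A>" "\<And>e. e \<in> F \<Longrightarrow> rng G e \<in> \<A>"
proof -
  have "\<exists>\<A> F n. finite \<A> \<and> \<A> \<subseteq> gverts G \<and> finite F \<and> F \<subseteq> edges G \<and> x \<in> vs.span (nest \<A> F n)"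
    using assms unfolding component_def
  proof (induction rule: vs.span_induct_alt)
    case base
    show ?case
      by (rule exI[of _ "{}"], rule exI[of _ "{}"], rule exI[of _ 0]) (auto intro: vs.span_zero)
  next
    case (step c u v)
    obtain a A b where u: "u = mono a A b" "set a \<subseteq> edges G" "set b \<subseteq> edges G" "A \<in> gverts G"
      "length a = length b" using step(1) by (auto simp: monomials_def)
    obtain \<A> F n where v: "finite \<A>" "\<A> \<subseteq> gverts G" "finite F" "F \<subseteq> edges G" "v \<in> vs.span (nest \<A> F n)"
      using step by blast
    define \<A>' F' n' where "\<A>' = insert A \<A>" "F' = set a \<union> set b \<union> F" "n' = max (length a) n"
    have "nest \<A> F n \<subseteq> nest \<A>' F' n'"
      by (rule nest_mono) (auto simp: \<A>'_F'_n'_def)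
    then have "v \<in> vs.span (nest \<A>' F' n')" using v(5) vs.span_mono by blast
    moreover have "u \<in> nest \<A>' F' (length a)"
      unfolding u(1) by (rule mono_nest) (auto simp: \<A>'_F'_n'_def u)
    then have "u \<in> nest \<A>' F' n'"
      using nest_mono[of \<A>' \<A>' F' F' "length a" n'] by (auto simp: \<A>'_F'_n'_def)
    ultimately have "ofc c * u + v \<in> vs.span (nest \<A>' F' n')"
      by (simp add: vs.span_add vs.span_scale vs.span_base)
    moreover have "finite \<A>'" "\<A>' \<subseteq> gverts G" "finite F'" "F' \<subseteq> edges G"
      using u v by (auto simp: \<A>'_F'_n'_def)
    ultimately show ?case by blast
  qed
  then obtain \<A> F n where *: "finite \<A>" "\<A> \<subseteq> gverts G" "finite F" "F \<subseteq> edges G" "x \<in> vs.span (nest \<A> F n)"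
    by blast
  \<comment> \<open>Intersections of nonempty subfamilies only, so that all of them belong to
    \<open>gverts G\<close> by the rule \<open>Inter\<close>; the family stays finite and becomes
    closed under intersections.\<close>
  define \<C> where "\<C> = Inter ` (Pow (\<A> \<union> rng G ` F) - {{}})"
  have "finite \<C>" using * by (simp add: \<C>_def)
  moreover have "\<C> \<subseteq> gverts G"
  proof
    fix A assume "A \<in> \<C>"
    then obtain X where X: "X \<subseteq> \<A> \<union> rng G ` F" "X \<noteq> {}" "A = \<Inter>X" by (auto simp: \<C>_def)
    moreover have "finite X" using X * by (meson finite_UnI finite_imageI finite_subset)
    moreover have "B \<in> gverts G" if "B \<in> X" for B
    proof -
      have "B \<in> \<A> \<or> B \<in> rng G ` F" using that X by blast
      then show ?thesis using *(2,4) by (auto intro: gverts.range)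
    qed
    ultimately show "A \<in> gverts G" by (simp add: gverts.Inter)
  qed
  moreover have sub: "\<A> \<union> rng G ` F \<subseteq> \<C>"
  proof
    fix A assume "A \<in> \<A> \<union> rng G ` F"
    then show "A \<in> \<C>" unfolding \<C>_def by (intro image_eqI[of _ _ "{A}"]) auto
  qed
  moreover have "A \<inter> B \<in> \<C>" if AB: "A \<in> \<C>" "B \<in> \<C>" for A B
  proof -
    obtain X Y where "X \<in> Pow (\<A> \<union> rng G ` F) - {{}}" "A = \<Inter>X"
      "Y \<in> Pow (\<A> \<union> rng G ` F) - {{}}" "B = \<Inter>Y" using AB by (auto simp: \<C>_def)
    then have "X \<union> Y \<in> Pow (\<A> \<union> rng G ` F) - {{}}" "A \<inter> B = \<Inter>(X \<union> Y)" by auto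
    then show ?thesis unfolding \<C>_def by blast
  qed
  moreover have "x \<in> vs.span (nest \<C> F n)"
    using *(5) nest_mono[of \<A> \<C> F F n n] sub vs.span_mono[of "nest \<A> F n" "nest \<C> F n"] by auto
  ultimately show ?thesis using *(3,4) by (intro that[of \<C> F n]) auto
qed

text \<open>All positive powers of \<open>y\<close> lie in the span of one finite set closed under
  multiplication, so they are linearly dependent. The relation is written from its first nonzero
  coefficient on, which later allows a power of \<open>y\<close> to be split off.\<close>

lemma powers_dependent:
  assumes "y \<in> component 0"
  obtains c k m where "k \<le> m" "c k \<noteq> 0" "(\<Sum>i=k..m. ofc (c i) * y ^ Suc i) = 0"
proof -
  obtain \<A> F n where *: "finite \<A>" "\<A> \<subseteq> gverts G" "finite F" "F \<subseteq> edges G" "y \<in> vs.span (nest \<A> F n)"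
    "\<And>A B. A \<in> \<A> \<Longrightarrow> B \<in> \<A> \<Longrightarrow> A \<inter> B \<in> \<A>" "\<And>e. e \<in> F \<Longrightarrow> rng G e \<in> \<A>"
    by (rule component_0_in_nest[OF assms]) blast
  define N where "N = nest \<A> F n"
  have N: "finite N" using * by (simp add: N_def finite_nest)
  have pow: "y ^ Suc i \<in> vs.span N" for i
  proof (induction i)
    case 0
    then show ?case using * by (simp add: N_def)
  next
    case (Suc i)
    have "y * y ^ Suc i \<in> vs.span N"
    proof (rule span_mult_subset[OF *(5)])
      fix u assume u: "u \<in> nest \<A> F n"
      show "u * y ^ Suc i \<in> vs.span N"
        using Suc by (rule mult_span_subset)
          (auto simp: N_def intro!: vs.span_base nest_mult[OF *(2,4,6,7) u])
    qed
    then show ?case by simp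
  qed
  define m where "m = card N"
  have "\<exists>c. (\<exists>i\<le>m. c i \<noteq> 0) \<and> (\<Sum>i\<le>m. ofc (c i) * y ^ Suc i) = 0"
  \<comment> \<open>Linear dependence is a property of sets, so it says nothing about repeated
    powers; two equal powers give a relation directly.\<close>
  proof (cases "inj_on (\<lambda>i. y ^ Suc i) {..m}")
    case True
    let ?B = "(\<lambda>i. y ^ Suc i) ` {..m}"
    have "card ?B = Suc m" using True by (simp add: card_image)
    moreover have "?B \<subseteq> vs.span N" using pow by blast
    ultimately have "vs.dependent ?B"
      using vs.independent_span_bound[OF N, of ?B] by (auto simp: m_def)
    then obtain u where u: "\<exists>v\<in>?B. u v \<noteq> 0" "(\<Sum>v\<in>?B. ofc (u v) * v) = 0"
      using vs.dependent_finite[of ?B] by auto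
    have "(\<Sum>i\<le>m. ofc (u (y ^ Suc i)) * y ^ Suc i) = 0"
      using u(2) by (subst (asm) sum.reindex[OF True]) (simp add: o_def)
    then show ?thesis using u(1) by (intro exI[of _ "\<lambda>i. u (y ^ Suc i)"]) auto
  next
    case False
    then obtain i j where ij: "i \<le> m" "j \<le> m" "i \<noteq> j" "y ^ Suc i = y ^ Suc j"
      by (auto simp: inj_on_def)
    have "(\<Sum>l\<le>m. ofc (if l = i then 1 else if l = j then - 1 else 0) * y ^ Suc l)
      = (\<Sum>l\<in>{i, j}. ofc (if l = i then 1 else if l = j then - 1 else 0) * y ^ Suc l)"
      using ij by (intro sum.mono_neutral_right) auto
    also have "\<dots> = 0" using ij by simp
    finally show ?thesis using ij
      by (intro exI[of _ "\<lambda>l. if l = i then 1 else if l = j then - 1 else 0"]) auto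
  qed
  then obtain c where c: "\<exists>i\<le>m. c i \<noteq> 0" "(\<Sum>i\<le>m. ofc (c i) * y ^ Suc i) = 0" by blast
  define k where "k = (LEAST i. c i \<noteq> 0)"
  have "c k \<noteq> 0" unfolding k_def by (rule LeastI_ex) (use c(1) in blast)
  moreover obtain i where i: "i \<le> m" "c i \<noteq> 0" using c(1) by blast
  then have "k \<le> m" using Least_le[of "\<lambda>i. c i \<noteq> 0" i] by (simp add: k_def)
  moreover have "c i = 0" if "i < k" for i
    using not_less_Least[OF that[unfolded k_def]] by simp
  then have "(\<Sum>i\<le>m. ofc (c i) * y ^ Suc i) = (\<Sum>i=k..m. ofc (c i) * y ^ Suc i)"
    by (intro sum.mono_neutral_right) (auto simp: not_le)
  ultimately show ?thesis using c(2) that by simp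
qed

end

lemma mult_ofc_left: "x * (ofc c * y) = ofc c * (x * y)"
  by (simp only: mult.assoc[symmetric] ofc_central[of c x, symmetric])

section \<open>Ideals that contain no vertex projection\<close>

context leavitt_family
begin

text \<open>Such an \<open>x\<close> behaves like the function \<open>d\<close> on the vertices. As
  \<open>B - D\<close> need not belong to \<open>gverts G\<close>, it is represented by
  \<open>P B - P (B \<inter> D)\<close>; if \<open>d\<close> is constantly \<open>- c\<close> there,
  this difference annihilates \<open>x + ofc c\<close>. The constant serves the induction: inside
  \<open>A\<close> it absorbs a new summand that is a multiple of \<open>P A\<close>.\<close>

lemma span_P_value:
  assumes "x \<in> vs.span (P ` gverts G)"
  shows "\<exists>d C. (\<forall>v\<in>verts G. P {v} * x = ofc (d v) * P {v}) \<and> C \<in> gverts G \<and> P C * x = x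
    \<and> (\<forall>c. \<forall>B\<in>gverts G. \<forall>D\<in>gverts G.
        (\<forall>v\<in>B - D. d v + c = 0) \<longrightarrow> (P B - P (B \<inter> D)) * (x + ofc c) = 0)"
  using assms
proof (induction rule: vs.span_induct_alt)
  case base
  have "(P B - P (B \<inter> D)) * (0 + ofc c) = 0" if "\<forall>v\<in>B - D. (0 :: complex) + c = 0" for B D c
  proof (cases "c = 0")
    case False
    then have "B \<inter> D = B" using that by auto
    then show ?thesis by simp
  qed simp
  then show ?case
    by (intro exI[of _ "\<lambda>_. 0"] exI[of _ "{}"]) (simp add: gverts_empty)
next
  case (step a u x)
  then obtain A where A: "A \<in> gverts G" "u = P A" by auto
  obtain d C where d: "\<forall>v\<in>verts G. P {v} * x = ofc (d v) * P {v}" and C: "C \<in> gverts G" "P C * x = x"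
    and zero': "\<forall>c. \<forall>B\<in>gverts G. \<forall>D\<in>gverts G.
        (\<forall>v\<in>B - D. d v + c = 0) \<longrightarrow> (P B - P (B \<inter> D)) * (x + ofc c) = 0"
    using step.IH by (elim exE conjE) (rule that; assumption)
  note zero = zero'[rule_format]
  define d' where "d' = (\<lambda>v. d v + (if v \<in> A then a else 0))"
  have "P {v} * (ofc a * u + x) = ofc (d' v) * P {v}" if v: "v \<in> verts G" for v
  proof -
    have "P {v} * (ofc a * u) = ofc a * P ({v} \<inter> A)"
      unfolding A(2) P_mult[OF gverts.vertex[OF v] A(1), symmetric] by (rule mult_ofc_left)
    then show ?thesis using d v
      by (simp add: d'_def ofc_add semiring_class.distrib_left semiring_class.distrib_right add.commute)
  qed
  moreover have "P (C \<union> A) * (ofc a * u + x) = ofc a * u + x"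
  proof -
    have "P (C \<union> A) * P A = P A" "P (C \<union> A) * P C = P C"
      using A C by (simp_all add: P_mult gverts_Un Int_absorb1)
    then have "P (C \<union> A) * (ofc a * u) = ofc a * u" "P (C \<union> A) * x = x"
      unfolding A(2) mult_ofc_left by (simp, subst (1 2) C(2)[symmetric], simp add: mult.assoc[symmetric])
    then show ?thesis by (simp add: semiring_class.distrib_left)
  qed
  moreover have "(P B - P (B \<inter> D)) * (ofc a * u + x + ofc c) = 0"
    if B: "B \<in> gverts G" and D: "D \<in> gverts G" and *: "\<forall>v\<in>B - D. d' v + c = 0" for B D c
  proof -
    \<comment> \<open>\<open>B - D\<close> is split along \<open>A\<close>: on
      \<open>(B \<inter> A) - D\<close> the new summand is the constant \<open>a\<close>, on
      \<open>B - (A \<union> D)\<close> it vanishes.\<close>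
    define q r where "q = P (B \<inter> A) - P ((B \<inter> A) \<inter> D)" and "r = P B - P (B \<inter> (A \<union> D))"
    have "P (B \<inter> (A \<union> D)) = P (B \<inter> A) + P (B \<inter> D) - P ((B \<inter> A) \<inter> D)"
      using P_Un[of "B \<inter> A" "B \<inter> D"] A B D
      by (simp add: gverts_Int Int_Un_distrib Int_assoc Int_left_commute)
    then have "P B - P (B \<inter> D) = q + r" by (simp add: q_def r_def)
    moreover have "q * (x + ofc (a + c)) = 0"
      unfolding q_def
    proof (rule zero)
      fix v assume "v \<in> B \<inter> A - D"
      then show "d v + (a + c) = 0" using bspec[OF *, of v] by (simp add: d'_def add.assoc)
    qed (use A B D in \<open>simp_all add: gverts_Int\<close>)
    moreover have "r * (x + ofc c) = 0"
      unfolding r_def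
    proof (rule zero)
      fix v assume "v \<in> B - (A \<union> D)"
      then show "d v + c = 0" using bspec[OF *, of v] by (simp add: d'_def add.assoc)
    qed (use A B D in \<open>simp_all add: gverts_Un\<close>)
    moreover have "q * P A = q"
      using A B D by (simp add: q_def left_diff_distrib P_mult gverts_Int Int_assoc Int_commute Int_left_commute)
    then have "q * (ofc a * u) = q * ofc a" unfolding A(2) mult_ofc_left by (simp add: ofc_central)
    moreover have "B \<inter> (A \<union> D) \<inter> A = B \<inter> A" by blast
    then have "r * P A = 0"
      using A B D by (simp add: r_def left_diff_distrib P_mult gverts_Int gverts_Un)
    then have "r * (ofc a * u) = 0" unfolding A(2) mult_ofc_left by simp
    ultimately show ?thesis
      by (simp add: semiring_class.distrib_left semiring_class.distrib_right ofc_add add_ac)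
  qed
  ultimately show ?case
    using gverts_Un[OF C(1) A(1)] by (intro exI[of _ d'] exI[of _ "C \<union> A"] conjI) simp_all
qed

lemma P_sum_S_T:
  assumes "F \<subseteq> edges G" "finite F" "v \<in> verts G"
  shows "P {v} * (\<Sum>e\<in>F. S e * T e) = (\<Sum>e\<in>{e\<in>F. src G e = v}. S e * T e)"
    "(\<Sum>e\<in>F. S e * T e) * P {v} = (\<Sum>e\<in>{e\<in>F. src G e = v}. S e * T e)"
proof -
  have "P {v} * (S e * T e) = (if src G e = v then S e * T e else 0)"
    "(S e * T e) * P {v} = (if src G e = v then S e * T e else 0)" if "e \<in> F" for e
    using assms that gverts.vertex[OF assms(3)]
    by (auto simp: mult.assoc[symmetric] P_S subset_iff, auto simp: mult.assoc T_P)
  then show "P {v} * (\<Sum>e\<in>F. S e * T e) = (\<Sum>e\<in>{e\<in>F. src G e = v}. S e * T e)"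
    "(\<Sum>e\<in>F. S e * T e) * P {v} = (\<Sum>e\<in>{e\<in>F. src G e = v}. S e * T e)"
    using assms(2) by (simp_all add: sum_distrib_left sum_distrib_right sum.inter_filter)
qed

text \<open>The outermost letters disappear: \<open>T e * (S g * y * T h) * S f\<close> is 0 or
  \<open>P (rng G g) * y * P (rng G h)\<close>, one level lower, and a projection becomes a range
  projection or 0. This drives the induction in \<open>ideal_component_0\<close>.\<close>

lemma T_nest_S:
  assumes "x \<in> vs.span (nest (gverts G) F (Suc n))" "F \<subseteq> edges G" "e \<in> edges G" "f \<in> edges G"
  shows "T e * x * S f \<in> vs.span (nest (gverts G) F n)"
proof -
  have "T e * u * S f \<in> nest (gverts G) F n" if u: "u \<in> nest (gverts G) F (Suc n)" for u
  proof -
    have 0: "0 \<in> nest (gverts G) F n" by (rule nest_0_subset)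
    consider "u = 0" | A where "A \<in> gverts G" "u = P A"
      | g h y where "g \<in> F" "h \<in> F" "u = S g * y * T h" "y \<in> nest (gverts G) F n" using u by auto
    then show ?thesis
    proof cases
      case 1
      then show ?thesis using 0 by simp
    next
      case 2
      then have "T e * u * S f = (if src G e \<in> A \<and> e = f then P (rng G e) else 0)"
        using assms by (auto simp: T_P T_S)
      then show ?thesis using 0 assms by (auto intro: nest_0_subset gverts.range)
    next
      case 3
      have "T e * u * S f = (T e * S g) * y * (T h * S f)" by (simp add: 3 mult.assoc)
      also have "\<dots> = (if e = g \<and> h = f then P (rng G g) * y * P (rng G h) else 0)"
        using 3 assms T_S[of e g] T_S[of h f] by auto
      finally have *: "T e * u * S f = (if e = g \<and> h = f then P (rng G g) * y * P (rng G h) else 0)" .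
      have "P (rng G g) * y * P (rng G h) \<in> nest (gverts G) F n"
        using 3 assms(2) by (intro P_nest gverts.range gverts_Int) auto
      then show ?thesis using 0 unfolding * by (cases "e = g \<and> h = f") auto
    qed
  qed
  then have "T e * u \<in> {y. y * S f \<in> nest (gverts G) F n}" if "u \<in> nest (gverts G) F (Suc n)" for u
    using that by simp
  then have "T e * x \<in> vs.span {y. y * S f \<in> nest (gverts G) F n}"
    by (intro mult_span_subset[OF assms(1)] vs.span_base)
  then show ?thesis by (rule span_mult_subset) (simp add: vs.span_base)
qed

text \<open>Here \<open>x0\<close> collects the terms of level zero. On the remaining terms
  \<open>S g * z * T h\<close> the sum of all \<open>S e * T e\<close> acts as a two-sided unit,
  since \<open>g\<close> and \<open>h\<close> lie in \<open>F\<close>.\<close>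

lemma nest_range:
  assumes "x \<in> vs.span (nest (gverts G) F (Suc n))" "F \<subseteq> edges G" "finite F"
  shows "\<exists>x0\<in>vs.span (P ` gverts G).
    (\<Sum>e\<in>F. S e * T e) * (x - x0) = x - x0 \<and> (x - x0) * (\<Sum>e\<in>F. S e * T e) = x - x0"
  using assms(1)
proof (induction rule: vs.span_induct_alt)
  case base
  then show ?case by (intro bexI[of _ 0]) (simp_all add: vs.span_zero)
next
  case (step c u y)
  let ?q = "\<Sum>e\<in>F. S e * T e"
  obtain y0 where y0: "y0 \<in> vs.span (P ` gverts G)" "?q * (y - y0) = y - y0" "(y - y0) * ?q = y - y0"
    using step by blast
  consider "u = 0 \<or> u \<in> P ` gverts G"
    | g h z where "g \<in> F" "h \<in> F" "u = S g * z * T h" using step(1) by auto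
  then show ?case
  proof cases
    case 1
    then have "u \<in> vs.span (P ` gverts G)" by (auto intro: vs.span_base vs.span_zero)
    then have "ofc c * u + y0 \<in> vs.span (P ` gverts G)" using y0(1) by (intro vs.span_add vs.span_scale)
    then show ?thesis using y0 by (intro bexI[of _ "ofc c * u + y0"]) simp_all
  next
    case 2
    have "?q * S g = (\<Sum>e\<in>F. if g = e then S g else 0)"
      using 2 assms(2) unfolding sum_distrib_right
      by (intro sum.cong) (auto simp: mult.assoc T_S subset_iff S_P_rng)
    also have "\<dots> = S g" using 2 assms by simp
    finally have q1: "?q * S g = S g" .
    have "T h * ?q = (\<Sum>e\<in>F. if h = e then T h else 0)"
      using 2 assms(2) unfolding sum_distrib_left
      by (intro sum.cong) (auto simp: mult.assoc[symmetric] T_S subset_iff P_rng_T)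
    also have "\<dots> = T h" using 2 assms by simp
    finally have q2: "T h * ?q = T h" .
    have "?q * u = u" "u * ?q = u"
      unfolding 2 by (simp add: mult.assoc[symmetric] q1, simp add: mult.assoc q2)
    then have "?q * (ofc c * u) = ofc c * u" "ofc c * u * ?q = ofc c * u"
      by (simp_all only: mult_ofc_left mult.assoc)
    then have "?q * (ofc c * u + (y - y0)) = ofc c * u + (y - y0)"
      "(ofc c * u + (y - y0)) * ?q = ofc c * u + (y - y0)"
      using y0(2,3) by (simp_all only: semiring_class.distrib_left semiring_class.distrib_right)
    then show ?thesis using y0(1) by (intro bexI[of _ y0]) (simp_all only: add_diff_eq)
  qed
qed

text \<open>Induction on the level. Each \<open>T e * x * S f\<close> lies in \<open>K\<close> one
  level lower, so it is 0. Let \<open>x0\<close> be a level-zero part of \<open>x\<close> as in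
  \<open>nest_range\<close>, with coefficient \<open>d v\<close> at \<open>v\<close>. If
  \<open>d v\<close> is not 0, then \<open>v\<close> emits an edge, and only edges in
  \<open>F\<close>, so the vertex relation holds at \<open>v\<close> and \<open>q\<close> fixes
  \<open>P {v}\<close>. Hence \<open>q * x * q = x\<close>; but \<open>q * x * q\<close> is the sum
  of all \<open>S e * (T e * x * S f) * T f\<close>, which is 0.\<close>

lemma ideal_component_0:
  assumes K_sandwich: "\<And>x e f. x \<in> K \<Longrightarrow> e \<in> edges G \<Longrightarrow> f \<in> edges G \<Longrightarrow> T e * x * S f \<in> K"
    and K_P: "\<And>x v. x \<in> K \<Longrightarrow> v \<in> verts G \<Longrightarrow> P {v} * x \<in> K"
    and K_scale: "\<And>x c. x \<in> K \<Longrightarrow> ofc c * x \<in> K"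
    and P_notin: "\<And>v. v \<in> verts G \<Longrightarrow> P {v} \<notin> K"
    and x: "x \<in> K" "x \<in> component 0"
  shows "x = 0"
proof -
  have "0 \<in> K" using K_scale[OF x(1), of 0] by simp
  then have P_nz: "P {v} \<noteq> 0" if "v \<in> verts G" for v using P_notin[OF that] by auto
  have cancel: "c = 0" if "ofc c * P {v} = 0" "v \<in> verts G" for c v
    using P_nz[OF that(2)] that(1) vs.scale_eq_0_iff by blast
  have cancel_K: "c = 0" if "ofc c * P {v} \<in> K" "v \<in> verts G" for c v
  proof (rule ccontr)
    assume "c \<noteq> 0"
    then have "ofc (1 / c) * (ofc c * P {v}) = P {v}" using vs.scale_scale[of "1 / c" c "P {v}"] by simp
    then show False using K_scale[OF that(1), of "1 / c"] P_notin[OF that(2)] by simp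
  qed
  \<comment> \<open>An element of level zero is determined by its coefficients at the vertices: if
    all of them vanish, \<open>span_P_value\<close> applies to \<open>B = C\<close>,
    \<open>D = {}\<close> and \<open>c = 0\<close>, and \<open>P C\<close> fixes
    \<open>x0\<close>.\<close>
  have zero: "x0 = 0" if x0_span: "x0 \<in> vs.span (P ` gverts G)" and x0_P: "\<And>v. v \<in> verts G \<Longrightarrow> P {v} * x0 = 0" for x0
  proof -
    obtain d C where d: "\<forall>v\<in>verts G. P {v} * x0 = ofc (d v) * P {v}" "C \<in> gverts G" "P C * x0 = x0"
      "\<forall>c. \<forall>B\<in>gverts G. \<forall>D\<in>gverts G. (\<forall>v\<in>B - D. d v + c = 0) \<longrightarrow> (P B - P (B \<inter> D)) * (x0 + ofc c) = 0"
      using span_P_value[OF x0_span] by (elim exE conjE) (rule that; assumption)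
    have "d v = 0" if "v \<in> verts G" for v using cancel[OF _ that] d(1) x0_P[OF that] that by simp
    then have "\<forall>v\<in>C - {}. d v + 0 = 0" using gverts_subset[OF d(2)] by auto
    then have "(P C - P (C \<inter> {})) * (x0 + ofc 0) = 0" using d(4)[rule_format, OF d(2) gverts_empty] by blast
    then show ?thesis using d(3) by simp
  qed
  have main: "x = 0" if "finite F" "F \<subseteq> edges G" "x \<in> vs.span (nest (gverts G) F n)" "x \<in> K" for F n x
    using that
  proof (induction n arbitrary: x)
    case 0
    have "insert 0 (P ` gverts G) = P ` gverts G" using imageI[OF gverts_empty, of P] by (simp add: insert_absorb)
    then have xs: "x \<in> vs.span (P ` gverts G)" using 0 by simp
    obtain d where d: "\<forall>v\<in>verts G. P {v} * x = ofc (d v) * P {v}" using span_P_value[OF xs] by blast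
    have "P {v} * x = 0" if "v \<in> verts G" for v
      using d[rule_format, OF that] K_P[OF 0(4) that] cancel_K[of "d v" v] that by simp
    then show ?case using zero xs by blast
  next
    case (Suc n)
    define q where "q = (\<Sum>e\<in>F. S e * T e)"
    have sandwich: "T e * x * S f = 0" if "e \<in> edges G" "f \<in> edges G" for e f
      by (rule Suc.IH) (use Suc.prems that T_nest_S K_sandwich in auto)
    obtain x0 where x0: "x0 \<in> vs.span (P ` gverts G)" "q * (x - x0) = x - x0" "(x - x0) * q = x - x0"
      using nest_range[OF Suc.prems(3,2,1)] unfolding q_def by blast
    obtain d where "\<forall>v\<in>verts G. P {v} * x0 = ofc (d v) * P {v}"
      using span_P_value[OF x0(1)] by blast
    note d = this[rule_format]
    have qP: "P {v} * q = P {v} \<and> q * P {v} = P {v} \<and> out_edges G v \<noteq> {} \<and> out_edges G v \<subseteq> F"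
      if v: "v \<in> verts G" and dv: "d v \<noteq> 0" for v
    proof -
      have sub: "out_edges G v \<subseteq> F"
      proof
        fix e assume e: "e \<in> out_edges G v"
        then have e': "e \<in> edges G" "src G e = v" by (auto simp: out_edges_def)
        show "e \<in> F"
        proof (rule ccontr)
          assume "e \<notin> F"
          \<comment> \<open>Outside \<open>F\<close> the ghost edge kills \<open>q\<close> and hence
            \<open>x - x0\<close>, so \<open>T e * x * S e\<close> equals \<open>d v\<close> times
            \<open>P (rng G e)\<close>. This contradicts \<open>sandwich\<close>, because ranges are
            nonempty.\<close>
          have "T e * q = (\<Sum>f\<in>F. T e * S f * T f)" by (simp add: q_def sum_distrib_left mult.assoc)
          also have "\<dots> = 0" using \<open>e \<notin> F\<close> e' Suc.prems(2) by (intro sum.neutral) (auto simp: T_S subset_iff)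
          finally have "T e * q * (x - x0) = 0" by simp
          then have "T e * (x - x0) = 0" by (simp add: mult.assoc x0(2))
          then have "T e * x * S e = T e * x0 * S e" by (simp add: right_diff_distrib)
          also have "\<dots> = T e * (P {v} * x0) * S e" using T_P_src[OF e'(1)] e'(2) by (simp add: mult.assoc[symmetric])
          also have "\<dots> = ofc (d v) * (T e * P {v} * S e)" unfolding d[OF v] mult_ofc_left by (simp add: mult.assoc)
          also have "\<dots> = ofc (d v) * P (rng G e)" using T_P_src[OF e'(1)] e' by (simp add: T_S)
          finally have "P (rng G e) = 0" using sandwich[OF e'(1) e'(1)] dv by simp
          moreover obtain w where "w \<in> rng G e" "w \<in> verts G"
            using rng_nonempty[OF e'(1)] rng_subset[OF e'(1)] by blast
          ultimately show False
            using P_mult[OF gverts.vertex[OF \<open>w \<in> verts G\<close>] gverts.range[OF e'(1)]] P_nz by simp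
        qed
      qed
      have eq: "{e \<in> F. src G e = v} = out_edges G v" using sub Suc.prems(2) by (auto simp: out_edges_def)
      note q = P_sum_S_T[OF Suc.prems(2,1) v, folded q_def, unfolded eq]
      \<comment> \<open>For a sink \<open>v\<close> one has \<open>P {v} * q = 0\<close>, so
        \<open>P {v} * x\<close> is \<open>d v\<close> times \<open>P {v}\<close>; then
        \<open>K\<close> would contain a vertex projection.\<close>
      have ne: "out_edges G v \<noteq> {}"
      proof
        assume "out_edges G v = {}"
        then have "P {v} * q = 0" using q by simp
        then have "P {v} * q * (x - x0) = 0" by simp
        then have "P {v} * (x - x0) = 0" by (simp add: mult.assoc x0(2))
        then have "P {v} * x = ofc (d v) * P {v}" using d[OF v] by (simp add: right_diff_distrib)
        then show False using K_P[OF Suc.prems(4) v] cancel_K[OF _ v] dv by simp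
      qed
      have "P {v} = (\<Sum>e\<in>out_edges G v. S e * T e)"
        using v ne sub Suc.prems(1) by (intro P_vertex_sum) (auto intro: finite_subset)
      then show ?thesis using q ne sub by simp
    qed
    \<comment> \<open>Every vertex with a nonzero coefficient emits an edge of the finite set
      \<open>F\<close>. So there are finitely many, and \<open>x0\<close> is a finite combination of
      vertex projections.\<close>
    define V where "V = {v \<in> verts G. d v \<noteq> 0}"
    have "V \<subseteq> src G ` F"
    proof
      fix v assume "v \<in> V"
      then obtain e where "e \<in> out_edges G v" "e \<in> F" using qP by (auto simp: V_def)
      then show "v \<in> src G ` F" by (auto simp: out_edges_def)
    qed
    then have fV: "finite V" using Suc.prems(1) finite_surj by blast
    define w where "w = (\<Sum>v\<in>V. ofc (d v) * P {v})"
    have "x0 - w = 0"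
    proof (rule zero)
      show "x0 - w \<in> vs.span (P ` gverts G)"
        unfolding w_def
        by (intro vs.span_diff[OF x0(1)] vs.span_sum vs.span_scale vs.span_base) (auto simp: V_def intro: gverts.vertex)
      fix v assume v: "v \<in> verts G"
      have "P {v} * (ofc (d u) * P {u}) = (if v = u then ofc (d v) * P {v} else 0)" if "u \<in> V" for u
      proof -
        have "P {v} * P {u} = P ({v} \<inter> {u})" using v that by (intro P_mult gverts.vertex) (auto simp: V_def)
        then have "P {v} * (ofc (d u) * P {u}) = ofc (d u) * P ({v} \<inter> {u})"
          by (simp only: mult_ofc_left)
        then show ?thesis by auto
      qed
      then have "P {v} * w = (\<Sum>u\<in>V. if v = u then ofc (d v) * P {v} else 0)"
        unfolding w_def sum_distrib_left by (intro sum.cong) auto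
      also have "\<dots> = ofc (d v) * P {v}" using fV v by (auto simp: V_def)
      finally show "P {v} * (x0 - w) = 0" using d[OF v] by (simp add: right_diff_distrib)
    qed
    then have "x0 = w" by simp
    have "q * w = w" "w * q = w"
    proof -
      have "q * (ofc (d v) * P {v}) = ofc (d v) * P {v}" if "v \<in> V" for v
        using qP[of v] that unfolding V_def mult_ofc_left by simp
      then show "q * w = w" unfolding w_def sum_distrib_left by (intro sum.cong) auto
      have "ofc (d v) * P {v} * q = ofc (d v) * P {v}" if "v \<in> V" for v
        using qP[of v] that unfolding V_def by (simp add: mult.assoc)
      then show "w * q = w" unfolding w_def sum_distrib_right by (intro sum.cong) auto
    qed
    then have qx: "q * x = x" "x * q = x"
      using x0(2,3) \<open>x0 = w\<close> by (simp_all add: right_diff_distrib left_diff_distrib)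
    have "q * x * q = (\<Sum>e\<in>F. \<Sum>f\<in>F. S e * (T e * x * S f) * T f)"
      unfolding q_def sum_distrib_left sum_distrib_right by (subst sum.swap) (simp add: mult.assoc)
    also have "\<dots> = 0" using sandwich Suc.prems(2) by (intro sum.neutral ballI) (auto simp: subset_iff)
    finally show ?case using qx by simp
  qed
  obtain \<A> F n where "\<A> \<subseteq> gverts G" "finite F" "F \<subseteq> edges G" "x \<in> vs.span (nest \<A> F n)"
    by (rule component_0_in_nest[OF x(2)]) blast
  then show ?thesis
    using main[of F x n] x(1) nest_mono[of \<A> "gverts G" F F n n]
      vs.span_mono[of "nest \<A> F n" "nest (gverts G) F n"] by auto
qed

end

section \<open>The Leavitt path algebra\<close>

lemma lpa_rels_gens:
  assumes "ultragraph G" "(t, u) \<in> lpa_rels G"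
  shows "set_alg_term t \<subseteq> lpa_gens G \<and> set_alg_term u \<subseteq> lpa_gens G"
proof -
  interpret ultragraph G by fact
  show ?thesis using assms(2)
  proof (induction rule: lpa_rels.induct)
    case (vertex_sum v es)
    have "set_alg_term (foldr (\<lambda>e t. Add (Mult (Gen (Edge e)) (Gen (Ghost e))) t) es Zero)
      \<subseteq> Edge ` set es \<union> Ghost ` set es" by (induction es) auto
    moreover have "set es \<subseteq> edges G" using vertex_sum by (auto simp: out_edges_def)
    then have "Edge ` set es \<union> Ghost ` set es \<subseteq> lpa_gens G" by (auto simp: lpa_gens_def)
    moreover have "Proj {v} \<in> lpa_gens G"
      using gverts.vertex[OF vertex_sum(1)] by (simp add: lpa_gens_def)
    ultimately show ?case by (auto dest: subsetD)
  qed (auto simp: lpa_gens_def gverts_empty gverts_Int gverts_Un gverts_src intro: gverts.range)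
qed

section \<open>The universal property of the Leavitt path algebra\<close>

context ultragraph
begin

abbreviation "valid_term t \<equiv> set_alg_term t \<subseteq> lpa_gens G"

definition lpa_value :: "('v, 'e) lpa_gen \<Rightarrow> (('v, 'e) lpa_gen alg_term set, unit) unitization" where
  "lpa_value g = emb (leavitt G) (lpa_gen G g)"

lemma complex_algebra_leavitt: "complex_algebra (leavitt G)"
  unfolding leavitt_def by (rule complex_algebra_universal)

lemma term_value_lpa:
  "valid_term t \<Longrightarrow> term_value lpa_value t = emb (leavitt G) (alg_class (lpa_gens G) (lpa_rels G) t)"
  unfolding lpa_value_def leavitt_def lpa_gen_def by (rule emb_alg_class[symmetric])

lemma lpa_value_family: "leavitt_family G lpa_value"
proof
  fix t u assume tu: "(t, u) \<in> lpa_rels G"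
  then show "term_value lpa_value t = term_value lpa_value u"
    using lpa_rels_gens[OF ultragraph_axioms tu] alg_class_eq[OF alg_eq.rel[OF tu]]
    by (simp add: term_value_lpa)
qed

lemma emb_carrier_leavitt:
  "emb (leavitt G) ` carrier (leavitt G) = {term_value lpa_value t | t. valid_term t}"
proof -
  have "carrier (leavitt G) = {alg_class (lpa_gens G) (lpa_rels G) t | t. valid_term t}"
    unfolding leavitt_def by (rule carrier_universal)
  then show ?thesis by (auto simp: term_value_lpa image_iff) (metis term_value_lpa)
qed

text \<open>Equal values in the Leavitt path algebra are equal classes, that is, there is a
  derivation by \<open>alg_eq\<close>, and every Leavitt family respects it. This makes
  \<open>lift\<close> well defined.\<close>

lemma term_value_determined:
  assumes "leavitt_family G \<theta>" "valid_term t" "valid_term u"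
    and "term_value lpa_value t = term_value lpa_value u"
  shows "term_value \<theta> t = term_value \<theta> u"
proof -
  interpret leavitt_family G \<theta> by fact
  have "alg_class (lpa_gens G) (lpa_rels G) t = alg_class (lpa_gens G) (lpa_rels G) u"
    using assms(2-4) complex_algebra.emb_eq_iff[OF complex_algebra_leavitt]
      alg_class_closed[of _ "lpa_gens G" "lpa_rels G", folded leavitt_def]
    by (simp add: term_value_lpa)
  note alg_class_eqD[OF this assms(3)]
  then show ?thesis by (rule term_value_alg_eq[rotated]) (rule relations)
qed

text \<open>The homomorphism given by the universal property. It is meaningful on \<open>lpa_range\<close> only, where a
  term as required exists and its value does not depend on the choice.\<close>

definition lift :: "(('v, 'e) lpa_gen \<Rightarrow> ('w, 'm) unitization)
    \<Rightarrow> (('v, 'e) lpa_gen alg_term set, unit) unitization \<Rightarrow> ('w, 'm) unitization" where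
  "lift \<theta> x = term_value \<theta> (SOME t. valid_term t \<and> term_value lpa_value t = x)"

lemma lift_term_value:
  assumes "leavitt_family G \<theta>" "valid_term t"
  shows "lift \<theta> (term_value lpa_value t) = term_value \<theta> t"
proof -
  let ?P = "\<lambda>u. valid_term u \<and> term_value lpa_value u = term_value lpa_value t"
  have *: "?P (SOME u. ?P u)" using assms(2) by (intro someI[of ?P t]) simp
  show ?thesis
    unfolding lift_def by (rule term_value_determined[OF assms(1) conjunct1[OF *] assms(2) conjunct2[OF *]])
qed

abbreviation "lpa_range \<equiv> emb (leavitt G) ` carrier (leavitt G)"

lemma lift_add:
  assumes "leavitt_family G \<theta>" "x \<in> lpa_range" "y \<in> lpa_range"
  shows "x + y \<in> lpa_range" "lift \<theta> (x + y) = lift \<theta> x + lift \<theta> y"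
proof -
  obtain t u where tu: "valid_term t" "x = term_value lpa_value t" "valid_term u" "y = term_value lpa_value u"
    using assms(2,3) unfolding emb_carrier_leavitt by blast
  then have *: "valid_term (Add t u)" "x + y = term_value lpa_value (Add t u)" by simp_all
  then show "x + y \<in> lpa_range" unfolding emb_carrier_leavitt by blast
  show "lift \<theta> (x + y) = lift \<theta> x + lift \<theta> y"
    using lift_term_value[OF assms(1) *(1)] lift_term_value[OF assms(1)] tu by simp
qed

lemma lift_mult:
  assumes "leavitt_family G \<theta>" "x \<in> lpa_range" "y \<in> lpa_range"
  shows "x * y \<in> lpa_range" "lift \<theta> (x * y) = lift \<theta> x * lift \<theta> y"
proof -
  obtain t u where tu: "valid_term t" "x = term_value lpa_value t" "valid_term u" "y = term_value lpa_value u"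
    using assms(2,3) unfolding emb_carrier_leavitt by blast
  then have *: "valid_term (Mult t u)" "x * y = term_value lpa_value (Mult t u)" by simp_all
  then show "x * y \<in> lpa_range" unfolding emb_carrier_leavitt by blast
  show "lift \<theta> (x * y) = lift \<theta> x * lift \<theta> y"
    using lift_term_value[OF assms(1) *(1)] lift_term_value[OF assms(1)] tu by simp
qed

lemma lift_scale:
  assumes "leavitt_family G \<theta>" "x \<in> lpa_range"
  shows "ofc c * x \<in> lpa_range" "lift \<theta> (ofc c * x) = ofc c * lift \<theta> x"
proof -
  obtain t where t: "valid_term t" "x = term_value lpa_value t"
    using assms(2) unfolding emb_carrier_leavitt by blast
  then have *: "valid_term (Scale c t)" "ofc c * x = term_value lpa_value (Scale c t)" by simp_all
  then show "ofc c * x \<in> lpa_range" unfolding emb_carrier_leavitt by blast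
  show "lift \<theta> (ofc c * x) = ofc c * lift \<theta> x"
    using lift_term_value[OF assms(1) *(1)] lift_term_value[OF assms(1)] t by simp
qed

lemma lift_0: "leavitt_family G \<theta> \<Longrightarrow> 0 \<in> lpa_range \<and> lift \<theta> 0 = 0"
  using lift_term_value[of \<theta> Zero] unfolding emb_carrier_leavitt by (force intro: exI[of _ Zero])

lemma lift_sum:
  assumes "leavitt_family G \<theta>" "finite I" "\<And>i. i \<in> I \<Longrightarrow> f i \<in> lpa_range"
  shows "(\<Sum>i\<in>I. f i) \<in> lpa_range \<and> lift \<theta> (\<Sum>i\<in>I. f i) = (\<Sum>i\<in>I. lift \<theta> (f i))"
  using assms(2,3) by (induction I rule: finite_induct) (simp_all add: lift_0[OF assms(1)] lift_add[OF assms(1)])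

lemma lift_gen: "leavitt_family G \<theta> \<Longrightarrow> g \<in> lpa_gens G \<Longrightarrow> lpa_value g \<in> lpa_range \<and> lift \<theta> (lpa_value g) = \<theta> g"
  using lift_term_value[of \<theta> "Gen g"] unfolding emb_carrier_leavitt by (force intro: exI[of _ "Gen g"])

lemma valid_mono_term:
  "set a \<subseteq> edges G \<Longrightarrow> set b \<subseteq> edges G \<Longrightarrow> A \<in> gverts G \<Longrightarrow> valid_term (mono_term a A b)"
  by (induction a A b rule: mono_term.induct) (auto simp: lpa_gens_def)

text \<open>One term, built from monomials of the right degree, serves both families at once.
  Applied in the two directions it shows that \<open>lift\<close> maps each component onto the
  corresponding one.\<close>

lemma component_terms:
  assumes "leavitt_family G \<theta>" "leavitt_family G \<theta>'" "x \<in> leavitt_family.component G \<theta> n"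
  shows "\<exists>t. valid_term t \<and> term_value \<theta> t = x \<and> term_value \<theta>' t \<in> leavitt_family.component G \<theta>' n"
proof -
  interpret F: leavitt_family G \<theta> by fact
  interpret F': leavitt_family G \<theta>' by fact
  show ?thesis using assms(3) unfolding F.component_def
  proof (induction rule: vs.span_induct_alt)
    case base
    then show ?case by (intro exI[of _ Zero]) simp
  next
    case (step c u v)
    obtain a A b where u: "u = term_value \<theta> (mono_term a A b)" "set a \<subseteq> edges G" "set b \<subseteq> edges G"
      "A \<in> gverts G" "int (length a) - int (length b) = n"
      using step(1) by (auto simp: F.monomials_def)
    obtain t where t: "valid_term t" "term_value \<theta> t = v" "term_value \<theta>' t \<in> F'.component n"
      using step by blast
    have "term_value \<theta>' (mono_term a A b) \<in> F'.component n"
      using u by (intro F'.component_mono F'.monomialsI)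
    then have "term_value \<theta>' (Add (Scale c (mono_term a A b)) t) \<in> F'.component n"
      using t by (simp add: F'.component_add F'.component_scale)
    then show ?case using t u valid_mono_term[of a b A]
      by (intro exI[of _ "Add (Scale c (mono_term a A b)) t"]) simp
  qed
qed

lemma component_subset_range: "leavitt_family.component G lpa_value n \<subseteq> lpa_range"
  using component_terms[OF lpa_value_family lpa_value_family] unfolding emb_carrier_leavitt by blast

lemma lift_component:
  assumes "leavitt_family G \<theta>"
  shows "lift \<theta> ` leavitt_family.component G lpa_value n = leavitt_family.component G \<theta> n"
proof (intro equalityI subsetI)
  fix y assume "y \<in> lift \<theta> ` leavitt_family.component G lpa_value n"
  then obtain x where x: "x \<in> leavitt_family.component G lpa_value n" "y = lift \<theta> x" by blast
  obtain t where "valid_term t" "term_value lpa_value t = x" "term_value \<theta> t \<in> leavitt_family.component G \<theta> n"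
    using component_terms[OF lpa_value_family assms x(1)] by blast
  then show "y \<in> leavitt_family.component G \<theta> n" using x lift_term_value[OF assms] by metis
next
  fix y assume "y \<in> leavitt_family.component G \<theta> n"
  then obtain t where "valid_term t" "term_value \<theta> t = y" "term_value lpa_value t \<in> leavitt_family.component G lpa_value n"
    using component_terms[OF assms lpa_value_family] by blast
  then show "y \<in> lift \<theta> ` leavitt_family.component G lpa_value n" using lift_term_value[OF assms] by (metis imageI)
qed

end

context leavitt_family
begin

lemma term_value_homogeneous:
  assumes "set_alg_term t \<subseteq> lpa_gens G"
  shows "\<exists>f F. finite F \<and> (\<forall>n. f n \<in> component n) \<and> (\<forall>n. n \<notin> F \<longrightarrow> f n = 0) \<and> term_value \<theta> t = sum f F"
proof -
  let ?M = "\<Union>n. monomials n"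
  have gen: "\<theta> g \<in> vs.span ?M" if "g \<in> lpa_gens G" for g
  proof -
    have "mono [e] (rng G e) [] = S e" "mono [] (rng G e) [e] = T e" if "e \<in> edges G" for e
      using that by (simp_all add: S_P_rng P_rng_T)
    moreover have "mono [e] (rng G e) [] \<in> monomials 1" "mono [] (rng G e) [e] \<in> monomials (- 1)"
      if "e \<in> edges G" for e
      using that by (intro monomialsI; simp add: gverts.range)+
    moreover have "mono [] A [] \<in> monomials 0" if "A \<in> gverts G" for A
      using that by (intro monomialsI) auto
    ultimately have "\<theta> g \<in> ?M" using that unfolding lpa_gens_def by fastforce
    then show ?thesis by (rule vs.span_base)
  qed
  have mult: "x * y \<in> vs.span ?M" if "x \<in> vs.span ?M" "y \<in> vs.span ?M" for x y
  proof (rule span_mult_subset[OF that(1)])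
    fix u assume "u \<in> ?M"
    then obtain m where u: "u \<in> monomials m" by blast
    show "u * y \<in> vs.span ?M"
    proof (rule mult_span_subset[OF that(2)])
      fix v assume "v \<in> ?M"
      then obtain n where v: "v \<in> monomials n" by blast
      have "u * v \<in> component (m + n)" using u v by (intro component_mult component_mono)
      then show "u * v \<in> vs.span ?M"
        unfolding component_def using vs.span_mono[of "monomials (m + n)" ?M] by blast
    qed
  qed
  have "term_value \<theta> t \<in> vs.span ?M"
    using assms
  proof (induction t)
    case (Add t u)
    then show ?case by (auto intro: vs.span_add)
  qed (simp_all add: gen mult vs.span_zero vs.span_scale)
  then show ?thesis
  proof (induction rule: vs.span_induct_alt)
    case base
    then show ?case by (intro exI[of _ "\<lambda>_. 0"] exI[of _ "{}"]) simp
  next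
    case (step c u v)
    obtain n where n: "u \<in> monomials n" using step by blast
    obtain f F where f: "finite F" "\<forall>n. f n \<in> component n" "\<forall>n. n \<notin> F \<longrightarrow> f n = 0" "v = sum f F"
      using step by blast
    define g where "g = f(n := ofc c * u + f n)"
    have "v = sum f (insert n F)" using f by (simp add: sum.insert_if)
    also have "ofc c * u + \<dots> = sum g (insert n F)"
      using f(1) by (simp add: sum.insert_remove g_def add.assoc)
    finally show ?case using f n
      by (intro exI[of _ g] exI[of _ "insert n F"])
        (auto simp: g_def component_add component_scale component_mono)
  qed
qed

end

lemma ofc_mult_ofc: "ofc a * x * (ofc b * y) = ofc (a * b) * (x * y)"
  by (subst mult.assoc, subst mult_ofc_left) simp

section \<open>Rescaling of the generators, and monomials of finite paths\<close>

context leavitt_family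
begin

text \<open>The algebraic form of the gauge action, which multiplies degree \<open>n\<close> by the
  \<open>n\<close>-th power of \<open>z\<close>. The value \<open>z = 2\<close> separates the
  degrees in the Leavitt path algebra; \<open>z\<close> on the circle computes the gauge action on
  the image in the C*-algebra.\<close>

definition rescaled :: "complex \<Rightarrow> ('v, 'e) lpa_gen \<Rightarrow> ('w, 'm) unitization" where
  "rescaled z g = (case g of Edge e \<Rightarrow> ofc z * S e | Ghost e \<Rightarrow> ofc (1 / z) * T e | Proj A \<Rightarrow> P A)"

lemma rescaled_simps [simp]:
  "rescaled z (Edge e) = ofc z * S e" "rescaled z (Ghost e) = ofc (1 / z) * T e"
  "rescaled z (Proj A) = P A"
  by (simp_all add: rescaled_def)

lemma rescaled_family:
  assumes "z \<noteq> 0" shows "leavitt_family G (rescaled z)"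
proof
  fix t u assume "(t, u) \<in> lpa_rels G"
  then show "term_value (rescaled z) t = term_value (rescaled z) u"
  proof cases
    case (ghost_edge e f)
    then show ?thesis using T_S[of e f] assms by (auto simp: ofc_mult_ofc simp del: vs.scale_scale)
  next
    case (vertex_sum v es)
    have "term_value (rescaled z) (foldr (\<lambda>e t. Add (Mult (Gen (Edge e)) (Gen (Ghost e))) t) es Zero)
      = term_value \<theta> (foldr (\<lambda>e t. Add (Mult (Gen (Edge e)) (Gen (Ghost e))) t) es Zero)"
      using assms by (induction es) (simp_all add: ofc_mult_ofc del: vs.scale_scale)
    then show ?thesis using relations[OF lpa_rels.vertex_sum[OF vertex_sum(3-)]] vertex_sum by simp
  qed (simp_all add: P_mult P_Un P_src_S S_P_rng P_rng_T T_P_src mult_ofc_left[of "\<theta> g" for g] mult.assoc)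
qed

lemma rescaled_mono_term:
  assumes "z \<noteq> 0"
  shows "term_value (rescaled z) (mono_term a A b) = ofc (z powi (int (length a) - int (length b))) * mono a A b"
proof (induction a A b rule: mono_term.induct)
  case (1 e a A b)
  have "z powi (int (length (e # a)) - int (length b)) = z * z powi (int (length a) - int (length b))"
    using power_int_add[of z 1 "int (length a) - int (length b)"] assms by (simp add: add_diff_eq)
  then show ?case using 1 by (simp add: ofc_mult_ofc del: of_nat_Suc vs.scale_scale length_Cons)
next
  case (2 A f b)
  have "z powi (int (length ([] :: 'e list)) - int (length (f # b)))
      = z powi (int (length ([] :: 'e list)) - int (length b)) * (1 / z)"
    using assms by (simp add: power_int_diff power_int_minus field_simps)
  then show ?case using 2 by (simp only: mono_term.simps term_value.simps rescaled_simps ofc_mult_ofc)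
qed simp

lemma mono_prod: "mono a A b = prod_list (map S a) * P A * prod_list (map T (rev b))"
  by (induction a A b rule: mono_term.induct) (simp_all add: mult.assoc)

text \<open>At a forbidden transition from \<open>e\<close> to \<open>f\<close> one has
  \<open>S e * S f = S e * P (rng G e) * S f = 0\<close>. With the version for ghosts this
  reconciles arbitrary words with the finite paths of the grading.\<close>

lemma prod_list_S_nonpath:
  "set es \<subseteq> edges G \<Longrightarrow> Suc i < length es \<Longrightarrow> src G (es ! Suc i) \<notin> rng G (es ! i)
    \<Longrightarrow> prod_list (map S es) = 0"
proof (induction es arbitrary: i)
  case (Cons e es)
  show ?case
  proof (cases i)
    case 0
    then obtain f fs where es: "es = f # fs" using Cons by (cases es) auto
    have "S e * S f = S e * (P (rng G e) * S f)" using S_P_rng[of e] Cons(2) es by (simp add: mult.assoc[symmetric])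
    also have "\<dots> = 0" using Cons es 0 by (simp add: P_S gverts.range)
    finally show ?thesis using es by (simp add: mult.assoc[symmetric])
  qed (use Cons in simp)
qed simp

lemma prod_list_T_nonpath:
  "set es \<subseteq> edges G \<Longrightarrow> Suc i < length es \<Longrightarrow> src G (es ! Suc i) \<notin> rng G (es ! i)
    \<Longrightarrow> prod_list (map T (rev es)) = 0"
proof (induction es arbitrary: i)
  case (Cons e es)
  show ?case
  proof (cases i)
    case 0
    then obtain f fs where es: "es = f # fs" using Cons by (cases es) auto
    have "T f * T e = T f * P (rng G e) * T e" using P_rng_T[of e] Cons(2) es by (simp add: mult.assoc)
    also have "\<dots> = 0" using Cons es 0 by (simp add: T_P gverts.range)
    finally show ?thesis using es by (simp add: mult.assoc)
  qed (use Cons in simp)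
qed simp

end

context complex_algebra
begin

lemma emb_list_prod:
  "xs \<noteq> [] \<Longrightarrow> set xs \<subseteq> carrier A \<Longrightarrow>
    list_prod A xs \<in> carrier A \<and> emb A (list_prod A xs) = prod_list (map (emb A) xs)"
  by (induction xs rule: induct_list012) (simp_all add: m_closed emb_mult)

end

context ultragraph
begin

interpretation L: complex_algebra "leavitt G" by (rule complex_algebra_leavitt)
interpretation F: leavitt_family G lpa_value by (rule lpa_value_family)

lemma lpa_gen_closed: "g \<in> lpa_gens G \<Longrightarrow> lpa_gen G g \<in> carrier (leavitt G)"
  unfolding lpa_gen_def leavitt_def by (rule alg_class_closed) simp

lemma emb_path_elt:
  assumes "finite_path G \<alpha>"
  shows "path_elt G \<alpha> \<in> carrier (leavitt G) \<and> emb (leavitt G) (path_elt G \<alpha>) =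
      (case \<alpha> of SetPath B \<Rightarrow> F.P B | EdgePath es \<Rightarrow> prod_list (map F.S es))"
    and "ghost_path_elt G \<alpha> \<in> carrier (leavitt G) \<and> emb (leavitt G) (ghost_path_elt G \<alpha>) =
      (case \<alpha> of SetPath B \<Rightarrow> F.P B | EdgePath es \<Rightarrow> prod_list (map F.T (rev es)))"
proof -
  have "path_elt G \<alpha> \<in> carrier (leavitt G) \<and> emb (leavitt G) (path_elt G \<alpha>) =
      (case \<alpha> of SetPath B \<Rightarrow> F.P B | EdgePath es \<Rightarrow> prod_list (map F.S es))
    \<and> ghost_path_elt G \<alpha> \<in> carrier (leavitt G) \<and> emb (leavitt G) (ghost_path_elt G \<alpha>) =
      (case \<alpha> of SetPath B \<Rightarrow> F.P B | EdgePath es \<Rightarrow> prod_list (map F.T (rev es)))"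
  proof (cases \<alpha>)
    case (SetPath B)
    then show ?thesis using assms by (simp add: lpa_value_def lpa_gen_closed lpa_gens_def)
  next
    case (EdgePath es)
    then have es: "es \<noteq> []" "set es \<subseteq> edges G" using assms by auto
    have "set (map (\<lambda>e. lpa_gen G (Edge e)) es) \<subseteq> carrier (leavitt G)"
      "set (map (\<lambda>e. lpa_gen G (Ghost e)) (rev es)) \<subseteq> carrier (leavitt G)"
      using es by (auto intro!: lpa_gen_closed simp: lpa_gens_def)
    then show ?thesis
      using L.emb_list_prod[of "map (\<lambda>e. lpa_gen G (Edge e)) es"]
        L.emb_list_prod[of "map (\<lambda>e. lpa_gen G (Ghost e)) (rev es)"] es EdgePath
      by (simp add: o_def lpa_value_def)
  qed
  then show "path_elt G \<alpha> \<in> carrier (leavitt G) \<and> emb (leavitt G) (path_elt G \<alpha>) =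
      (case \<alpha> of SetPath B \<Rightarrow> F.P B | EdgePath es \<Rightarrow> prod_list (map F.S es))"
    and "ghost_path_elt G \<alpha> \<in> carrier (leavitt G) \<and> emb (leavitt G) (ghost_path_elt G \<alpha>) =
      (case \<alpha> of SetPath B \<Rightarrow> F.P B | EdgePath es \<Rightarrow> prod_list (map F.T (rev es)))"
    by auto
qed

definition path_monomial where
  "path_monomial \<alpha> A \<beta> = path_elt G \<alpha> \<otimes>\<^bsub>leavitt G\<^esub> lpa_gen G (Proj A) \<otimes>\<^bsub>leavitt G\<^esub> ghost_path_elt G \<beta>"

lemma emb_path_monomial:
  assumes "finite_path G \<alpha>" "finite_path G \<beta>" "A \<in> gverts G"
  shows "path_monomial \<alpha> A \<beta> \<in> carrier (leavitt G)"
    and "emb (leavitt G) (path_monomial \<alpha> A \<beta>) =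
      (case \<alpha> of SetPath B \<Rightarrow> F.P B | EdgePath es \<Rightarrow> prod_list (map F.S es)) * F.P A *
      (case \<beta> of SetPath B \<Rightarrow> F.P B | EdgePath es \<Rightarrow> prod_list (map F.T (rev es)))"
proof -
  have A: "lpa_gen G (Proj A) \<in> carrier (leavitt G)"
    using assms(3) by (intro lpa_gen_closed) (simp add: lpa_gens_def)
  note \<alpha> = emb_path_elt(1)[OF assms(1)] and \<beta> = emb_path_elt(2)[OF assms(2)]
  show "path_monomial \<alpha> A \<beta> \<in> carrier (leavitt G)"
    unfolding path_monomial_def using \<alpha> \<beta> A by (simp add: L.m_closed)
  show "emb (leavitt G) (path_monomial \<alpha> A \<beta>) =
      (case \<alpha> of SetPath B \<Rightarrow> F.P B | EdgePath es \<Rightarrow> prod_list (map F.S es)) * F.P A *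
      (case \<beta> of SetPath B \<Rightarrow> F.P B | EdgePath es \<Rightarrow> prod_list (map F.T (rev es)))"
    unfolding path_monomial_def using \<alpha> \<beta> A by (simp add: L.emb_mult L.m_closed lpa_value_def[symmetric])
qed

lemma path_monomial_in_monomials:
  assumes "finite_path G \<alpha>" "finite_path G \<beta>" "A \<in> gverts G"
  shows "emb (leavitt G) (path_monomial \<alpha> A \<beta>) \<in> F.monomials (int (path_length \<alpha>) - int (path_length \<beta>))"
proof -
  \<comment> \<open>A path of length 0 contributes the empty word, and its set is intersected with
    the set in the middle.\<close>
  define a B where "a = (case \<alpha> of SetPath B \<Rightarrow> [] | EdgePath es \<Rightarrow> es)"
    and "B = (case \<alpha> of SetPath B \<Rightarrow> B \<inter> A | EdgePath es \<Rightarrow> A)"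
  define b C where "b = (case \<beta> of SetPath C \<Rightarrow> [] | EdgePath es \<Rightarrow> es)"
    and "C = (case \<beta> of SetPath C \<Rightarrow> B \<inter> C | EdgePath es \<Rightarrow> B)"
  have B: "B \<in> gverts G" using assms by (auto simp: B_def gverts_Int split: upath.split)
  have "(case \<alpha> of SetPath B \<Rightarrow> F.P B | EdgePath es \<Rightarrow> prod_list (map F.S es)) * F.P A
    = prod_list (map F.S a) * F.P B"
    using assms by (auto simp: a_def B_def F.P_mult split: upath.split)
  moreover have "F.P B * (case \<beta> of SetPath B \<Rightarrow> F.P B | EdgePath es \<Rightarrow> prod_list (map F.T (rev es)))
    = F.P C * prod_list (map F.T (rev b))"
    using assms B by (auto simp: b_def C_def F.P_mult split: upath.split)
  ultimately have "emb (leavitt G) (path_monomial \<alpha> A \<beta>) = F.mono a C b"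
    unfolding emb_path_monomial(2)[OF assms] F.mono_prod by (simp add: mult.assoc)
  moreover have "C \<in> gverts G" using assms B by (auto simp: C_def gverts_Int split: upath.split)
  moreover have "set a \<subseteq> edges G" "length a = path_length \<alpha>"
    using assms by (auto simp: a_def split: upath.split)
  moreover have "set b \<subseteq> edges G" "length b = path_length \<beta>"
    using assms by (auto simp: b_def split: upath.split)
  ultimately show ?thesis by (metis F.monomialsI)
qed

lemma monomial_is_path_monomial:
  assumes "x \<in> F.monomials n"
  shows "x = 0 \<or> (\<exists>\<alpha> A \<beta>. finite_path G \<alpha> \<and> finite_path G \<beta> \<and> A \<in> gverts G
    \<and> int (path_length \<alpha>) - int (path_length \<beta>) = n \<and> x = emb (leavitt G) (path_monomial \<alpha> A \<beta>))"
proof -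
  obtain a A b where x: "x = F.mono a A b" "set a \<subseteq> edges G" "set b \<subseteq> edges G" "A \<in> gverts G"
    "int (length a) - int (length b) = n" using assms by (auto simp: F.monomials_def)
  \<comment> \<open>\<open>EdgePath []\<close> is no finite path, so an empty word becomes
    \<open>SetPath A\<close>, whose projection is absorbed by \<open>P A\<close>.\<close>
  define \<alpha> \<beta> :: "('v, 'e) upath" where "\<alpha> = (if a = [] then SetPath A else EdgePath a)"
    and "\<beta> = (if b = [] then SetPath A else EdgePath b)"
  show ?thesis
  proof (cases "finite_path G \<alpha> \<and> finite_path G \<beta>")
    case True
    have "y * F.P A * F.P A = y * F.P A" for y using x(4) by (simp add: mult.assoc F.P_mult)
    then have "x = emb (leavitt G) (path_monomial \<alpha> A \<beta>)"
      unfolding x(1) F.mono_prod using x(4) emb_path_monomial(2)[of \<alpha> \<beta> A] True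
      by (cases "a = []"; cases "b = []") (simp_all add: \<alpha>_def \<beta>_def F.P_mult mult.assoc[symmetric])
    moreover have "int (path_length \<alpha>) - int (path_length \<beta>) = n"
      using x(5) by (auto simp: \<alpha>_def \<beta>_def)
    ultimately show ?thesis using True x(4) by blast
  next
    case False
    then have "prod_list (map F.S a) = 0 \<or> prod_list (map F.T (rev b)) = 0"
      using x F.prod_list_S_nonpath[of a] F.prod_list_T_nonpath[of b]
      by (auto simp: \<alpha>_def \<beta>_def split: if_splits)
    then show ?thesis unfolding x(1) F.mono_prod by auto
  qed
qed

lemma leavitt_component_closed: "leavitt_component G n \<subseteq> carrier (leavitt G)"
  and emb_leavitt_component: "emb (leavitt G) ` leavitt_component G n = F.component n"
proof -
  let ?X = "{c \<odot>\<^bsub>leavitt G\<^esub> path_monomial \<alpha> A \<beta> | c \<alpha> A \<beta>. finite_path G \<alpha> \<and> finite_path G \<beta> \<and> A \<in> gverts G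
           \<and> int (path_length \<alpha>) - int (path_length \<beta>) = n}"
  have comp: "leavitt_component G n = finite_sums (leavitt G) ?X"
    unfolding leavitt_component_def path_monomial_def ..
  have X: "?X \<subseteq> carrier (leavitt G)" using emb_path_monomial(1) by auto
  then show "leavitt_component G n \<subseteq> carrier (leavitt G)" unfolding comp by (rule L.finite_sums_closed)
  have "emb (leavitt G) ` leavitt_component G n = vs.span (emb (leavitt G) ` ?X)"
    unfolding comp
  proof (rule L.emb_finite_sums[OF X])
    fix d x assume "x \<in> ?X"
    then obtain c \<alpha> A \<beta> where *: "x = c \<odot>\<^bsub>leavitt G\<^esub> path_monomial \<alpha> A \<beta>" "finite_path G \<alpha>" "finite_path G \<beta>"
      "A \<in> gverts G" "int (path_length \<alpha>) - int (path_length \<beta>) = n" by blast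
    then have "d \<odot>\<^bsub>leavitt G\<^esub> x = (d * c) \<odot>\<^bsub>leavitt G\<^esub> path_monomial \<alpha> A \<beta>"
      using emb_path_monomial(1) by (simp add: L.scale_scale)
    then show "d \<odot>\<^bsub>leavitt G\<^esub> x \<in> ?X" using * by blast
  qed
  also have "\<dots> = F.component n"
    unfolding F.component_def
  proof (rule vs.span_eq[THEN iffD2], intro conjI subsetI)
    fix u assume "u \<in> emb (leavitt G) ` ?X"
    then obtain c \<alpha> A \<beta> where *: "u = emb (leavitt G) (c \<odot>\<^bsub>leavitt G\<^esub> path_monomial \<alpha> A \<beta>)" "finite_path G \<alpha>" "finite_path G \<beta>"
      "A \<in> gverts G" "int (path_length \<alpha>) - int (path_length \<beta>) = n" by blast
    then have "u = ofc c * emb (leavitt G) (path_monomial \<alpha> A \<beta>)"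
      using emb_path_monomial(1) by (simp add: L.emb_scale)
    moreover have "emb (leavitt G) (path_monomial \<alpha> A \<beta>) \<in> F.monomials n"
      using path_monomial_in_monomials * by metis
    ultimately show "u \<in> vs.span (F.monomials n)" by (simp add: vs.span_base vs.span_scale)
  next
    fix u assume u: "u \<in> F.monomials n"
    show "u \<in> vs.span (emb (leavitt G) ` ?X)"
    proof (cases "u = 0")
      case False
      then obtain \<alpha> A \<beta> where *: "finite_path G \<alpha>" "finite_path G \<beta>" "A \<in> gverts G"
        "int (path_length \<alpha>) - int (path_length \<beta>) = n" "u = emb (leavitt G) (path_monomial \<alpha> A \<beta>)"
        using monomial_is_path_monomial[OF u] by blast
      then have "1 \<odot>\<^bsub>leavitt G\<^esub> path_monomial \<alpha> A \<beta> \<in> ?X" by blast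
      then have "path_monomial \<alpha> A \<beta> \<in> ?X" using emb_path_monomial(1) * by simp
      then show ?thesis unfolding *(5) by (intro vs.span_base imageI)
    qed (simp add: vs.span_zero)
  qed
  finally show "emb (leavitt G) ` leavitt_component G n = F.component n" .
qed

end

section \<open>The grading of the Leavitt path algebra\<close>

context ultragraph
begin

interpretation L: complex_algebra "leavitt G" by (rule complex_algebra_leavitt)
interpretation F: leavitt_family G lpa_value by (rule lpa_value_family)

lemma lift_rescaled_component:
  assumes "z \<noteq> 0" "x \<in> F.component n"
  shows "x \<in> lpa_range \<and> lift (F.rescaled z) x = ofc (z powi n) * x"
  using assms(2) unfolding F.component_def
proof (induction rule: vs.span_induct_alt)
  case base
  then show ?case using lift_0[OF F.rescaled_family[OF assms(1)]] by simp
next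
  case (step c u v)
  note fam = F.rescaled_family[OF assms(1)]
  obtain a A b where u: "u = F.mono a A b" "valid_term (mono_term a A b)" "int (length a) - int (length b) = n"
    using step(1) valid_mono_term by (auto simp: F.monomials_def)
  have u': "u \<in> lpa_range" "lift (F.rescaled z) u = ofc (z powi n) * u"
    using u lift_term_value[OF fam u(2)] F.rescaled_mono_term[OF assms(1), of a A b]
    unfolding emb_carrier_leavitt by auto
  show ?case
    using lift_add[OF fam lift_scale(1)[OF fam u'(1), of c]] lift_scale(2)[OF fam u'(1), of c] u'(2) step.IH
    by (simp add: semiring_class.distrib_left mult.commute)
qed

text \<open>Rescaling by 2 multiplies degree \<open>n\<close> by \<open>2 powi n\<close>.
  Subtracting \<open>2 powi m\<close> times the relation eliminates degree \<open>m\<close>, and the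
  factors \<open>2 powi n - 2 powi m\<close> that the other degrees acquire do not vanish.\<close>

lemma component_independent:
  assumes "finite I" "\<And>n. f n \<in> F.component n" "(\<Sum>n\<in>I. f n) = 0" "n \<in> I"
  shows "f n = 0"
  using assms
proof (induction I arbitrary: f n rule: finite_induct)
  case (insert m I)
  let ?z = "\<lambda>n. (2 :: complex) powi n"
  note fam = F.rescaled_family[of 2, simplified]
  have sum: "f m + (\<Sum>n\<in>I. f n) = 0" using insert by simp
  have "(\<Sum>n\<in>insert m I. ofc (?z n) * f n) = lift (F.rescaled 2) (\<Sum>n\<in>insert m I. f n)"
    using lift_sum[OF fam, of "insert m I" f] lift_rescaled_component[of 2 "f n" n for n] insert by simp
  also have "\<dots> = 0" using insert(5) lift_0[OF fam] by simp
  finally have "ofc (?z m) * f m + (\<Sum>n\<in>I. ofc (?z n) * f n) = 0" using insert by simp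
  moreover have "ofc (?z m) * f m + (\<Sum>n\<in>I. ofc (?z m) * f n) = 0"
    using arg_cong[OF sum, of "\<lambda>x. ofc (?z m) * x"]
    by (simp add: semiring_class.distrib_left sum_distrib_left)
  ultimately have "ofc (?z m) * f m + (\<Sum>n\<in>I. ofc (?z n) * f n)
    = ofc (?z m) * f m + (\<Sum>n\<in>I. ofc (?z m) * f n)" by (simp only:)
  then have "(\<Sum>n\<in>I. ofc (?z n) * f n) = (\<Sum>n\<in>I. ofc (?z m) * f n)" by (rule add_left_imp_eq)
  then have "(\<Sum>n\<in>I. ofc (?z n - ?z m) * f n) = 0"
    by (simp add: vs.scale_left_diff_distrib sum_subtractf)
  then have I: "ofc (?z n - ?z m) * f n = 0" if "n \<in> I" for n
    using insert.IH[of "\<lambda>n. ofc (?z n - ?z m) * f n" n] that insert.prems(1) F.component_scale by simp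
  have zero: "f n = 0" if "n \<in> I" for n
  proof -
    have "?z n \<noteq> ?z m"
    proof
      assume "?z n = ?z m"
      then have "norm (?z n) = norm (?z m)" by simp
      then have "(2 :: real) powi n = 2 powi m" by (simp add: norm_power_int)
      then have "n = m" by (metis power_int_strict_increasing linorder_neqE less_irrefl one_less_numeral_iff semiring_norm(76))
      then show False using that insert by simp
    qed
    then show ?thesis using I[OF that] by simp
  qed
  then have "f m = 0" using sum by simp
  then show ?case using zero insert.prems(3) by auto
qed simp

lemma mem_leavitt_component_iff:
  "x \<in> carrier (leavitt G) \<Longrightarrow> x \<in> leavitt_component G n \<longleftrightarrow> emb (leavitt G) x \<in> F.component n"
  unfolding emb_leavitt_component[symmetric]
  using leavitt_component_closed[of n] L.emb_eq_iff by (auto simp: subset_iff image_iff)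

lemma leavitt_graded: "graded (leavitt G) (leavitt_component G)"
  unfolding graded_def
proof (intro conjI allI ballI)
  note mem = mem_leavitt_component_iff and closed = subsetD[OF leavitt_component_closed]
  show "linear_subspace (leavitt G) (leavitt_component G n)" for n
    unfolding linear_subspace_def
  proof (intro conjI ballI allI leavitt_component_closed)
    show "\<zero>\<^bsub>leavitt G\<^esub> \<in> leavitt_component G n" by (subst mem) simp_all
    fix x assume x: "x \<in> leavitt_component G n"
    show "c \<odot>\<^bsub>leavitt G\<^esub> x \<in> leavitt_component G n" for c
      using x closed[OF x] by (simp add: mem L.emb_scale F.component_scale)
    fix y assume y: "y \<in> leavitt_component G n"
    show "x \<oplus>\<^bsub>leavitt G\<^esub> y \<in> leavitt_component G n"
      using x y closed[OF x] closed[OF y] by (simp add: mem L.emb_add F.component_add)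
  qed
  show "set_prod (leavitt G) (leavitt_component G m) (leavitt_component G n) \<subseteq> leavitt_component G (m + n)" for m n
  proof
    fix z assume "z \<in> set_prod (leavitt G) (leavitt_component G m) (leavitt_component G n)"
    then obtain x y where xy: "x \<in> leavitt_component G m" "y \<in> leavitt_component G n" "z = x \<otimes>\<^bsub>leavitt G\<^esub> y"
      by (auto simp: set_prod_def)
    then show "z \<in> leavitt_component G (m + n)"
      using closed[OF xy(1)] closed[OF xy(2)] by (simp add: mem L.emb_mult L.m_closed F.component_mult)
  qed
  fix x assume x: "x \<in> carrier (leavitt G)"
  let ?Q = "\<lambda>f. (\<forall>n. f n \<in> leavitt_component G n) \<and> finite {n. f n \<noteq> \<zero>\<^bsub>leavitt G\<^esub>}
         \<and> x = finsum (leavitt G) f {n. f n \<noteq> \<zero>\<^bsub>leavitt G\<^esub>}"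
  have emb_sum: "emb (leavitt G) (finsum (leavitt G) f I) = (\<Sum>n\<in>I. emb (leavitt G) (f n))"
    if "finite I" "\<And>n. f n \<in> leavitt_component G n" for f I
    using that closed by (intro L.emb_finsum) auto
  have supp: "sum (\<lambda>n. emb (leavitt G) (f n)) {n. f n \<noteq> \<zero>\<^bsub>leavitt G\<^esub>} = sum (\<lambda>n. emb (leavitt G) (f n)) I"
    if "finite I" "{n. f n \<noteq> \<zero>\<^bsub>leavitt G\<^esub>} \<subseteq> I" for f :: "int \<Rightarrow> _" and I
    using that by (intro sum.mono_neutral_left) auto
  obtain t where t: "valid_term t" "emb (leavitt G) x = term_value lpa_value t"
    using x imageI[OF x, of "emb (leavitt G)"] unfolding emb_carrier_leavitt by blast
  obtain f I where f: "finite I" "\<forall>n. f n \<in> F.component n" "\<forall>n. n \<notin> I \<longrightarrow> f n = 0" "term_value lpa_value t = sum f I"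
    using F.term_value_homogeneous[OF t(1)] by blast
  define h where "h = (\<lambda>n. inv_into (leavitt_component G n) (emb (leavitt G)) (f n))"
  have h: "h n \<in> leavitt_component G n" "emb (leavitt G) (h n) = f n" for n
    using f(2)[rule_format, of n] unfolding emb_leavitt_component[symmetric] h_def
    by (auto intro: inv_into_into simp: f_inv_into_f)
  have hI: "{n. h n \<noteq> \<zero>\<^bsub>leavitt G\<^esub>} \<subseteq> I"
  proof
    fix n assume "n \<in> {n. h n \<noteq> \<zero>\<^bsub>leavitt G\<^esub>}"
    then have "f n \<noteq> 0" using h[of n] closed[OF h(1)[of n]] L.emb_eq_iff[of "h n" "\<zero>\<^bsub>leavitt G\<^esub>"] by simp
    then show "n \<in> I" using f(3) by blast
  qed
  then have fin: "finite {n. h n \<noteq> \<zero>\<^bsub>leavitt G\<^esub>}" using f(1) finite_subset by blast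
  show "\<exists>!f. ?Q f"
  proof (rule ex1I[of _ h])
    have "emb (leavitt G) (finsum (leavitt G) h {n. h n \<noteq> \<zero>\<^bsub>leavitt G\<^esub>}) = emb (leavitt G) x"
      unfolding emb_sum[OF fin h(1)] supp[OF f(1) hI] using h(2) f(4) t(2) by simp
    then have "finsum (leavitt G) h {n. h n \<noteq> \<zero>\<^bsub>leavitt G\<^esub>} = x"
      using x h(1) closed by (subst (asm) L.emb_eq_iff) (auto intro!: L.M.finsum_closed)
    then show "?Q h" using h(1) fin by auto
    fix k assume k: "?Q k"
    show "k = h"
    proof
      fix n
      let ?I = "insert n ({n. k n \<noteq> \<zero>\<^bsub>leavitt G\<^esub>} \<union> {n. h n \<noteq> \<zero>\<^bsub>leavitt G\<^esub>})"
      have I: "finite ?I" using k fin by simp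
      have "(\<Sum>n\<in>?I. emb (leavitt G) (k n)) = emb (leavitt G) x"
        using k emb_sum[of "{n. k n \<noteq> \<zero>\<^bsub>leavitt G\<^esub>}" k]
        by (subst supp[OF I, symmetric]) auto
      moreover have "(\<Sum>n\<in>?I. emb (leavitt G) (h n)) = emb (leavitt G) x"
        using \<open>?Q h\<close> emb_sum[of "{n. h n \<noteq> \<zero>\<^bsub>leavitt G\<^esub>}" h]
        by (subst supp[OF I, symmetric]) auto
      ultimately have "(\<Sum>n\<in>?I. emb (leavitt G) (k n) - emb (leavitt G) (h n)) = 0"
        by (simp add: sum_subtractf)
      moreover have "emb (leavitt G) (k n) - emb (leavitt G) (h n) \<in> F.component n" for n
        using k h(1) closed mem by (intro F.component_diff) blast+
      ultimately have "emb (leavitt G) (k n) - emb (leavitt G) (h n) = 0"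
        using component_independent[OF I, of "\<lambda>n. emb (leavitt G) (k n) - emb (leavitt G) (h n)" n] by blast
      moreover have "k n \<in> carrier (leavitt G)" "h n \<in> carrier (leavitt G)" using k h(1) closed by blast+
      ultimately show "k n = h n" using L.emb_eq_iff by simp
    qed
  qed
qed

lemma strongly_graded_leavitt_iff:
  "strongly_graded (leavitt G) (leavitt_component G) \<longleftrightarrow>
   (\<forall>n. \<forall>A\<in>gverts G. F.P A \<in> vs.span {x * y | x y. x \<in> F.component (- n) \<and> y \<in> F.component n})"
proof -
  note closed = leavitt_component_closed
  have "emb (leavitt G) ` finite_sums (leavitt G) (set_prod (leavitt G) (leavitt_component G m) (leavitt_component G n))
    = vs.span {x * y | x y. x \<in> F.component m \<and> y \<in> F.component n}" for m n
  proof -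
    let ?S = "set_prod (leavitt G) (leavitt_component G m) (leavitt_component G n)"
    have "c \<odot>\<^bsub>leavitt G\<^esub> z \<in> ?S" if "z \<in> ?S" for c z
    proof -
      obtain x y where xy: "x \<in> leavitt_component G m" "y \<in> leavitt_component G n" "z = x \<otimes>\<^bsub>leavitt G\<^esub> y"
        using \<open>z \<in> ?S\<close> by (auto simp: set_prod_def)
      then have "c \<odot>\<^bsub>leavitt G\<^esub> z = (c \<odot>\<^bsub>leavitt G\<^esub> x) \<otimes>\<^bsub>leavitt G\<^esub> y"
        using closed by (simp add: L.smult_mult_left subset_iff)
      moreover have "c \<odot>\<^bsub>leavitt G\<^esub> x \<in> leavitt_component G m"
        using leavitt_graded xy(1) by (simp add: graded_def linear_subspace_def)
      ultimately show ?thesis using xy(2) by (auto simp: set_prod_def)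
    qed
    then show ?thesis
      using L.emb_finite_sums[OF L.set_prod_subset_carrier[OF closed closed]]
        L.emb_set_prod[OF closed closed] by (simp add: emb_leavitt_component)
  qed
  moreover have "finite_sums (leavitt G) (set_prod (leavitt G) (leavitt_component G m) (leavitt_component G n)) \<subseteq> carrier (leavitt G)" for m n
    by (intro L.finite_sums_closed L.set_prod_subset_carrier closed)
  ultimately have "finite_sums (leavitt G) (set_prod (leavitt G) (leavitt_component G m) (leavitt_component G n))
      = leavitt_component G (m + n) \<longleftrightarrow>
    vs.span {x * y | x y. x \<in> F.component m \<and> y \<in> F.component n} = F.component (m + n)" for m n
    using L.emb_image_eq_iff[OF _ closed] by (metis emb_leavitt_component)
  then show ?thesis
    unfolding strongly_graded_def F.strongly_graded_iff[symmetric] using leavitt_graded by simp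
qed

end

section \<open>Norm estimates in C*-algebras\<close>

context cstar_algebra
begin

abbreviation "E \<equiv> emb A ` carrier A"

text \<open>The scalar part is ignored, so this is a norm on \<open>E\<close> only.\<close>

definition nm where "nm u = nrm A (coordinate A u)"

definition star where "star u = ofc (cnj (scalar_part u)) + emb A (adj A (coordinate A u))"

lemma nm_emb [simp]: "x \<in> carrier A \<Longrightarrow> nm (emb A x) = nrm A x"
  by (simp add: nm_def)

lemma star_emb [simp]: "x \<in> carrier A \<Longrightarrow> star (emb A x) = emb A (adj A x)"
  by (simp add: star_def)

lemma E_add: "x \<in> E \<Longrightarrow> y \<in> E \<Longrightarrow> x + y \<in> E"
  by (auto simp: emb_add[symmetric])

lemma E_mult_left: "x \<in> E \<Longrightarrow> u * x \<in> E"
  using emb_mult_range(1) by force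

lemma E_mult_right: "x \<in> E \<Longrightarrow> x * u \<in> E"
  using emb_mult_range(2) by force

lemma E_scale: "x \<in> E \<Longrightarrow> ofc c * x \<in> E"
  by (rule E_mult_left)

lemma E_uminus: "x \<in> E \<Longrightarrow> - x \<in> E"
  using E_mult_left[of x "- 1"] by simp

lemma E_diff: "x \<in> E \<Longrightarrow> y \<in> E \<Longrightarrow> x - y \<in> E"
  using E_add[of x "- y"] E_uminus[of y] by simp

lemma E_0: "0 \<in> E"
  using emb_zero by (metis imageI M.zero_closed)

lemmas E_closed = E_add E_mult_left E_mult_right E_uminus E_diff E_0

lemma E_star: "x \<in> E \<Longrightarrow> star x \<in> E"
  by (auto simp: adj_closed)

lemma star_star: "x \<in> E \<Longrightarrow> star (star x) = x"
  by (auto simp: adj_closed adj_adj)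

lemma star_add: "x \<in> E \<Longrightarrow> y \<in> E \<Longrightarrow> star (x + y) = star x + star y"
  by (auto simp: emb_add[symmetric] adj_add adj_closed)

lemma star_mult: "x \<in> E \<Longrightarrow> y \<in> E \<Longrightarrow> star (x * y) = star y * star x"
  by (auto simp: emb_mult[symmetric] adj_mult adj_closed m_closed)

lemma star_scale: "x \<in> E \<Longrightarrow> star (ofc c * x) = ofc (cnj c) * star x"
  by (auto simp: emb_scale[symmetric] adj_smult adj_closed)

lemma star_0: "star 0 = 0"
  using star_scale[OF E_0, of 0] by simp

lemma star_uminus: "x \<in> E \<Longrightarrow> star (- x) = - star x"
  using star_scale[of x "- 1"] by simp

lemma star_diff: "x \<in> E \<Longrightarrow> y \<in> E \<Longrightarrow> star (x - y) = star x - star y"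
  using star_add[of x "- y"] star_uminus[of y] E_uminus[of y] by simp

lemma nm_nonneg: "x \<in> E \<Longrightarrow> 0 \<le> nm x"
  by (auto simp: nrm_nonneg)

lemma nm_eq_0: "x \<in> E \<Longrightarrow> nm x = 0 \<longleftrightarrow> x = 0"
proof -
  assume "x \<in> E"
  then obtain a where "a \<in> carrier A" "x = emb A a" by blast
  then show ?thesis using emb_eq_iff[of a \<zero>] by (simp add: nrm_eq_zero)
qed

lemma nm_0 [simp]: "nm 0 = 0"
  using nm_eq_0[OF E_0] by simp

lemma nm_triangle: "x \<in> E \<Longrightarrow> y \<in> E \<Longrightarrow> nm (x + y) \<le> nm x + nm y"
  by (auto simp: emb_add[symmetric] nrm_triangle)

lemma nm_scale: "x \<in> E \<Longrightarrow> nm (ofc c * x) = cmod c * nm x"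
  by (auto simp: emb_scale[symmetric] nrm_smult)

lemma nm_uminus: "x \<in> E \<Longrightarrow> nm (- x) = nm x"
  using nm_scale[of x "- 1"] by simp

lemma nm_triangle_diff: "x \<in> E \<Longrightarrow> y \<in> E \<Longrightarrow> nm (x - y) \<le> nm x + nm y"
  using nm_triangle[of x "- y"] by (simp add: nm_uminus E_uminus)

lemma nm_minus_commute: "x \<in> E \<Longrightarrow> y \<in> E \<Longrightarrow> nm (x - y) = nm (y - x)"
  using nm_uminus[of "x - y"] E_diff by simp

lemma nm_mult: "x \<in> E \<Longrightarrow> y \<in> E \<Longrightarrow> nm (x * y) \<le> nm x * nm y"
  by (auto simp: emb_mult[symmetric] nrm_mult m_closed)

lemma nm_cstar: "x \<in> E \<Longrightarrow> nm (star x * x) = (nm x)\<^sup>2"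
  by (auto simp: emb_mult[symmetric] adj_closed cstar_identity m_closed)

lemma nm_star: "x \<in> E \<Longrightarrow> nm (star x) = nm x"
proof -
  have le: "nm x \<le> nm (star x)" if "x \<in> E" for x
  proof (cases "nm x = 0")
    case False
    have "nm x * nm x \<le> nm (star x) * nm x"
      using nm_cstar[OF that] nm_mult[OF E_star[OF that] that] by (simp add: power2_eq_square)
    then show ?thesis using False nm_nonneg[OF that] by simp
  qed (use that E_star nm_nonneg in simp)
  show "x \<in> E \<Longrightarrow> nm (star x) = nm x"
    using le[of x] le[of "star x"] by (simp add: E_star star_star)
qed

lemma nm_star_mult: "x \<in> E \<Longrightarrow> nm (x * star x) = (nm x)\<^sup>2"
  using nm_cstar[of "star x"] by (simp add: E_star star_star nm_star)

lemma metric_space: "Metric_space (carrier A) (cdist A)"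
proof -
  have d: "cdist A x y = nm (emb A x - emb A y)" if "x \<in> carrier A" "y \<in> carrier A" for x y
    using that by (simp add: cdist_def nm_def coordinate_diff)
  show ?thesis
  proof
    fix x y
    show "0 \<le> cdist A x y" by (simp add: cdist_def nrm_nonneg)
    show "cdist A x y = cdist A y x"
    proof (cases "x \<in> carrier A \<and> y \<in> carrier A")
      case True
      then show ?thesis by (simp add: d nm_minus_commute)
    qed (auto simp: cdist_def)
    assume x: "x \<in> carrier A" and y: "y \<in> carrier A"
    show "(cdist A x y = 0) = (x = y)"
      using x y nm_eq_0[of "emb A x - emb A y"] by (simp add: d E_diff emb_eq_iff)
    fix z assume z: "z \<in> carrier A"
    show "cdist A x z \<le> cdist A x y + cdist A y z"
      using nm_triangle[of "emb A x - emb A y" "emb A y - emb A z"] x y z by (simp add: d E_diff)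
  qed
qed

lemma cdist_nm: "x \<in> carrier A \<Longrightarrow> y \<in> carrier A \<Longrightarrow> cdist A x y = nm (emb A x - emb A y)"
  by (simp add: cdist_def nm_def coordinate_diff)

lemma nm_telescope:
  assumes "\<And>n. x n \<in> E" "\<And>n. nm (x (Suc n) - x n) \<le> C * r ^ n" "0 \<le> r" "r < 1" "0 \<le> C"
  shows "nm (x (n + k) - x n) \<le> C * r ^ n / (1 - r)"
proof -
  have "nm (x (n + k) - x n) \<le> C * r ^ n * (\<Sum>i<k. r ^ i)"
  proof (induction k)
    case (Suc k)
    have "nm (x (n + Suc k) - x n) \<le> nm (x (Suc (n + k)) - x (n + k)) + nm (x (n + k) - x n)"
      using nm_triangle[of "x (Suc (n + k)) - x (n + k)" "x (n + k) - x n"] assms(1) by (simp add: E_diff)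
    then show ?case using Suc assms(2)[of "n + k"] by (simp add: power_add algebra_simps)
  qed simp
  also have "(\<Sum>i<k. r ^ i) \<le> 1 / (1 - r)"
    using assms by (simp add: sum_gp_strict divide_right_mono)
  then have "C * r ^ n * (\<Sum>i<k. r ^ i) \<le> C * r ^ n * (1 / (1 - r))"
    using assms by (intro mult_left_mono) auto
  finally show ?thesis by simp
qed

lemma nm_convergent:
  assumes "\<And>n. x n \<in> E" "\<And>n. nm (x (Suc n) - x n) \<le> C * r ^ n" "0 \<le> r" "r < 1" "0 \<le> C"
  shows "\<exists>l\<in>E. (\<lambda>n. nm (x n - l)) \<longlonglongrightarrow> 0"
proof -
  interpret Metric_space "carrier A" "cdist A" by (rule metric_space)
  define a where "a n = coordinate A (x n)" for n
  have a: "a n \<in> carrier A" "x n = emb A (a n)" for n using assms(1)[of n] by (auto simp: a_def)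
  have tail: "(\<lambda>n. C * r ^ n / (1 - r)) \<longlonglongrightarrow> 0"
    using assms(3,4) by (auto intro!: tendsto_eq_intros LIMSEQ_power_zero)
  have le: "cdist A (a m) (a n) \<le> C * r ^ n / (1 - r)" if "n \<le> m" for m n
    using nm_telescope[OF assms, of n "m - n"] a that by (simp add: cdist_nm)
  have "MCauchy a"
    unfolding MCauchy_def
  proof (intro conjI allI impI)
    show "range a \<subseteq> carrier A" using a by auto
    fix \<epsilon> :: real assume "0 < \<epsilon>"
    then obtain N where N: "\<And>n. n \<ge> N \<Longrightarrow> C * r ^ n / (1 - r) < \<epsilon>"
      using tail[THEN order_tendstoD(2), of \<epsilon>] by (auto simp: eventually_sequentially)
    have "cdist A (a n) (a m) < \<epsilon>" if "N \<le> n" "N \<le> m" for n m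
    proof (cases "n \<le> m")
      case True
      then show ?thesis using le[OF True] N[OF that(1)] by (simp add: commute)
    next
      case False
      then show ?thesis using le[of m n] N[OF that(2)] by simp
    qed
    then show "\<exists>N. \<forall>n n'. N \<le> n \<longrightarrow> N \<le> n' \<longrightarrow> cdist A (a n) (a n') < \<epsilon>" by blast
  qed
  then obtain l where l: "limitin mtopology a l sequentially"
    using complete unfolding mcomplete_def by blast
  then have lA: "l \<in> carrier A" and "(\<lambda>n. cdist A (a n) l) \<longlonglongrightarrow> 0"
    by (auto simp: limitin_metric_dist_null)
  then have "(\<lambda>n. nm (x n - emb A l)) \<longlonglongrightarrow> 0" using a by (simp add: cdist_nm)
  then show ?thesis using lA by blast
qed

lemma nm_limit_unique:
  assumes "\<And>n. x n \<in> E" "l \<in> E" "m \<in> E" "(\<lambda>n. nm (x n - l)) \<longlonglongrightarrow> 0" "(\<lambda>n. nm (x n - m)) \<longlonglongrightarrow> 0"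
  shows "l = m"
proof -
  have "nm (l - m) \<le> nm (x n - l) + nm (x n - m)" for n
    using nm_triangle_diff[of "x n - m" "x n - l"] assms(1)[of n] assms(2,3) by (simp add: E_diff)
  moreover have "(\<lambda>n. nm (x n - l) + nm (x n - m)) \<longlonglongrightarrow> 0"
    using tendsto_add[OF assms(4,5)] by simp
  ultimately have "nm (l - m) \<le> 0" by (intro LIMSEQ_le_const) auto
  then have "nm (l - m) = 0" using nm_nonneg[of "l - m"] assms by (simp add: E_diff)
  then show ?thesis using nm_eq_0[of "l - m"] assms by (simp add: E_diff)
qed

text \<open>Solves \<open>(1 - v)\<^sup>2 = 1 - h\<^sup>2\<close> by iterating the contraction \<open>v \<mapsto> (h\<^sup>2 + v\<^sup>2) / 2\<close>.\<close>

lemma sqrt_exists: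
  assumes h: "h \<in> E" "star h = h" "nm h < 1"
  shows "\<exists>v\<in>E. star v = v \<and> h * v = v * h \<and> v + v = h * h + v * v"
proof -
  define r where "r = nm h"
  have r: "0 \<le> r" "r < 1" using h nm_nonneg by (auto simp: r_def)
  define v where "v = rec_nat 0 (\<lambda>_ v. ofc (1 / 2) * (h * h + v * v))"
  have v0: "v 0 = 0" and vS: "v (Suc n) = ofc (1 / 2) * (h * h + v n * v n)" for n by (simp_all add: v_def)
  have vE: "v n \<in> E" for n by (induction n) (simp_all add: v0 vS E_closed h)
  have hh: "nm (h * h) \<le> r * r" using nm_mult[OF h(1) h(1)] by (simp add: r_def)
  \<comment> \<open>The ball of radius \<open>r\<close> is preserved: the mean of two terms of norm
    at most \<open>r * r\<close> has norm at most \<open>r * r\<close>, and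
    \<open>r < 1\<close>.\<close>
  have vr: "nm (v n) \<le> r" for n
  proof (induction n)
    case (Suc n)
    have "nm (v (Suc n)) = nm (h * h + v n * v n) / 2"
      unfolding vS using h vE by (subst nm_scale) (simp_all add: E_closed norm_divide)
    also have "nm (h * h + v n * v n) \<le> nm (h * h) + nm (v n * v n)"
      using h vE by (intro nm_triangle) (simp_all add: E_closed)
    also have "nm (v n * v n) \<le> r * r"
      using nm_mult[OF vE vE, of n n] Suc r nm_nonneg[OF vE, of n] by (meson mult_mono order_trans)
    finally have "nm (v (Suc n)) \<le> r * r" using hh by simp
    also have "\<dots> \<le> r" using r by (simp add: mult_left_le)
    finally show ?case .
  qed (simp add: v0 r)
  \<comment> \<open>A difference of squares without commutativity. On the ball of radius
    \<open>r\<close> it makes the iteration a contraction with factor \<open>r\<close>.\<close>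
  have sqdiff: "ofc (1 / 2) * (h * h + a * a) - ofc (1 / 2) * (h * h + b * b)
    = ofc (1 / 2) * (a * (a - b) + (a - b) * b)" for a b
    by (simp only: right_diff_distrib[symmetric] left_diff_distrib[symmetric])
      (simp add: right_diff_distrib left_diff_distrib)
  have "nm (v (Suc n) - v n) \<le> 1 * r ^ n" for n
  proof (induction n)
    case 0
    show ?case using vr[of 1] r by (simp add: v0)
  next
    case (Suc n)
    let ?d = "v (Suc n) - v n"
    have eq: "v (Suc (Suc n)) - v (Suc n) = ofc (1 / 2) * (v (Suc n) * ?d + ?d * v n)"
    proof -
      have "v (Suc (Suc n)) - v (Suc n)
        = ofc (1 / 2) * (h * h + v (Suc n) * v (Suc n)) - ofc (1 / 2) * (h * h + v n * v n)"
        by (simp only: vS)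
      then show ?thesis by (simp only: sqdiff)
    qed
    have dE: "?d \<in> E" using vE by (simp add: E_diff)
    have "nm (v (Suc (Suc n)) - v (Suc n)) = nm (v (Suc n) * ?d + ?d * v n) / 2"
      unfolding eq using vE dE by (subst nm_scale) (simp_all add: E_closed norm_divide)
    also have "nm (v (Suc n) * ?d + ?d * v n) \<le> nm (v (Suc n) * ?d) + nm (?d * v n)"
      using vE dE by (intro nm_triangle) (simp_all add: E_closed)
    also have "nm (v (Suc n) * ?d) \<le> r * nm ?d"
      using nm_mult[OF vE dE, of "Suc n"] vr[of "Suc n"] nm_nonneg[OF dE] by (meson mult_right_mono order_trans)
    also have "nm (?d * v n) \<le> nm ?d * r"
      using nm_mult[OF dE vE, of n] vr[of n] nm_nonneg[OF dE] by (meson mult_left_mono order_trans)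
    finally have "nm (v (Suc (Suc n)) - v (Suc n)) \<le> r * nm ?d" by simp
    also have "\<dots> \<le> r * r ^ n" using Suc r by (intro mult_left_mono) auto
    finally show ?case by simp
  qed
  then obtain l where l: "l \<in> E" "(\<lambda>n. nm (v n - l)) \<longlonglongrightarrow> 0"
    using nm_convergent[where x = v and C = 1 and r = r] vE r by auto
  have sa: "star (v n) = v n" for n
    using h vE by (induction n) (simp_all add: v0 vS star_scale E_closed star_add star_mult star_0)
  have com: "h * v n = v n * h" for n
  proof (induction n)
    case (Suc n)
    have "h * (v n * v n) = (h * v n) * v n" by (simp add: mult.assoc)
    also have "\<dots> = v n * (h * v n)" unfolding Suc by (simp only: mult.assoc Suc)
    also have "\<dots> = v n * v n * h" unfolding Suc by (simp only: mult.assoc)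
    finally have "h * (h * h + v n * v n) = (h * h + v n * v n) * h"
      by (simp only: semiring_class.distrib_left semiring_class.distrib_right mult.assoc)
    then show ?case unfolding vS mult_ofc_left by (simp only: mult.assoc)
  qed (simp add: v0)
  have "nm (v n - star l) = nm (v n - l)" for n
    using nm_star[of "v n - l"] vE[of n] l(1) by (simp add: star_diff sa E_diff)
  then have "star l = l"
    using nm_limit_unique[OF vE E_star[OF l(1)] l(1)] l(2) by simp
  moreover have "h * l = l * h"
  proof (rule nm_limit_unique)
    have *: "(\<lambda>n. nm h * nm (v n - l)) \<longlonglongrightarrow> 0" using tendsto_mult_left[OF l(2), of "nm h"] by simp
    show "h * v n \<in> E" for n using vE by (simp add: E_closed)
    show "h * l \<in> E" "l * h \<in> E" using l by (simp_all add: E_closed)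
    show "(\<lambda>n. nm (h * v n - h * l)) \<longlonglongrightarrow> 0"
    proof (rule tendsto_sandwich[OF _ _ tendsto_const *])
      show "\<forall>\<^sub>F n in sequentially. 0 \<le> nm (h * v n - h * l)" using vE l by (simp add: nm_nonneg E_closed)
      have "nm (h * v n - h * l) \<le> nm h * nm (v n - l)" for n
        using nm_mult[OF h(1) E_diff[OF vE l(1)], of n] by (simp add: right_diff_distrib)
      then show "\<forall>\<^sub>F n in sequentially. nm (h * v n - h * l) \<le> nm h * nm (v n - l)" by simp
    qed
    show "(\<lambda>n. nm (h * v n - l * h)) \<longlonglongrightarrow> 0"
    proof (rule tendsto_sandwich[OF _ _ tendsto_const *])
      show "\<forall>\<^sub>F n in sequentially. 0 \<le> nm (h * v n - l * h)" using vE l h by (simp add: nm_nonneg E_closed)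
      have "nm (h * v n - l * h) \<le> nm h * nm (v n - l)" for n
        using nm_mult[OF E_diff[OF vE l(1)] h(1), of n] unfolding com by (simp add: left_diff_distrib mult.commute)
      then show "\<forall>\<^sub>F n in sequentially. nm (h * v n - l * h) \<le> nm h * nm (v n - l)" by simp
    qed
  qed
  moreover have "l = ofc (1 / 2) * (h * h + l * l)"
  proof (rule nm_limit_unique)
    show "v (Suc n) \<in> E" for n by (rule vE)
    show "l \<in> E" "ofc (1 / 2) * (h * h + l * l) \<in> E" using l h by (simp_all add: E_closed)
    show "(\<lambda>n. nm (v (Suc n) - l)) \<longlonglongrightarrow> 0" using l(2) by (rule LIMSEQ_Suc)
    have *: "(\<lambda>n. (r + nm l) * nm (v n - l)) \<longlonglongrightarrow> 0" using tendsto_mult_left[OF l(2), of "r + nm l"] by simp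
    show "(\<lambda>n. nm (v (Suc n) - ofc (1 / 2) * (h * h + l * l))) \<longlonglongrightarrow> 0"
    proof (rule tendsto_sandwich[OF _ _ tendsto_const *])
      show "\<forall>\<^sub>F n in sequentially. 0 \<le> nm (v (Suc n) - ofc (1 / 2) * (h * h + l * l))"
        using vE l h by (intro always_eventually allI nm_nonneg) (simp add: E_closed)
      have "nm (v (Suc n) - ofc (1 / 2) * (h * h + l * l)) \<le> (r + nm l) * nm (v n - l)" for n
      proof -
        let ?d = "v n - l"
        have dE: "?d \<in> E" using vE l by (simp add: E_diff)
        have "v (Suc n) - ofc (1 / 2) * (h * h + l * l) = ofc (1 / 2) * (v n * ?d + ?d * l)"
          unfolding vS by (rule sqdiff)
        then have "nm (v (Suc n) - ofc (1 / 2) * (h * h + l * l)) = nm (v n * ?d + ?d * l) / 2"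
          using vE dE l(1) by (simp only: nm_scale[OF E_add[OF E_mult_left[OF dE] E_mult_right[OF dE]]])
            (simp add: norm_divide)
        also have "nm (v n * ?d + ?d * l) \<le> nm (v n * ?d) + nm (?d * l)"
          using vE dE by (intro nm_triangle) (simp_all add: E_closed)
        also have "nm (v n * ?d) \<le> r * nm ?d"
          using nm_mult[OF vE dE, of n] vr[of n] nm_nonneg[OF dE] by (meson mult_right_mono order_trans)
        also have "nm (?d * l) \<le> nm l * nm ?d"
          using nm_mult[OF dE l(1)] by (simp add: mult.commute)
        finally have "nm (v (Suc n) - ofc (1 / 2) * (h * h + l * l)) \<le> (r * nm ?d + nm l * nm ?d) / 2" by simp
        moreover have "0 \<le> (r + nm l) * nm ?d" using r nm_nonneg[OF l(1)] nm_nonneg[OF dE] by simp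
        ultimately show ?thesis by (simp add: algebra_simps)
      qed
      then show "\<forall>\<^sub>F n in sequentially. nm (v (Suc n) - ofc (1 / 2) * (h * h + l * l)) \<le> (r + nm l) * nm (v n - l)" by simp
    qed
  qed
  then have "l + l = ofc 2 * (ofc (1 / 2) * (h * h + l * l))"
    by (metis ofc_1 ofc_add one_add_one semiring_class.distrib_right mult_1_left)
  then have "l + l = h * h + l * l" by simp
  ultimately show ?thesis using l(1) by blast
qed

end

lemma ofc_double: "x + x = ofc 2 * x"
proof -
  have "ofc 2 * x = (ofc 1 + ofc 1) * x" by (simp only: ofc_add[symmetric] one_add_one)
  then show ?thesis by (simp only: ofc_1 semiring_class.distrib_right mult_1_left)
qed

section \<open>Bounds for multiplication by elements of the unitization\<close>

type_synonym 'a cstar_unitization = "('a, ('a, unit) cstar_ext) unitization"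

context cstar_algebra
begin

text \<open>Bounds the operator norm of left multiplication on \<open>E\<close>. This measures
  elements with a scalar part, such as \<open>1 - q\<close>.\<close>

definition bnd :: "real \<Rightarrow> 'a cstar_unitization \<Rightarrow> bool" where
  "bnd K F \<longleftrightarrow> (\<forall>b\<in>E. nm (F * b) \<le> K * nm b)"

text \<open>\<open>F'\<close> plays the role of the adjoint of \<open>F\<close>. As
  \<open>star_mult\<close> speaks of factors in \<open>E\<close> only, the relation is expressed by
  its effect on \<open>E\<close>.\<close>

definition adjoint_pair :: "'a cstar_unitization \<Rightarrow> 'a cstar_unitization \<Rightarrow> bool" where
  "adjoint_pair F F' \<longleftrightarrow> (\<forall>b\<in>E. star (F * b) = star b * F')"

lemma bndD: "bnd K F \<Longrightarrow> b \<in> E \<Longrightarrow> nm (F * b) \<le> K * nm b"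
  unfolding bnd_def by blast

lemma adjointI: "(\<And>b. b \<in> E \<Longrightarrow> star (F * b) = star b * F') \<Longrightarrow> adjoint_pair F F'"
  and adjointD: "adjoint_pair F F' \<Longrightarrow> b \<in> E \<Longrightarrow> star (F * b) = star b * F'"
  unfolding adjoint_pair_def by blast+

lemma bnd_1: "bnd 1 1"
  by (simp add: bnd_def)

lemma bnd_E: "x \<in> E \<Longrightarrow> bnd (nm x) x"
  by (simp add: bnd_def nm_mult)

lemma bnd_mono: "bnd K F \<Longrightarrow> K \<le> L \<Longrightarrow> bnd L F"
  unfolding bnd_def by (meson mult_right_mono nm_nonneg order_trans)

lemma bnd_add: "bnd K F \<Longrightarrow> bnd L H \<Longrightarrow> bnd (K + L) (F + H)"
  unfolding bnd_def
proof
  fix b assume *: "\<forall>b\<in>E. nm (F * b) \<le> K * nm b" "\<forall>b\<in>E. nm (H * b) \<le> L * nm b" and b: "b \<in> E"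
  have "nm ((F + H) * b) \<le> nm (F * b) + nm (H * b)"
    using b nm_triangle[of "F * b" "H * b"] by (simp add: semiring_class.distrib_right E_mult_left)
  then show "nm ((F + H) * b) \<le> (K + L) * nm b"
    using bspec[OF *(1) b] bspec[OF *(2) b] by (simp add: algebra_simps)
qed

lemma bnd_mult: "bnd K F \<Longrightarrow> bnd L H \<Longrightarrow> 0 \<le> K \<Longrightarrow> bnd (K * L) (F * H)"
  unfolding bnd_def
proof
  fix b assume *: "\<forall>b\<in>E. nm (F * b) \<le> K * nm b" "\<forall>b\<in>E. nm (H * b) \<le> L * nm b" "0 \<le> K" and b: "b \<in> E"
  have "nm (F * H * b) \<le> K * nm (H * b)"
    using bspec[OF *(1) E_mult_left[OF b]] by (simp add: mult.assoc)
  also have "\<dots> \<le> K * (L * nm b)" using bspec[OF *(2) b] *(3) by (rule mult_left_mono)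
  finally show "nm (F * H * b) \<le> K * L * nm b" by (simp add: mult.assoc)
qed

lemma bnd_scale: "bnd K F \<Longrightarrow> bnd (cmod c * K) (ofc c * F)"
  unfolding bnd_def
proof
  fix b assume *: "\<forall>b\<in>E. nm (F * b) \<le> K * nm b" and b: "b \<in> E"
  have "nm (ofc c * F * b) = cmod c * nm (F * b)"
    using nm_scale[OF E_mult_left[OF b]] by (simp add: mult.assoc)
  then show "nm (ofc c * F * b) \<le> cmod c * K * nm b"
    using bspec[OF * b] mult_left_mono[of _ _ "cmod c"] by (simp add: mult.assoc)
qed

lemma bnd_uminus: "bnd K F \<Longrightarrow> bnd K (- F)"
  using bnd_scale[of K F "- 1"] by simp

lemma bnd_diff: "bnd K F \<Longrightarrow> bnd L H \<Longrightarrow> bnd (K + L) (F - H)"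
  using bnd_add[of K F L "- H"] bnd_uminus[of L H] by simp

lemma bnd_mult_1: "bnd 1 F \<Longrightarrow> bnd 1 H \<Longrightarrow> bnd 1 (F * H)"
  using bnd_mult[of 1 F 1 H] by simp

lemma bnd_power: "bnd 1 F \<Longrightarrow> bnd 1 (F ^ n)"
  by (induction n) (simp_all add: bnd_1 bnd_mult_1)

text \<open>For elements of \<open>E\<close> the bound controls the norm again: test it on
  \<open>star x\<close> and use the C*-identity.\<close>

lemma bnd_nm:
  assumes "x \<in> E" "bnd K x" "0 \<le> K" shows "nm x \<le> K"
proof (cases "nm x = 0")
  case False
  have "nm x * nm x \<le> K * nm x"
    using assms(1) bspec[OF assms(2)[unfolded bnd_def] E_star[OF assms(1)]]
    by (simp add: nm_star_mult nm_star power2_eq_square)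
  then show ?thesis using False nm_nonneg[OF assms(1)] by simp
qed (use assms in simp)

lemma adjoint_1: "adjoint_pair 1 1"
  by (simp add: adjoint_pair_def)

lemma adjoint_E: "x \<in> E \<Longrightarrow> adjoint_pair x (star x)"
  by (simp add: adjoint_pair_def star_mult)

lemma adjoint_add: "adjoint_pair F F' \<Longrightarrow> adjoint_pair H H' \<Longrightarrow> adjoint_pair (F + H) (F' + H')"
  by (simp add: adjoint_pair_def semiring_class.distrib_left semiring_class.distrib_right star_add E_mult_left)

lemma adjoint_scale: "adjoint_pair F F' \<Longrightarrow> adjoint_pair (ofc c * F) (ofc (cnj c) * F')"
proof (rule adjointI)
  fix b assume F: "adjoint_pair F F'" and b: "b \<in> E"
  have "star (ofc c * F * b) = ofc (cnj c) * (star b * F')"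
    using star_scale[OF E_mult_left[OF b]] adjointD[OF F b] by (simp add: mult.assoc)
  then show "star (ofc c * F * b) = star b * (ofc (cnj c) * F')" by (simp only: mult_ofc_left)
qed

lemma adjoint_diff: "adjoint_pair F F' \<Longrightarrow> adjoint_pair H H' \<Longrightarrow> adjoint_pair (F - H) (F' - H')"
  using adjoint_add[of F F' "- H" "- H'"] adjoint_scale[of H H' "- 1"] by simp

lemma adjoint_mult: "adjoint_pair F F' \<Longrightarrow> adjoint_pair H H' \<Longrightarrow> adjoint_pair (F * H) (H' * F')"
proof (rule adjointI)
  fix b assume F: "adjoint_pair F F'" and H: "adjoint_pair H H'" and b: "b \<in> E"
  show "star (F * H * b) = star b * (H' * F')"
    using adjointD[OF F E_mult_left[OF b, of H]] adjointD[OF H b] by (simp only: mult.assoc[symmetric])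
qed

lemma adjoint_power: "adjoint_pair F F \<Longrightarrow> adjoint_pair (F ^ n) (F ^ n)"
  by (induction n) (auto simp: adjoint_1 power_commutes dest: adjoint_mult[of F F])

text \<open>The C*-identity for multiplication operators: the square of \<open>nm (F * b)\<close> is
  the norm of \<open>star b * (F' * F * b)\<close>.\<close>

lemma bnd_sqrt:
  assumes "adjoint_pair F F'" "bnd (K\<^sup>2) (F' * F)" "0 \<le> K" shows "bnd K F"
  unfolding bnd_def
proof
  fix b assume b: "b \<in> E"
  have "(nm (F * b))\<^sup>2 = nm (star (F * b) * (F * b))" using b by (simp add: nm_cstar E_mult_left)
  also have "\<dots> = nm (star b * (F' * F * b))" using adjointD[OF assms(1) b] by (simp add: mult.assoc)
  also have "\<dots> \<le> nm b * nm (F' * F * b)"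
    using nm_mult[OF E_star[OF b] E_mult_left[OF b]] by (simp add: nm_star b)
  also have "\<dots> \<le> nm b * (K\<^sup>2 * nm b)"
    using bndD[OF assms(2) b] b by (intro mult_left_mono nm_nonneg)
  also have "\<dots> = (K * nm b)\<^sup>2" by (simp add: power2_eq_square mult_ac)
  finally show "nm (F * b) \<le> K * nm b"
    by (rule power2_le_imp_le) (rule mult_nonneg_nonneg[OF assms(3) nm_nonneg[OF b]])
qed

lemma bnd_isometry: "adjoint_pair F F' \<Longrightarrow> F' * F = 1 \<Longrightarrow> bnd 1 F"
  using bnd_sqrt[of F F' 1] bnd_1 by simp

lemma bnd_idempotent:
  assumes "adjoint_pair F F" "F * F = F" shows "bnd 1 F"
  unfolding bnd_def
proof
  fix b assume b: "b \<in> E"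
  have "(nm (F * b))\<^sup>2 = nm (star (F * b) * (F * b))" using b by (simp add: nm_cstar E_mult_left)
  also have "\<dots> = nm (star b * (F * b))"
    unfolding adjointD[OF assms(1) b] mult.assoc[symmetric] mult.assoc[of "star b" F F] assms(2) ..
  also have "\<dots> \<le> nm b * nm (F * b)"
    using nm_mult[OF E_star[OF b] E_mult_left[OF b]] by (simp add: nm_star b)
  finally have "nm (F * b) * nm (F * b) \<le> nm b * nm (F * b)" by (simp add: power2_eq_square)
  then show "nm (F * b) \<le> 1 * nm b"
    using nm_nonneg[OF E_mult_left[OF b], of F] nm_nonneg[OF b] by (cases "nm (F * b) = 0") simp_all
qed

text \<open>For self-adjoint \<open>F\<close>, \<open>bnd_sqrt\<close> shows by repeated squaring
  that the bound \<open>K ^ (2 ^ n)\<close> for \<open>F ^ (2 ^ n)\<close> gives the bound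
  \<open>K\<close> for \<open>F\<close>. Linear growth lies below every geometric growth with
  \<open>K > 1\<close>, so each such \<open>K\<close> is a bound, and therefore 1 is.\<close>

lemma bnd_power_limit:
  assumes F: "adjoint_pair F F" and bound: "\<And>n. bnd (a + c * real n) (F ^ n)"
  shows "bnd 1 F"
proof -
  have root: "bnd K F" if "bnd (K ^ (2 ^ n)) (F ^ (2 ^ n))" "0 \<le> K" for K n
    using that
  proof (induction n)
    case (Suc n)
    have "bnd ((K ^ (2 ^ n))\<^sup>2) (F ^ (2 ^ n) * F ^ (2 ^ n))"
      using Suc.prems(1) by (simp add: power_add[symmetric] power_mult[symmetric] mult_2 mult.commute)
    then show ?case using Suc bnd_sqrt[OF adjoint_power[OF F]] by simp
  qed simp
  have K: "bnd K F" if "1 < K" for K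
  proof -
    have "(\<lambda>n. a * inverse (K ^ n) + c * (real n / K ^ n)) \<longlonglongrightarrow> a * 0 + c * 0"
      using that lim_n_over_pown[of K]
      by (intro tendsto_add tendsto_mult tendsto_const LIMSEQ_inverse_realpow_zero) auto
    then have "\<forall>\<^sub>F n in sequentially. a * inverse (K ^ n) + c * (real n / K ^ n) < 1"
      by (rule order_tendstoD(2)) simp
    then obtain N where N: "\<And>n. n \<ge> N \<Longrightarrow> a * inverse (K ^ n) + c * (real n / K ^ n) < 1"
      by (auto simp: eventually_sequentially)
    have "N \<le> 2 ^ N" by (simp add: less_imp_le)
    have pos: "0 < K ^ (2 ^ N)" using that by simp
    have "a + c * real (2 ^ N) = (a * inverse (K ^ (2 ^ N)) + c * (real (2 ^ N) / K ^ (2 ^ N))) * K ^ (2 ^ N)"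
      using that by (simp add: field_simps)
    also have "\<dots> \<le> 1 * K ^ (2 ^ N)"
      using N[OF \<open>N \<le> 2 ^ N\<close>] pos by (intro mult_right_mono) simp_all
    finally have "bnd (K ^ (2 ^ N)) (F ^ (2 ^ N))" using bnd_mono[OF bound[of "2 ^ N"]] by simp
    then show ?thesis using root that by simp
  qed
  show ?thesis unfolding bnd_def
  proof
    fix b assume b: "b \<in> E"
    show "nm (F * b) \<le> 1 * nm b"
    proof (rule ccontr)
      assume *: "\<not> nm (F * b) \<le> 1 * nm b"
      have "nm (F * b) \<le> 2 * nm b" using bndD[OF K[of 2] b] by simp
      then have "0 < nm b" using * nm_nonneg[OF b] by linarith
      have "1 < nm (F * b) / nm b" using * \<open>0 < nm b\<close> by simp
      then obtain L where "1 < L" "L < nm (F * b) / nm b" using dense by blast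
      then have "L * nm b < nm (F * b)" using \<open>0 < nm b\<close> by (simp add: field_simps)
      moreover have "nm (F * b) \<le> L * nm b" using bndD[OF K[OF \<open>1 < L\<close>] b] .
      ultimately show False by simp
    qed
  qed
qed

lemma ofc_i_mult: "ofc \<i> * ofc \<i> = (- 1 :: 'a cstar_unitization)"
  by (simp only: ofc_mult[symmetric]) simp

text \<open>\<open>g + \<i> (1 - w)\<close> is unitary.\<close>

lemma bnd_unitary_parts:
  assumes "g \<in> E" "w \<in> E" "star g = g" "star w = w" "g * w = w * g" "w + w = g * g + w * w"
  shows "bnd 1 g" "bnd 1 (1 - w)"
proof -
  define J where "J = (ofc \<i> :: 'a cstar_unitization)"
  have J: "J * J = - 1" "\<And>x. x * J = J * x"
    unfolding J_def by (rule ofc_i_mult, rule ofc_central[symmetric])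
  define u u' where "u = g + J * (1 - w)" and "u' = g - J * (1 - w)"
  have "adjoint_pair (1 - w) (1 - w)" "adjoint_pair g g"
    using adjoint_diff[OF adjoint_1 adjoint_E[OF assms(2)]] adjoint_E[OF assms(1)] assms by simp_all
  note adj = this adjoint_scale[OF this(1), of \<i>] adjoint_scale[OF this(1), of "- \<i>"]
  have minus_J: "ofc (- \<i>) = - J" using vs.scale_minus_left[of \<i> 1] by (simp add: J_def)
  have adj_u: "adjoint_pair u u'" "adjoint_pair u' u"
    using adjoint_add[OF adj(2,3)] adjoint_add[OF adj(2,4)]
    by (simp_all add: u_def u'_def minus_J J_def[symmetric])
  have "J * (1 - w) * (J * (1 - w)) = J * J * ((1 - w) * (1 - w))"
  proof -
    have "J * (1 - w) * (J * (1 - w)) = J * ((1 - w) * J) * (1 - w)" by (simp only: mult.assoc)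
    then show ?thesis unfolding J(2)[of "1 - w"] by (simp only: mult.assoc)
  qed
  then have JJ: "J * (1 - w) * (J * (1 - w)) = - ((1 - w) * (1 - w))" by (simp add: J(1))
  have gJ: "g * (J * (1 - w)) = J * (1 - w) * g"
  proof -
    have "g * (J * (1 - w)) = g * J * (1 - w)" by (simp only: mult.assoc)
    also have "\<dots> = J * (g * (1 - w))" unfolding J(2)[of g] by (simp only: mult.assoc)
    also have "g * (1 - w) = (1 - w) * g" using assms(5) by (simp add: right_diff_distrib left_diff_distrib)
    finally show ?thesis by (simp only: mult.assoc)
  qed
  \<comment> \<open>The hypothesis on \<open>w\<close> says just this, and it is the unitarity of
    \<open>u\<close> because \<open>g\<close> commutes with \<open>w\<close>.\<close>
  have sq: "g * g + (1 - w) * (1 - w) = 1"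
  proof -
    have "(1 - w) * (1 - w) = 1 - (w + w) + w * w" by (simp add: right_diff_distrib left_diff_distrib)
    then show ?thesis unfolding assms(6) by simp
  qed
  have "u' * u = 1" "u * u' = 1"
  proof -
    have expand: "(g - K) * (g + K) = g * g + (g * K - K * g) - K * K"
      "(g + K) * (g - K) = g * g - (g * K - K * g) - K * K" for K
      by (simp_all add: algebra_simps)
    show "u' * u = 1" "u * u' = 1" unfolding u_def u'_def expand JJ gJ using sq by simp_all
  qed
  then have b: "bnd 1 u" "bnd 1 u'" using adj_u bnd_isometry by blast+
  have "g = ofc (1 / 2) * (u + u')"
  proof -
    have "u + u' = ofc 2 * g" using ofc_double[of g] by (simp add: u_def u'_def)
    then show ?thesis by simp
  qed
  then show "bnd 1 g" using bnd_scale[OF bnd_add[OF b], of "1 / 2"] by simp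
  have "1 - w = ofc (- \<i> / 2) * (u - u')"
  proof -
    have "u - u' = ofc 2 * (ofc \<i> * (1 - w))" using ofc_double[of "ofc \<i> * (1 - w)"] by (simp only: u_def u'_def J_def) simp
    then show ?thesis by simp
  qed
  then show "bnd 1 (1 - w)" using bnd_scale[OF bnd_diff[OF b], of "- \<i> / 2"] by (simp add: norm_divide)
qed

text \<open>By \<open>sqrt_exists\<close> this element is the square of \<open>1 - v\<close>, and
  \<open>1 - v\<close> is the imaginary part of a unitary.\<close>

lemma bnd_one_minus_square:
  assumes "h \<in> E" "star h = h" "nm h < 1"
  shows "bnd 1 (1 - h * h)"
proof -
  obtain v where v: "v \<in> E" "star v = v" "h * v = v * h" "v + v = h * h + v * v"
    using sqrt_exists[OF assms] by blast
  have "bnd 1 ((1 - v) * (1 - v))"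
    using bnd_unitary_parts(2)[OF assms(1) v(1) assms(2) v(2-4)] by (intro bnd_mult_1)
  moreover have "(1 - v) * (1 - v) = 1 - h * h" using v(4) by (simp add: right_diff_distrib left_diff_distrib algebra_simps)
  ultimately show ?thesis by simp
qed

end

text \<open>For self-adjoint \<open>h\<close> of norm below 1, \<open>sqrt_exists\<close> provides
  an element whose algebraic relations with \<open>h\<close> survive \<open>\<phi>\<close> and
  exhibit \<open>\<phi> h\<close> as the real part of a unitary; so \<open>\<phi> h\<close> has norm
  at most 1. Scaling settles all self-adjoint elements and the C*-identity the rest. Continuity of
  \<open>\<phi>\<close> is a consequence and not an assumption.\<close>

lemma star_hom_nrm_le:
  assumes A: "cstar_algebra A" and B: "cstar_algebra B" and hom: "star_hom A B \<phi>" and x: "x \<in> carrier A"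
  shows "nrm B (\<phi> x) \<le> nrm A x"
proof -
  interpret A: cstar_algebra A by fact
  interpret B: cstar_algebra B by fact
  note hom' = hom[unfolded star_hom_def]
  have closed: "\<phi> y \<in> carrier B" if "y \<in> carrier A" for y using hom' that by blast
  have add: "\<phi> (y \<oplus>\<^bsub>A\<^esub> z) = \<phi> y \<oplus>\<^bsub>B\<^esub> \<phi> z" and mult: "\<phi> (y \<otimes>\<^bsub>A\<^esub> z) = \<phi> y \<otimes>\<^bsub>B\<^esub> \<phi> z"
    if "y \<in> carrier A" "z \<in> carrier A" for y z using hom' that by blast+
  have scale: "\<phi> (c \<odot>\<^bsub>A\<^esub> y) = c \<odot>\<^bsub>B\<^esub> \<phi> y" and adj: "\<phi> (adj A y) = adj B (\<phi> y)"
    if "y \<in> carrier A" for y c using hom' that by blast+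
  have less_1: "nrm B (\<phi> h) \<le> 1" if h: "h \<in> carrier A" "adj A h = h" "nrm A h < 1" for h
  proof -
    obtain a where a: "a \<in> carrier A" "A.star (emb A a) = emb A a" "emb A h * emb A a = emb A a * emb A h"
      "emb A a + emb A a = emb A h * emb A h + emb A a * emb A a"
      using A.sqrt_exists[of "emb A h"] h by auto
    have "adj A a = a" using a(1,2) by (simp add: A.emb_eq_iff A.adj_closed)
    moreover have "h \<otimes>\<^bsub>A\<^esub> a = a \<otimes>\<^bsub>A\<^esub> h"
      using a(1,3) h by (simp add: A.emb_mult[symmetric] A.emb_eq_iff A.m_closed)
    moreover have "a \<oplus>\<^bsub>A\<^esub> a = h \<otimes>\<^bsub>A\<^esub> h \<oplus>\<^bsub>A\<^esub> a \<otimes>\<^bsub>A\<^esub> a"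
      using a(1,4) h by (simp add: A.emb_mult[symmetric] A.emb_add[symmetric] A.emb_eq_iff A.m_closed)
    ultimately have *: "adj B (\<phi> a) = \<phi> a" "\<phi> h \<otimes>\<^bsub>B\<^esub> \<phi> a = \<phi> a \<otimes>\<^bsub>B\<^esub> \<phi> h"
      "\<phi> a \<oplus>\<^bsub>B\<^esub> \<phi> a = \<phi> h \<otimes>\<^bsub>B\<^esub> \<phi> h \<oplus>\<^bsub>B\<^esub> \<phi> a \<otimes>\<^bsub>B\<^esub> \<phi> a"
      using adj[OF a(1)] mult[OF a(1) h(1)] mult[OF h(1) a(1)] add[OF a(1) a(1)] mult[OF a(1) a(1)] mult[OF h(1) h(1)]
        add[OF A.m_closed[OF h(1) h(1)] A.m_closed[OF a(1) a(1)]] by simp_all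
    have "B.bnd 1 (emb B (\<phi> h))"
      using * closed[OF a(1)] closed[OF h(1)] adj[OF h(1)] h(2)
      by (intro B.bnd_unitary_parts(1)[of _ "emb B (\<phi> a)"])
        (simp_all add: B.emb_mult[symmetric] B.emb_add[symmetric] B.m_closed)
    then show ?thesis using B.bnd_nm[of "emb B (\<phi> h)" 1] closed[OF h(1)] by simp
  qed
  have sa: "nrm B (\<phi> h) \<le> nrm A h" if h: "h \<in> carrier A" "adj A h = h" for h
  proof (rule dense_ge)
    fix t assume t: "nrm A h < t"
    then have "0 < t" using A.nrm_nonneg[OF h(1)] by linarith
    have "nrm A (complex_of_real (1 / t) \<odot>\<^bsub>A\<^esub> h) < 1"
      using t \<open>0 < t\<close> h by (simp add: A.nrm_smult norm_divide)
    then have "nrm B (\<phi> (complex_of_real (1 / t) \<odot>\<^bsub>A\<^esub> h)) \<le> 1"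
      using h by (intro less_1) (simp_all add: A.adj_smult)
    then show "nrm B (\<phi> h) \<le> t"
      using h \<open>0 < t\<close> closed[OF h(1)] by (simp add: scale B.nrm_smult norm_divide divide_le_eq)
  qed
  have "(nrm B (\<phi> x))\<^sup>2 = nrm B (\<phi> (adj A x \<otimes>\<^bsub>A\<^esub> x))"
    using x closed[OF x] by (simp add: mult adj A.adj_closed B.cstar_identity)
  also have "\<dots> \<le> nrm A (adj A x \<otimes>\<^bsub>A\<^esub> x)"
    using x by (intro sa) (simp_all add: A.adj_mult A.adj_closed A.adj_adj A.m_closed)
  also have "\<dots> = (nrm A x)\<^sup>2" using x by (rule A.cstar_identity)
  finally show ?thesis using A.nrm_nonneg[OF x] by (rule power2_le_imp_le)
qed

lemma ofc_diff: "ofc (c - d) = ofc c - ofc d"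
  using vs.scale_left_diff_distrib[of c d 1] by simp

section \<open>The order relation between projections\<close>

context cstar_algebra
begin

lemma star_idempotent: "x \<in> E \<Longrightarrow> star x = x \<Longrightarrow> adjoint_pair x x"
  using adjoint_E[of x] by simp

text \<open>With \<open>J\<close> for the imaginary unit, \<open>1 + J * x\<close> and
  \<open>1 - J * x\<close> are contractions too: their product \<open>1 + x * x\<close> is the mean
  of the squares of \<open>1 + x\<close> and \<open>1 - x\<close>. The discrete Fourier sum over the
  fourth powers of the four contractions isolates the linear term, \<open>16 x\<close>; hence
  \<open>16 * nm x \<le> 4\<close>.\<close>

lemma bnd_extreme_quarter:
  assumes x: "x \<in> E" "star x = x" "bnd 1 (1 + x)" "bnd 1 (1 - x)"
  shows "nm x \<le> 1 / 4"
proof -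
  define J where "J = (ofc \<i> :: 'a cstar_unitization)"
  have J: "J * J = - 1" "x * J = J * x"
    unfolding J_def by (rule ofc_i_mult, rule ofc_central[symmetric])
  have minus_J: "ofc (- \<i>) = - J" using vs.scale_minus_left[of \<i> 1] by (simp add: J_def)
  have JxJx: "J * x * (J * x) = - (x * x)"
  proof -
    have "J * x * (J * x) = J * (x * J) * x" by (simp only: mult.assoc)
    also have "\<dots> = (J * J) * (x * x)" by (simp only: J(2) mult.assoc)
    finally show ?thesis by (simp add: J(1))
  qed
  have adj: "adjoint_pair x x" using x star_idempotent by blast
  have pair: "adjoint_pair (1 + J * x) (1 - J * x)" "adjoint_pair (1 - J * x) (1 + J * x)"
    using adjoint_add[OF adjoint_1 adjoint_scale[OF adj, of \<i>]] adjoint_add[OF adjoint_1 adjoint_scale[OF adj, of "- \<i>"]]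
    by (simp_all add: J_def[symmetric] minus_J)
  have "(1 - J * x) * (1 + J * x) = ofc (1 / 2) * ((1 + x) * (1 + x) + (1 - x) * (1 - x))"
    "(1 + J * x) * (1 - J * x) = ofc (1 / 2) * ((1 + x) * (1 + x) + (1 - x) * (1 - x))"
  proof -
    have "(1 + x) * (1 + x) + (1 - x) * (1 - x) = (1 + x * x) + (1 + x * x)" by (simp add: algebra_simps)
    then have "ofc (1 / 2) * ((1 + x) * (1 + x) + (1 - x) * (1 - x)) = 1 + x * x" by (simp add: ofc_double)
    moreover have "(1 - K) * (1 + K) = 1 - K * K" "(1 + K) * (1 - K) = 1 - K * K" for K :: "'a cstar_unitization"
      by (simp_all add: algebra_simps)
    ultimately show "(1 - J * x) * (1 + J * x) = ofc (1 / 2) * ((1 + x) * (1 + x) + (1 - x) * (1 - x))"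
      "(1 + J * x) * (1 - J * x) = ofc (1 / 2) * ((1 + x) * (1 + x) + (1 - x) * (1 - x))"
      by (simp_all only: JxJx) simp_all
  qed
  moreover have "bnd 1 (ofc (1 / 2) * ((1 + x) * (1 + x) + (1 - x) * (1 - x)))"
    using bnd_scale[OF bnd_add[OF bnd_mult_1[OF x(3,3)] bnd_mult_1[OF x(4,4)]], of "1 / 2"] by simp
  ultimately have bJ: "bnd 1 (1 + J * x)" "bnd 1 (1 - J * x)"
    using bnd_sqrt[OF pair(1), of 1] bnd_sqrt[OF pair(2), of 1] by simp_all
  have quartic: "(1 + y) ^ 4 - (1 - y) ^ 4 = (y + y + y + y + y + y + y + y) + (y * y * y + y * y * y + y * y * y + y * y * y + y * y * y + y * y * y + y * y * y + y * y * y)"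
    for y :: "'a cstar_unitization"
    by (simp add: eval_nat_numeral algebra_simps)
  have eight: "z + z + z + z + z + z + z + z = ofc 8 * z" for z :: "'a cstar_unitization"
  proof -
    have "ofc 8 * z = ofc 2 * (ofc 2 * (ofc 2 * z))" by simp
    then show ?thesis by (simp only: ofc_double[symmetric] add.assoc)
  qed
  have "J * ((1 + J * x) ^ 4 - (1 - J * x) ^ 4) = ofc 8 * (J * (J * x) + J * (J * x * (J * x) * (J * x)))"
    unfolding quartic eight by (simp only: semiring_class.distrib_left mult_ofc_left)
  also have "J * (J * x) = - x" by (simp only: mult.assoc[symmetric] J(1)) simp
  also have "J * (J * x * (J * x) * (J * x)) = x * x * x"
  proof -
    have "J * (J * x * (J * x) * (J * x)) = - (J * (x * x * (J * x)))" unfolding JxJx by simp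
    also have "x * x * (J * x) = J * (x * x * x)"
      by (metis J(2) mult.assoc)
    also have "- (J * (J * (x * x * x))) = x * x * x" by (simp only: mult.assoc[symmetric] J(1)) (simp add: mult.assoc)
    finally show ?thesis .
  qed
  finally have "((1 + x) ^ 4 - (1 - x) ^ 4) - J * ((1 + J * x) ^ 4 - (1 - J * x) ^ 4) = ofc 16 * x"
    unfolding quartic eight using ofc_double[of "ofc 8 * x"] by (simp add: right_diff_distrib semiring_class.distrib_left)
  moreover have "bnd (1 + 1 + (1 + 1)) (((1 + x) ^ 4 - (1 - x) ^ 4) - J * ((1 + J * x) ^ 4 - (1 - J * x) ^ 4))"
    using bnd_diff[OF bnd_diff[OF bnd_power[OF x(3)] bnd_power[OF x(4)]]
        bnd_scale[OF bnd_diff[OF bnd_power[OF bJ(1)] bnd_power[OF bJ(2)]], of \<i>], of 4 4 4 4]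
    by (simp add: J_def)
  ultimately have "bnd 4 (ofc 16 * x)" by simp
  then have "nm (ofc 16 * x) \<le> 4" using x(1) by (intro bnd_nm) (simp_all add: E_scale)
  then show ?thesis using x(1) by (simp add: nm_scale)
qed

text \<open>\<open>1\<close> is an extreme point of the unit ball. The map \<open>x \<mapsto> (3 x - x\<^sup>3) / 2\<close> preserves the
  hypotheses and expands norms below \<open>1 / 4\<close> by the factor \<open>7 / 5\<close>.\<close>

lemma bnd_extreme:
  assumes "x \<in> E" "star x = x" "bnd 1 (1 + x)" "bnd 1 (1 - x)"
  shows "x = 0"
proof -
  have bound: "nm x \<le> 1 / 4 * (5 / 7) ^ n"
    if "x \<in> E" "star x = x" "bnd 1 (1 + x)" "bnd 1 (1 - x)" for n x
    using that
  proof (induction n arbitrary: x)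
    case 0
    then show ?case using bnd_extreme_quarter by simp
  next
    case (Suc n)
    note x = Suc.prems
    define f where "f = ofc (1 / 2) * (x + x + x - x * x * x)"
    \<comment> \<open>\<open>1 + f\<close> is the mean of \<open>(1 + x) ^ 3\<close> and three
      copies of \<open>(1 + x) ^ 2 * (1 - x)\<close>, all of them contractions. As \<open>f\<close>
      is odd in \<open>x\<close>, the same identity at \<open>- x\<close> handles
      \<open>1 - f\<close>.\<close>
    have cube: "(1 + y) * (1 + y) * (1 + y) + ((1 + y) * (1 + y) * (1 - y) + (1 + y) * (1 + y) * (1 - y) + (1 + y) * (1 + y) * (1 - y))
      = ((1 + 1) + (1 + 1)) + ((y + y + y - y * y * y) + (y + y + y - y * y * y))" for y :: "'a cstar_unitization"
      by (simp add: algebra_simps)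
    have quarter: "ofc (1 / 4) * (((1 + 1) + (1 + 1)) + (y + y)) = 1 + ofc (1 / 2) * y" for y :: "'a cstar_unitization"
      by (simp only: ofc_double semiring_class.distrib_left) (simp add: ofc_mult[symmetric])
    have bnd_f: "bnd 1 (1 + ofc (1 / 2) * (y + y + y - y * y * y))" if "bnd 1 (1 + y)" "bnd 1 (1 - y)" for y
    proof -
      note b = bnd_mult_1[OF bnd_mult_1[OF that(1,1)] that(1)] bnd_mult_1[OF bnd_mult_1[OF that(1,1)] that(2)]
      show ?thesis
        using bnd_scale[OF bnd_add[OF b(1) bnd_add[OF bnd_add[OF b(2) b(2)] b(2)]], of "1 / 4"]
        unfolding cube quarter by simp
    qed
    have xx: "x * x \<in> E" "x * x * x \<in> E" using x(1) by (simp_all add: E_mult_left)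
    have fE: "f \<in> E" unfolding f_def using x(1) by (simp add: E_closed)
    moreover have "star f = f"
      unfolding f_def using x(1,2) xx by (simp add: star_scale star_add star_diff star_mult E_closed mult.assoc)
    moreover have "bnd 1 (1 + f)" unfolding f_def using x(3,4) by (rule bnd_f)
    moreover have "bnd 1 (1 - f)"
    proof -
      have "1 + ofc (1 / 2) * (- x + - x + - x - - x * - x * - x) = 1 - f"
        by (simp add: f_def right_diff_distrib semiring_class.distrib_left)
      then show ?thesis using bnd_f[of "- x"] x(3,4) by simp
    qed
    ultimately have f_le: "nm f \<le> 1 / 4 * (5 / 7) ^ n" by (rule Suc.IH)
    have "x + x + x - x * x * x = ofc 2 * f" by (simp add: f_def)
    then have "ofc 3 * x = ofc 2 * f + x * x * x"
      using ofc_double[of x] vs.scale_left_distrib[of 2 1 x] by (simp add: algebra_simps)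
    then have "3 * nm x = nm (ofc 2 * f + x * x * x)" using nm_scale[OF x(1), of 3] by simp
    also have "\<dots> \<le> nm (ofc 2 * f) + nm (x * x * x)" using xx fE by (intro nm_triangle) (simp_all add: E_scale)
    also have "nm (ofc 2 * f) = 2 * nm f" using nm_scale[OF fE, of 2] by simp
    \<comment> \<open>The quarter bound would even give 1/16; with 1/5 the expansion factor becomes
      \<open>(3 - 1/5) / 2 = 7/5\<close>.\<close>
    also have "nm (x * x * x) \<le> (1 / 5) * nm x"
    proof -
      have q: "nm x \<le> 1 / 4" "0 \<le> nm x" using bnd_extreme_quarter[OF x] nm_nonneg[OF x(1)] by simp_all
      have "nm (x * x * x) \<le> nm (x * x) * nm x" using xx x by (intro nm_mult)
      also have "\<dots> \<le> (1 / 5) * nm x"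
      proof (rule mult_right_mono[OF _ q(2)])
        have "nm (x * x) \<le> nm x * nm x" using x by (intro nm_mult)
        also have "\<dots> \<le> 1 / 4 * (1 / 4)" using q by (intro mult_mono) auto
        finally show "nm (x * x) \<le> 1 / 5" by simp
      qed
      finally show ?thesis .
    qed
    finally show ?case using f_le by simp
  qed
  have "(\<lambda>n. 1 / 4 * (5 / 7 :: real) ^ n) \<longlonglongrightarrow> 1 / 4 * 0"
    by (intro tendsto_mult tendsto_const LIMSEQ_power_zero) simp
  then have "nm x \<le> 1 / 4 * 0"
    by (rule LIMSEQ_le_const) (use bound[OF assms] in blast)
  then have "nm x = 0" using nm_nonneg[OF assms(1)] by simp
  then show ?thesis using nm_eq_0[OF assms(1)] by simp
qed

text \<open>With \<open>c = z q\<close> one has \<open>c\<^sup>* c = q p q - q \<le> 0\<close>. Expanding \<open>(1 + c c\<^sup>*)\<^sup>n\<close> shows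
  \<open>c c\<^sup>* \<le> 0\<close> as well, while \<open>c c\<^sup>*\<close> is a sum of squares minus \<open>c\<^sup>* c\<close>.\<close>

lemma projection_le_E:
  assumes p: "p \<in> E" "star p = p" "p * p = p" and q: "q \<in> E" "star q = q" "q * q = q"
    and z: "z \<in> E" "p - q = star z * z"
  shows "p * q = q"
proof -
  define F where "F = 1 - q + q * p * q"
  define c where "c = z * q"
  define X where "X = c * star c"
  have cE: "c \<in> E" using q by (simp add: c_def E_mult_left)
  have scE: "star c \<in> E" using cE by (rule E_star)
  have "star c * c = q * (star z * z) * q"
    using z(1) q by (simp add: c_def star_mult mult.assoc)
  then have cc: "star c * c = F - 1"
    unfolding z(2)[symmetric] F_def using q(3) by (simp add: right_diff_distrib left_diff_distrib mult.assoc)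
  have qq: "q * (q * y) = q * y" "p * (p * y) = p * y" for y by (simp_all add: mult.assoc[symmetric] q p)
  \<comment> \<open>The parts \<open>1 - q\<close> and \<open>q * p * q\<close> annihilate each
    other and both are contractions. So all powers of \<open>F\<close> are bounded by 2, and
    \<open>bnd_power_limit\<close> lowers the bound of \<open>F\<close> to 1.\<close>
  have "F ^ Suc n = (1 - q) + (q * p * q) ^ Suc n" for n
  proof (induction n)
    case (Suc n)
    have "F ^ Suc (Suc n) = F * ((1 - q) + (q * p * q) ^ Suc n)" using Suc by simp
    also have "\<dots> = (1 - q) + (q * p * q) ^ Suc (Suc n)"
      unfolding F_def
      by (simp add: algebra_simps qq q(3))
    finally show ?case .
  qed (simp add: F_def)
  moreover have bq: "bnd 1 q" "bnd 1 p" "bnd 1 (1 - q)"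
    using bnd_idempotent[OF star_idempotent[OF q(1,2)] q(3)] bnd_idempotent[OF star_idempotent[OF p(1,2)] p(3)]
      bnd_idempotent[OF adjoint_diff[OF adjoint_1 star_idempotent[OF q(1,2)]]] q(3)
    by (simp_all add: algebra_simps)
  ultimately have F_Suc: "bnd 2 (F ^ Suc n)" for n
    using bnd_add[OF bq(3) bnd_power[OF bnd_mult_1[OF bnd_mult_1[OF bq(1,2)] bq(1)]], of "Suc n"] by simp
  have bF: "bnd 2 (F ^ n)" for n
    using F_Suc bnd_mono[OF bnd_1, of 2] by (cases n) auto
  have adjF: "adjoint_pair F F"
    unfolding F_def
    using adjoint_add[OF adjoint_diff[OF adjoint_1 star_idempotent[OF q(1,2)]]
        adjoint_mult[OF adjoint_mult[OF star_idempotent[OF q(1,2)] star_idempotent[OF p(1,2)]] star_idempotent[OF q(1,2)]]]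
    by (simp add: mult.assoc)
  have bnd_F: "bnd 1 F"
    by (rule bnd_power_limit[OF adjF, of 2 0]) (simp add: bF)
  have XE: "X \<in> E" "star X = X"
    using cE scE by (simp_all add: X_def E_mult_left star_mult star_star)
  \<comment> \<open>As \<open>1 + star c * c = F\<close>, the powers of \<open>1 + X\<close> reduce
    to powers of \<open>F\<close> between \<open>c\<close> and \<open>star c\<close>; they grow at
    most linearly.\<close>
  have expand: "(1 + X) ^ n = 1 + c * (\<Sum>j<n. F ^ j) * star c" for n
  proof (induction n)
    case (Suc n)
    let ?S = "\<Sum>j<n. F ^ j"
    have "(\<Sum>j<Suc n. F ^ j) = 1 + F * ?S" by (simp only: sum.lessThan_Suc_shift power_0 power_Suc sum_distrib_left)
    also have "\<dots> = 1 + ?S + (star c * c) * ?S" unfolding cc by (simp add: left_diff_distrib)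
    finally have S: "(\<Sum>j<Suc n. F ^ j) = 1 + ?S + star c * c * ?S" .
    have "(1 + X) ^ Suc n = (1 + X) * (1 + c * ?S * star c)" using Suc by simp
    also have "\<dots> = 1 + c * (1 + ?S + star c * c * ?S) * star c"
      by (simp add: X_def semiring_class.distrib_left semiring_class.distrib_right mult.assoc)
    finally show ?case unfolding S .
  qed simp
  define K where "K = nm c * nm (star c)"
  have K: "0 \<le> K" using nm_nonneg cE scE by (simp add: K_def)
  have bS: "bnd (2 * real n) (\<Sum>j<n. F ^ j)" for n
  proof (induction n)
    case 0
    show ?case by (simp add: bnd_def)
  next
    case (Suc n)
    then show ?case using bnd_add[OF Suc bF[of n]] by (simp add: algebra_simps)
  qed
  have "bnd (1 + (2 * K) * real n) ((1 + X) ^ n)" for n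
    using bnd_add[OF bnd_1 bnd_mult[OF bnd_mult[OF bnd_E[OF cE] bS[of n]] bnd_E[OF scE]]] nm_nonneg[OF cE]
    unfolding expand by (simp add: K_def mult_ac)
  then have bX: "bnd 1 (1 + X)"
    using bnd_power_limit[OF adjoint_add[OF adjoint_1 star_idempotent[OF XE]]] by blast
  \<comment> \<open>Real and imaginary part of \<open>c\<close>. The sum of their squares is half of
    \<open>X + star c * c\<close>, where \<open>star c * c = F - 1\<close> is already under
    control.\<close>
  define a b where "a = ofc (1 / 2) * (c + star c)" and "b = ofc (- \<i> / 2) * (c - star c)"
  have ab: "a \<in> E" "star a = a" "b \<in> E" "star b = b"
  proof -
    show "a \<in> E" "b \<in> E" using cE scE by (simp_all add: a_def b_def E_closed)
    show "star a = a" using cE scE by (simp add: a_def star_scale star_add star_star E_closed add.commute)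
    have "star b = ofc (\<i> / 2) * (star c - c)"
      using cE scE star_scale[of "c - star c" "- \<i> / 2"] by (simp add: b_def star_diff star_star E_closed del: minus_divide_left vs.scale_minus_left)
    also have "\<dots> = b" using vs.scale_minus_left[of "\<i> / 2" "c - star c"] by (simp add: b_def right_diff_distrib)
    finally show "star b = b" .
  qed
  have squares: "a * a + a * a + (b * b + b * b) = X + star c * c"
  proof -
    have "a * a = ofc (1 / 4) * ((c + star c) * (c + star c))" by (simp only: a_def ofc_mult_ofc) simp
    moreover have "b * b = ofc (- (1 / 4)) * ((c - star c) * (c - star c))" by (simp only: b_def ofc_mult_ofc) simp
    then have "b * b = - (ofc (1 / 4) * ((c - star c) * (c - star c)))" by simp
    ultimately have "a * a + b * b = ofc (1 / 4) * ((c + star c) * (c + star c) - (c - star c) * (c - star c))"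
      by (simp add: right_diff_distrib)
    also have "(c + star c) * (c + star c) - (c - star c) * (c - star c) = (X + star c * c) + (X + star c * c)"
      by (simp add: X_def algebra_simps)
    finally have "a * a + b * b = ofc (1 / 2) * (X + star c * c)" by (simp add: ofc_double)
    then have "(a * a + b * b) + (a * a + b * b) = X + star c * c" by (simp add: ofc_double)
    then show ?thesis by (simp only: add_ac)
  qed
  \<comment> \<open>The scale brings \<open>s * nm a\<close> and \<open>s * nm b\<close> below 1, as
    \<open>bnd_one_minus_square\<close> requires, and \<open>s \<le> 1\<close> keeps the weights of
    the convex combinations below in the unit interval.\<close>
  define s where "s = 1 / (2 + 2 * nm a + 2 * nm b)"
  have "0 < 2 + 2 * nm a + 2 * nm b" using nm_nonneg[OF ab(1)] nm_nonneg[OF ab(3)] by simp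
  then have s: "0 < s" "s \<le> 1" "s * nm a < 1" "s * nm b < 1"
    using nm_nonneg[OF ab(1)] nm_nonneg[OF ab(3)] by (simp_all add: s_def field_simps)
  define c6 where "c6 = complex_of_real (s\<^sup>2 / 6)"
  have scaled: "bnd 1 (1 - ofc (complex_of_real (s\<^sup>2)) * (h * h))" if "h \<in> E" "star h = h" "s * nm h < 1" for h
  proof -
    have "bnd 1 (1 - ofc (complex_of_real s) * h * (ofc (complex_of_real s) * h))"
      using that s by (intro bnd_one_minus_square) (simp_all add: E_scale star_scale nm_scale)
    then show ?thesis by (simp only: ofc_mult_ofc power2_eq_square of_real_mult)
  qed
  \<comment> \<open>The mean of three contractions: \<open>1 - s^2 a^2\<close>,
    \<open>1 - s^2 b^2\<close> and \<open>1 + (s^2 / 2) (star c * c)\<close>, the last being a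
    convex combination of \<open>1\<close> and \<open>F\<close>. The terms in
    \<open>star c * c\<close> cancel and \<open>X\<close> is left with the coefficient
    \<open>s^2 / 6\<close>; hence \<open>c6\<close>.\<close>
  have "bnd 1 (1 - ofc c6 * X)"
  proof -
    define k where "k = complex_of_real (s\<^sup>2 / 2)"
    have k: "cmod (1 - k) = 1 - s\<^sup>2 / 2" "cmod k = s\<^sup>2 / 2"
    proof -
      have "s\<^sup>2 / 2 \<le> 1" using s by (simp add: power_le_one order.trans[OF _ one_le_numeral])
      moreover have "1 - k = complex_of_real (1 - s\<^sup>2 / 2)" by (simp add: k_def)
      ultimately show "cmod (1 - k) = 1 - s\<^sup>2 / 2" by (simp only: norm_of_real)
      show "cmod k = s\<^sup>2 / 2" unfolding k_def by (simp only: norm_of_real) simp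
    qed
    have "bnd (cmod (1 - k) * 1 + cmod k * 1) (ofc (1 - k) * 1 + ofc k * F)"
      by (intro bnd_add bnd_scale bnd_1 bnd_F)
    then have b3: "bnd 1 (1 + ofc k * (star c * c))"
      unfolding cc k by (simp add: ofc_diff right_diff_distrib algebra_simps)
    have "1 - ofc c6 * X = ofc (1 / 3) * ((1 - ofc (complex_of_real (s\<^sup>2)) * (a * a))
      + (1 - ofc (complex_of_real (s\<^sup>2)) * (b * b)) + (1 + ofc k * (star c * c)))"
    proof -
      have "X = a * a + a * a + (b * b + b * b) - star c * c" using squares by simp
      then have "ofc c6 * X = ofc (c6 * 2) * (a * a) + ofc (c6 * 2) * (b * b) - ofc c6 * (star c * c)"
        by (simp add: ofc_double right_diff_distrib semiring_class.distrib_left)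
      moreover have "c6 * 2 = 1 / 3 * complex_of_real (s\<^sup>2)" "c6 = 1 / 3 * k" by (simp_all add: c6_def k_def)
      ultimately have X: "ofc c6 * X = ofc (1 / 3 * complex_of_real (s\<^sup>2)) * (a * a)
        + ofc (1 / 3 * complex_of_real (s\<^sup>2)) * (b * b) - ofc (1 / 3 * k) * (star c * c)" by (simp only:)
      have "ofc (1 / 3) + ofc (1 / 3) + ofc (1 / 3) = (1 :: 'a cstar_unitization)"
        by (simp only: ofc_add[symmetric]) simp
      then show ?thesis unfolding X
        by (simp add: right_diff_distrib semiring_class.distrib_left)
    qed
    moreover have "bnd 1 (ofc (1 / 3) * ((1 - ofc (complex_of_real (s\<^sup>2)) * (a * a))
      + (1 - ofc (complex_of_real (s\<^sup>2)) * (b * b)) + (1 + ofc k * (star c * c))))"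
      using bnd_scale[OF bnd_add[OF bnd_add[OF scaled[OF ab(1,2) s(3)] scaled[OF ab(3,4) s(4)]] b3], of "1 / 3"] by (simp add: norm_divide)
    ultimately show ?thesis by simp
  qed
  moreover have "bnd 1 (1 + ofc c6 * X)"
  proof -
    have "s\<^sup>2 / 6 \<le> 1" using s by (simp add: power_le_one order.trans[OF _ one_le_numeral])
    moreover have "1 - c6 = complex_of_real (1 - s\<^sup>2 / 6)" by (simp add: c6_def)
    ultimately have "cmod (1 - c6) = 1 - s\<^sup>2 / 6" by (simp only: norm_of_real)
    moreover have "cmod c6 = s\<^sup>2 / 6" unfolding c6_def by (simp only: norm_of_real) simp
    ultimately have sum: "cmod (1 - c6) * 1 + cmod c6 * 1 = 1" by linarith
    have "ofc (1 - c6) * 1 + ofc c6 * (1 + X) = 1 + ofc c6 * X"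
      by (simp add: ofc_diff semiring_class.distrib_left)
    then show ?thesis
      using bnd_add[OF bnd_scale[OF bnd_1, of "1 - c6"] bnd_scale[OF bX, of c6]] unfolding sum by (simp only:)
  qed
  ultimately have "ofc c6 * X = 0"
    using XE by (intro bnd_extreme) (simp_all add: E_scale star_scale c6_def)
  moreover have "c6 \<noteq> 0" using s by (simp add: c6_def)
  ultimately have "X = 0" by simp
  then have "c = 0" using nm_star_mult[OF cE] nm_eq_0[OF cE] by (simp add: X_def)
  then have "F = 1" using cc by (simp add: star_0)
  then have "q * p * q = q" by (simp add: F_def)
  \<comment> \<open>The product is \<open>q - q * p * q\<close>, and its left factor is the adjoint
    of the right one, so the C*-identity gives \<open>q = p * q\<close>.\<close>
  then have "(q - q * p) * (q - p * q) = 0"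
    by (simp add: right_diff_distrib left_diff_distrib q(3) mult.assoc qq)
  moreover have "star (q - p * q) = q - q * p" "q - p * q \<in> E"
    using p q by (simp_all add: star_diff star_mult E_closed)
  ultimately have "q - p * q = 0" using nm_cstar[of "q - p * q"] nm_eq_0[of "q - p * q"] by simp
  then show ?thesis by simp
qed

end

lemma (in complex_algebra) emb_minus:
  "x \<in> carrier A \<Longrightarrow> y \<in> carrier A \<Longrightarrow> emb A (x \<ominus> y) = emb A x - emb A y"
  by (simp add: M.minus_eq scale_minus_1[symmetric] emb_add emb_scale)

section \<open>Cuntz-Krieger families satisfy the Leavitt relations\<close>

context ck_family
begin

definition ck_value where
  "ck_value g = (case g of Edge e \<Rightarrow> emb A (s e) | Ghost e \<Rightarrow> emb A (adj A (s e)) | Proj B \<Rightarrow> emb A (p B))"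

lemma ck_value_simps [simp]:
  "ck_value (Edge e) = emb A (s e)" "ck_value (Ghost e) = emb A (adj A (s e))" "ck_value (Proj B) = emb A (p B)"
  by (simp_all add: ck_value_def)

lemma s_closed: "e \<in> edges G \<Longrightarrow> s e \<in> carrier A"
  using isom by (simp add: partial_isometry_def)

lemma p_closed: "B \<in> gverts G \<Longrightarrow> p B \<in> carrier A"
  using proj by (simp add: projection_def)

lemma ck_proj:
  assumes "B \<in> gverts G"
  shows "emb A (p B) \<in> E" "star (emb A (p B)) = emb A (p B)" "emb A (p B) * emb A (p B) = emb A (p B)"
  using proj[OF assms] by (auto simp: projection_def emb_mult[symmetric])

lemma ck_isom:
  assumes "e \<in> edges G"
  shows "emb A (s e) * emb A (adj A (s e)) * emb A (s e) = emb A (s e)"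
    "emb A (adj A (s e)) * emb A (s e) * emb A (adj A (s e)) = emb A (adj A (s e))"
    "emb A (adj A (s e)) * emb A (s e) = emb A (p (rng G e))"
proof -
  have s: "s e \<in> carrier A" "adj A (s e) \<in> carrier A" using assms s_closed adj_closed by auto
  show 1: "emb A (s e) * emb A (adj A (s e)) * emb A (s e) = emb A (s e)"
    using isom[OF assms] s by (simp add: partial_isometry_def emb_mult[symmetric] m_closed)
  show "emb A (adj A (s e)) * emb A (s e) * emb A (adj A (s e)) = emb A (adj A (s e))"
    using arg_cong[OF 1, of star] s by (simp add: star_mult E_mult_left adj_adj mult.assoc)
  show "emb A (adj A (s e)) * emb A (s e) = emb A (p (rng G e))"
    using source_projection[OF assms] s by (simp add: emb_mult[symmetric])
qed

text \<open>\<open>range_projection\<close> is an inequality of projections;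
  \<open>projection_le_E\<close> turns it into an absorption law for
  \<open>s e * adj A (s e)\<close>, and multiplication by \<open>s e\<close> gives the one for
  \<open>s e\<close>. The second equation is the adjoint of the first.\<close>

lemma ck_src:
  assumes "ultragraph G" "e \<in> edges G"
  shows "emb A (p {src G e}) * emb A (s e) = emb A (s e)"
    "emb A (adj A (s e)) * emb A (p {src G e}) = emb A (adj A (s e))"
proof -
  interpret ultragraph G by fact
  let ?P = "emb A (p {src G e})" and ?S = "emb A (s e)" and ?T = "emb A (adj A (s e))"
  have s: "s e \<in> carrier A" "adj A (s e) \<in> carrier A" using assms s_closed adj_closed by auto
  have TS: "?T = star ?S" "?S = star ?T" using s by (simp_all add: adj_adj)
  obtain z where z: "z \<in> carrier A" "p {src G e} \<ominus> (s e \<otimes> adj A (s e)) = adj A z \<otimes> z"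
    using range_projection[OF assms(2)] by (auto simp: cstar_le_def)
  have "emb A (p {src G e}) - ?S * ?T = star (emb A z) * emb A z"
    using z s p_closed[OF gverts_src[OF assms(2)]]
    by (simp add: emb_minus[symmetric] emb_mult[symmetric] m_closed adj_closed)
  then have "?P * (?S * ?T) = ?S * ?T"
  proof (rule projection_le_E[rotated -1])
    show "?P \<in> E" "star ?P = ?P" "?P * ?P = ?P" using ck_proj[OF gverts_src[OF assms(2)]] by auto
    show "?S * ?T \<in> E" "emb A z \<in> E" using z(1) s by (auto intro!: E_mult_left)
    show "star (?S * ?T) = ?S * ?T" using s by (simp add: star_mult adj_adj)
    show "?S * ?T * (?S * ?T) = ?S * ?T" using ck_isom(1)[OF assms(2)] by (simp add: mult.assoc[symmetric])
  qed
  then have "?P * (?S * ?T) * ?S = ?S * ?T * ?S" by simp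
  then show PS: "?P * ?S = ?S" using ck_isom(1)[OF assms(2)] by (simp add: mult.assoc)
  show "?T * ?P = ?T"
    using arg_cong[OF PS, of star] s ck_proj[OF gverts_src[OF assms(2)]] by (simp add: star_mult)
qed

lemma ck_leavitt_family:
  assumes "ultragraph G" shows "leavitt_family G ck_value"
proof -
  interpret ultragraph G by fact
  have closed: "e \<in> edges G \<Longrightarrow> s e \<in> carrier A" "e \<in> edges G \<Longrightarrow> adj A (s e) \<in> carrier A"
    "B \<in> gverts G \<Longrightarrow> p B \<in> carrier A" for e B
    using s_closed adj_closed p_closed by auto
  show ?thesis
  proof
    fix t u assume "(t, u) \<in> lpa_rels G"
    then show "term_value ck_value t = term_value ck_value u"
    proof cases
      case proj_empty
      then show ?thesis by (simp add: p_empty)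
    next
      case (proj_Int B C)
      then show ?thesis using p_Int[of B C] closed by (simp add: emb_mult[symmetric])
    next
      case (proj_Un B C)
      then show ?thesis using p_Un[of B C] closed gverts_Int[of B C] by (simp add: emb_minus emb_add)
    next
      case (src_edge e)
      then show ?thesis using ck_src(1)[OF assms] by simp
    next
      case (edge_rng e)
      then show ?thesis using ck_isom[of e] by (simp add: mult.assoc)
    next
      case (rng_ghost e)
      then show ?thesis using ck_isom[of e] by simp
    next
      case (ghost_src e)
      then show ?thesis using ck_src(2)[OF assms] by simp
    next
      case (ghost_edge e f)
      show ?thesis
      proof (cases "e = f")
        case True
        then show ?thesis using ghost_edge ck_isom(3)[of e] by simp
      next
        case False
        let ?S = "\<lambda>e. emb A (s e)" and ?T = "\<lambda>e. emb A (adj A (s e))"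
        have "emb A ((s e \<otimes> adj A (s e)) \<otimes> (s f \<otimes> adj A (s f))) = 0"
          using orthogonal_ranges[of e f] False ghost_edge by simp
        then have zero: "?S e * ?T e * (?S f * ?T f) = 0"
          using ghost_edge closed by (simp add: emb_mult m_closed)
        \<comment> \<open>Inserting the range projections of both partial isometries brings the two
          orthogonal ranges next to each other.\<close>
        have "?T e * ?S f = (?T e * ?S e * ?T e) * (?S f * ?T f * ?S f)"
          using ck_isom(2)[of e] ck_isom(1)[of f] ghost_edge by simp
        also have "\<dots> = ?T e * (?S e * ?T e * (?S f * ?T f)) * ?S f" by (simp only: mult.assoc)
        finally show ?thesis using zero ghost_edge False by simp
      qed
    next
      case (vertex_sum v es)
      then have fin: "finite (out_edges G v)" "out_edges G v \<noteq> {}" by (metis List.finite_set, metis set_empty)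
      have out: "out_edges G v \<subseteq> edges G" by (auto simp: out_edges_def)
      have "term_value ck_value (foldr (\<lambda>e t. Add (Mult (Gen (Edge e)) (Gen (Ghost e))) t) es Zero)
        = (\<Sum>e\<in>set es. emb A (s e) * emb A (adj A (s e)))"
        using vertex_sum(5) by (induction es) auto
      also have "\<dots> = (\<Sum>e\<in>out_edges G v. emb A (s e \<otimes> adj A (s e)))"
        using vertex_sum(6) closed out by (intro sum.cong) (auto simp: emb_mult)
      also have "\<dots> = emb A (\<Oplus>e\<in>out_edges G v. s e \<otimes> adj A (s e))"
        using fin out closed by (intro emb_finsum[symmetric]) (auto simp: m_closed)
      finally show ?thesis using ck_family_axioms ck_family.vertex_sum vertex_sum fin
        by (simp add: ck_family.vertex_sum[OF ck_family_axioms])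
    qed
  qed
qed

end

section \<open>Operators on square-summable sequences\<close>

typedef ell2 = "{f :: nat \<Rightarrow> complex. summable (\<lambda>n. (cmod (f n))\<^sup>2)}"
  morphisms seq_of ell2_of
  by (rule exI[of _ "\<lambda>_. 0"]) simp

setup_lifting type_definition_ell2

lemma summable_sq_add:
  assumes "summable (\<lambda>n. (cmod (f n))\<^sup>2)" "summable (\<lambda>n. (cmod (g n))\<^sup>2)"
  shows "summable (\<lambda>n. (cmod (f n + g n))\<^sup>2)"
proof (rule summable_comparison_test')
  show "summable (\<lambda>n. 2 * (cmod (f n))\<^sup>2 + 2 * (cmod (g n))\<^sup>2)"
    using assms by (intro summable_add summable_mult)
  fix n
  have "(cmod (f n + g n))\<^sup>2 \<le> (cmod (f n) + cmod (g n))\<^sup>2"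
    by (intro power_mono norm_triangle_ineq norm_ge_zero)
  also have "\<dots> \<le> 2 * (cmod (f n))\<^sup>2 + 2 * (cmod (g n))\<^sup>2"
    using zero_le_power2[of "cmod (f n) - cmod (g n)"] by (simp add: power2_eq_square algebra_simps)
  finally show "norm ((cmod (f n + g n))\<^sup>2) \<le> 2 * (cmod (f n))\<^sup>2 + 2 * (cmod (g n))\<^sup>2" by simp
qed

lemma summable_sq_mult: "summable (\<lambda>n. (cmod (f n))\<^sup>2) \<Longrightarrow> summable (\<lambda>n. (cmod (c * f n))\<^sup>2)"
  by (simp add: norm_mult power_mult_distrib summable_mult)

lemma summable_inner:
  assumes "summable (\<lambda>n. (cmod (f n))\<^sup>2)" "summable (\<lambda>n. (cmod (g n))\<^sup>2)"
  shows "summable (\<lambda>n. inner (f n) (g n))"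
proof (rule summable_comparison_test')
  show "summable (\<lambda>n. (cmod (f n))\<^sup>2 + (cmod (g n))\<^sup>2)" using assms by (intro summable_add)
  fix n
  have "\<bar>inner (f n) (g n)\<bar> \<le> cmod (f n) * cmod (g n)" by (rule Cauchy_Schwarz_ineq2)
  also have "\<dots> \<le> (cmod (f n))\<^sup>2 + (cmod (g n))\<^sup>2"
  proof -
    have "0 \<le> (cmod (f n) - cmod (g n))\<^sup>2" "0 \<le> cmod (f n) * cmod (g n)" by simp_all
    then show ?thesis unfolding power2_diff by linarith
  qed
  finally show "norm (inner (f n) (g n)) \<le> (cmod (f n))\<^sup>2 + (cmod (g n))\<^sup>2" by simp
qed

text \<open>The inner product is the real part of the usual one, so this is a real Hilbert space;
  its complex structure is carried by \<open>mulC\<close>.\<close>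

instantiation ell2 :: real_inner
begin

lift_definition zero_ell2 :: ell2 is "\<lambda>_. 0" by simp
lift_definition plus_ell2 :: "ell2 \<Rightarrow> ell2 \<Rightarrow> ell2" is "\<lambda>f g n. f n + g n" by (rule summable_sq_add)
lift_definition uminus_ell2 :: "ell2 \<Rightarrow> ell2" is "\<lambda>f n. - f n" by simp
lift_definition minus_ell2 :: "ell2 \<Rightarrow> ell2 \<Rightarrow> ell2" is "\<lambda>f g n. f n - g n"
  using summable_sq_add[of _ "\<lambda>n. - _ n"] by simp
lift_definition scaleR_ell2 :: "real \<Rightarrow> ell2 \<Rightarrow> ell2" is "\<lambda>r f n. complex_of_real r * f n"
  by (rule summable_sq_mult)
lift_definition inner_ell2 :: "ell2 \<Rightarrow> ell2 \<Rightarrow> real" is "\<lambda>f g. \<Sum>n. inner (f n) (g n)" .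
definition norm_ell2 :: "ell2 \<Rightarrow> real" where "norm_ell2 x = sqrt (inner x x)"
definition dist_ell2 :: "ell2 \<Rightarrow> ell2 \<Rightarrow> real" where "dist_ell2 x y = norm (x - y)"
definition sgn_ell2 :: "ell2 \<Rightarrow> ell2" where "sgn_ell2 x = scaleR (inverse (norm x)) x"
definition uniformity_ell2 :: "(ell2 \<times> ell2) filter"
  where "uniformity_ell2 = (INF e\<in>{0<..}. principal {(x, y). dist x y < e})"
definition open_ell2 :: "ell2 set \<Rightarrow> bool"
  where "open_ell2 U = (\<forall>x\<in>U. eventually (\<lambda>(x', y). x' = x \<longrightarrow> y \<in> U) uniformity)"

instance
proof
  fix x y z :: ell2 and r r' :: real
  show "x + y + z = x + (y + z)" "x + y = y + x" "0 + x = x" "- x + x = 0" "x - y = x + - y"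
    by (transfer, simp add: add_ac)+
  show "r *\<^sub>R (x + y) = r *\<^sub>R x + r *\<^sub>R y" "(r + r') *\<^sub>R x = r *\<^sub>R x + r' *\<^sub>R x"
    "r *\<^sub>R r' *\<^sub>R x = (r * r') *\<^sub>R x" "1 *\<^sub>R x = x"
    by (transfer, simp add: algebra_simps)+
  show "dist x y = norm (x - y)" by (rule dist_ell2_def)
  show "sgn x = scaleR (inverse (norm x)) x" by (rule sgn_ell2_def)
  show "uniformity = (INF e\<in>{0<..}. principal {(x, y :: ell2). dist x y < e})" by (rule uniformity_ell2_def)
  show "open U = (\<forall>x\<in>U. eventually (\<lambda>(x', y). x' = x \<longrightarrow> y \<in> U) uniformity)" for U :: "ell2 set"
    by (rule open_ell2_def)
  show "inner x y = inner y x" by transfer (simp add: inner_commute)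
  show "inner (x + y) z = inner x z + inner y z"
    by transfer (simp add: inner_add_left suminf_add summable_inner)
  show "inner (r *\<^sub>R x) y = r * inner x y"
  proof (transfer)
    fix r :: real and f g :: "nat \<Rightarrow> complex"
    assume "summable (\<lambda>n. (cmod (f n))\<^sup>2)" "summable (\<lambda>n. (cmod (g n))\<^sup>2)"
    then have s: "summable (\<lambda>n. inner (f n) (g n))" by (rule summable_inner)
    have "inner (complex_of_real r * f n) (g n) = r * inner (f n) (g n)" for n
      by (simp add: inner_complex_def algebra_simps)
    then show "(\<Sum>n. inner (complex_of_real r * f n) (g n)) = r * (\<Sum>n. inner (f n) (g n))"
      by (simp add: suminf_mult[OF s])
  qed
  show "0 \<le> inner x x"
    by transfer (simp add: suminf_nonneg summable_inner)
  show "(inner x x = 0) = (x = 0)"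
  proof transfer
    fix f :: "nat \<Rightarrow> complex" assume f: "summable (\<lambda>n. (cmod (f n))\<^sup>2)"
    show "((\<Sum>n. inner (f n) (f n)) = 0) = (f = (\<lambda>_. 0))"
      using suminf_eq_zero_iff[OF summable_inner[OF f f]] by (auto simp: fun_eq_iff)
  qed
  show "norm x = sqrt (inner x x)" by (rule norm_ell2_def)
qed

end

lemma seq_of_summable: "summable (\<lambda>n. (cmod (seq_of x n))\<^sup>2)"
  using seq_of[of x] by simp

lemma norm_ell2_sq: "(norm (x :: ell2))\<^sup>2 = (\<Sum>n. (cmod (seq_of x n))\<^sup>2)"
  unfolding power2_norm_eq_inner by transfer (simp add: power2_norm_eq_inner)

lemma sum_le_norm_ell2: "(\<Sum>n<N. (cmod (seq_of x n))\<^sup>2) \<le> (norm x)\<^sup>2"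
  unfolding norm_ell2_sq by (rule sum_le_suminf[OF seq_of_summable]) auto

lemma coordinate_le_norm: "cmod (seq_of x n) \<le> norm x"
proof -
  have "(cmod (seq_of x n))\<^sup>2 \<le> (\<Sum>n<Suc n. (cmod (seq_of x n))\<^sup>2)" by (simp add: sum_nonneg)
  then have "(cmod (seq_of x n))\<^sup>2 \<le> (norm x)\<^sup>2" using sum_le_norm_ell2[of x "Suc n"] by linarith
  then show ?thesis by (rule power2_le_imp_le) simp
qed

lemma seq_of_diff: "seq_of (x - y) n = seq_of x n - seq_of y n"
  by transfer simp

instance ell2 :: complete_space
proof
  fix X :: "nat \<Rightarrow> ell2" assume X: "Cauchy X"
  have "Cauchy (\<lambda>k. seq_of (X k) n)" for n
  proof (rule CauchyI)
    fix e :: real assume "0 < e"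
    then obtain M where "\<And>m k. m \<ge> M \<Longrightarrow> k \<ge> M \<Longrightarrow> norm (X m - X k) < e" using CauchyD[OF X] by blast
    then show "\<exists>M. \<forall>m\<ge>M. \<forall>k\<ge>M. norm (seq_of (X m) n - seq_of (X k) n) < e"
      using coordinate_le_norm[of "X _ - X _" n] unfolding seq_of_diff by (meson le_less_trans)
  qed
  then have "\<exists>l. (\<lambda>k. seq_of (X k) n) \<longlonglongrightarrow> l" for n
    using Cauchy_convergent_iff convergent_def by blast
  then obtain l where l: "\<And>n. (\<lambda>k. seq_of (X k) n) \<longlonglongrightarrow> l n" by metis
  \<comment> \<open>For finitely many coordinates the bound passes to the coordinatewise limit. It
    does not depend on \<open>N\<close>, so it gives summability and the norm bound at once.\<close>
  have tail: "(\<Sum>n<N. (cmod (seq_of (X m) n - l n))\<^sup>2) \<le> e\<^sup>2"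
    if "\<And>k. k \<ge> M \<Longrightarrow> norm (X m - X k) \<le> e" "0 \<le> e" for m M N e
  proof (rule LIMSEQ_le_const2)
    show "(\<lambda>k. \<Sum>n<N. (cmod (seq_of (X m - X k) n))\<^sup>2) \<longlonglongrightarrow> (\<Sum>n<N. (cmod (seq_of (X m) n - l n))\<^sup>2)"
      unfolding seq_of_diff by (intro tendsto_intros l)
    have "(\<Sum>n<N. (cmod (seq_of (X m - X k) n))\<^sup>2) \<le> e\<^sup>2" if "k \<ge> M" for k
      using sum_le_norm_ell2[of "X m - X k" N] power_mono[OF \<open>\<And>k. k \<ge> M \<Longrightarrow> norm (X m - X k) \<le> e\<close>[OF that], of 2]
      by simp
    then show "\<exists>K. \<forall>k\<ge>K. (\<Sum>n<N. (cmod (seq_of (X m - X k) n))\<^sup>2) \<le> e\<^sup>2" by blast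
  qed
  have summable: "summable (\<lambda>n. (cmod (seq_of (X m) n - l n))\<^sup>2) \<and> (\<Sum>n. (cmod (seq_of (X m) n - l n))\<^sup>2) \<le> e\<^sup>2"
    if "\<And>k. k \<ge> M \<Longrightarrow> norm (X m - X k) \<le> e" "0 \<le> e" for m M e
  proof -
    have t: "(\<Sum>n<N. (cmod (seq_of (X m) n - l n))\<^sup>2) \<le> e\<^sup>2" for N by (rule tail[OF that])
    have s: "summable (\<lambda>n. (cmod (seq_of (X m) n - l n))\<^sup>2)"
    proof (rule bounded_imp_summable)
      show "(\<Sum>k\<le>n. (cmod (seq_of (X m) k - l k))\<^sup>2) \<le> e\<^sup>2" for n
        using t[of "Suc n"] by (simp only: lessThan_Suc_atMost)
    qed simp
    then show ?thesis using suminf_le_const[OF s t] by simp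
  qed
  obtain M1 where M1: "\<And>m k. m \<ge> M1 \<Longrightarrow> k \<ge> M1 \<Longrightarrow> norm (X m - X k) < 1" using CauchyD[OF X, of 1] by auto
  have "summable (\<lambda>n. (cmod (seq_of (X M1) n - l n))\<^sup>2)"
    using summable[of M1 M1 1] M1[of M1] by (simp add: less_imp_le)
  then have "summable (\<lambda>n. (cmod (seq_of (X M1) n + - 1 * (seq_of (X M1) n - l n)))\<^sup>2)"
    by (intro summable_sq_add summable_sq_mult seq_of_summable)
  then have lsum: "summable (\<lambda>n. (cmod (l n))\<^sup>2)" by simp
  define L where "L = ell2_of l"
  have L: "seq_of L = l" unfolding L_def using lsum by (simp add: ell2_of_inverse)
  have "X \<longlonglongrightarrow> L"
  proof (rule LIMSEQ_I)
    fix r :: real assume "0 < r"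
    then obtain M where M: "\<And>m k. m \<ge> M \<Longrightarrow> k \<ge> M \<Longrightarrow> norm (X m - X k) < r / 2" using CauchyD[OF X, of "r / 2"] by auto
    have "norm (X m - L) < r" if "m \<ge> M" for m
    proof -
      have "(norm (X m - L))\<^sup>2 \<le> (r / 2)\<^sup>2"
        unfolding norm_ell2_sq seq_of_diff L
        using summable[of M m "r / 2"] M[OF that] \<open>0 < r\<close> by (simp add: less_imp_le)
      then have "norm (X m - L) \<le> r / 2" by (rule power2_le_imp_le) (use \<open>0 < r\<close> in simp)
      then show ?thesis using \<open>0 < r\<close> by simp
    qed
    then show "\<exists>no. \<forall>n\<ge>no. norm (X n - L) < r" by blast
  qed
  then show "convergent X" by (rule convergentI)
qed

instance ell2 :: banach ..

lift_definition mulC :: "complex \<Rightarrow> ell2 \<Rightarrow> ell2" is "\<lambda>c f n. c * f n"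
  by (rule summable_sq_mult)

lemma mulC_simps:
  "mulC c (x + y) = mulC c x + mulC c y" "mulC (c + d) x = mulC c x + mulC d x"
  "mulC c (mulC d x) = mulC (c * d) x" "mulC 1 x = x" "mulC c (r *\<^sub>R x) = r *\<^sub>R mulC c x"
  "mulC c 0 = 0" "mulC c (- x) = - mulC c x"
  by (transfer, simp add: algebra_simps)+

lemma inner_mulC: "inner x (mulC c y) = inner (mulC (cnj c) x) y"
  by transfer (simp add: inner_complex_def algebra_simps)

lemma norm_mulC: "norm (mulC c x) = cmod c * norm x"
proof -
  have "(norm (mulC c x))\<^sup>2 = (cmod c * norm x)\<^sup>2"
    unfolding norm_ell2_sq power_mult_distrib
    by transfer (simp add: norm_mult power_mult_distrib suminf_mult)
  then show ?thesis by (simp add: power2_eq_iff_nonneg)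
qed

section \<open>Adjointable complex-linear operators\<close>

definition adjoint_ops :: "(ell2 \<Rightarrow>\<^sub>L ell2) \<Rightarrow> (ell2 \<Rightarrow>\<^sub>L ell2) \<Rightarrow> bool" where
  "adjoint_ops T T' \<longleftrightarrow> (\<forall>x y. inner (T x) y = inner x (T' y))"

text \<open>Complex linearity is an extra condition on real-linear operators. Existence of an
  adjoint is built in instead of being derived by Riesz representation;
  \<open>ell2_ops_complete\<close> checks that it survives norm limits.\<close>

definition ell2_ops :: "(ell2 \<Rightarrow>\<^sub>L ell2) set" where
  "ell2_ops = {T :: ell2 \<Rightarrow>\<^sub>L ell2. (\<forall>c x. blinfun_apply T (mulC c x) = mulC c (blinfun_apply T x)) \<and> (\<exists>T'. adjoint_ops T T')}"

definition op_adj :: "(ell2 \<Rightarrow>\<^sub>L ell2) \<Rightarrow> (ell2 \<Rightarrow>\<^sub>L ell2)" where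
  "op_adj T = (SOME T'. adjoint_ops T T')"

lemma adjoint_ops_unique: "adjoint_ops T T' \<Longrightarrow> adjoint_ops T T'' \<Longrightarrow> T' = T''"
  by (rule blinfun_eqI) (metis adjoint_ops_def vector_eq_ldot)

lemma adjoint_ops_sym: "adjoint_ops T T' \<Longrightarrow> adjoint_ops T' T"
  by (metis adjoint_ops_def inner_commute)

lemma op_adj_eq: "adjoint_ops T T' \<Longrightarrow> op_adj T = T'"
  unfolding op_adj_def by (rule adjoint_ops_unique[OF someI])

lemma ell2_opsD:
  fixes T :: "ell2 \<Rightarrow>\<^sub>L ell2"
  assumes "T \<in> ell2_ops"
  shows "adjoint_ops T (op_adj T)" "T (mulC c x) = mulC c (T x)"
  using assms op_adj_eq by (auto simp: ell2_ops_def)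

lemma ell2_opsI: "(\<And>c x. blinfun_apply T (mulC c x) = mulC c (blinfun_apply T x)) \<Longrightarrow> adjoint_ops T T' \<Longrightarrow> T \<in> ell2_ops"
  by (auto simp: ell2_ops_def)

lemma op_adj_in_ops:
  assumes T: "T \<in> ell2_ops" shows "op_adj T \<in> ell2_ops" "op_adj (op_adj T) = T"
proof -
  note adj = ell2_opsD(1)[OF T] adjoint_ops_sym[OF ell2_opsD(1)[OF T]]
  have "inner x (op_adj T (mulC c y)) = inner x (mulC c (op_adj T y))" for c x y
    using adj(1) ell2_opsD(2)[OF T] by (simp add: adjoint_ops_def[symmetric] inner_mulC) (metis adjoint_ops_def inner_mulC)
  then have "op_adj T (mulC c y) = mulC c (op_adj T y)" for c y by (metis vector_eq_ldot)
  then show "op_adj T \<in> ell2_ops" using adj(2) by (rule ell2_opsI)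
  show "op_adj (op_adj T) = T" using adj(2) by (rule op_adj_eq)
qed

lemma norm_le_adjoint:
  assumes "adjoint_ops T T'" shows "norm T' \<le> norm T" "(norm T)\<^sup>2 \<le> norm (T' o\<^sub>L T)"
proof -
  show "norm T' \<le> norm T"
  proof (rule norm_blinfun_bound)
    fix y
    have "(norm (T' y))\<^sup>2 = inner (T (T' y)) y"
      using assms unfolding adjoint_ops_def power2_norm_eq_inner by metis
    also have "\<dots> \<le> norm (T (T' y)) * norm y" by (rule norm_cauchy_schwarz)
    also have "\<dots> \<le> norm T * norm (T' y) * norm y" by (intro mult_right_mono norm_blinfun) simp
    finally have "norm (T' y) * norm (T' y) \<le> norm (T' y) * (norm T * norm y)"
      by (simp add: power2_eq_square mult_ac)
    then show "norm (T' y) \<le> norm T * norm y" by (cases "norm (T' y) = 0") simp_all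
  qed simp
  have "norm T \<le> sqrt (norm (T' o\<^sub>L T))"
  proof (rule norm_blinfun_bound)
    fix x
    have "(norm (T x))\<^sup>2 = inner x (T' (T x))"
      using assms unfolding adjoint_ops_def power2_norm_eq_inner by metis
    also have "\<dots> \<le> norm x * norm ((T' o\<^sub>L T) x)" using norm_cauchy_schwarz by simp
    also have "\<dots> \<le> norm x * (norm (T' o\<^sub>L T) * norm x)" by (intro mult_left_mono norm_blinfun) simp
    also have "\<dots> = (sqrt (norm (T' o\<^sub>L T)) * norm x)\<^sup>2" by (simp add: power_mult_distrib power2_eq_square)
    finally show "norm (T x) \<le> sqrt (norm (T' o\<^sub>L T)) * norm x" by (rule power2_le_imp_le) simp
  qed simp
  then have "(norm T)\<^sup>2 \<le> (sqrt (norm (T' o\<^sub>L T)))\<^sup>2" by (intro power_mono) simp_all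
  then show "(norm T)\<^sup>2 \<le> norm (T' o\<^sub>L T)" by simp
qed

lemma norm_op_adj: "T \<in> ell2_ops \<Longrightarrow> norm (op_adj T) = norm T"
  using norm_le_adjoint(1)[OF ell2_opsD(1)] norm_le_adjoint(1)[OF adjoint_ops_sym[OF ell2_opsD(1)]] by (metis antisym)

lemma op_cstar_identity:
  assumes T: "T \<in> ell2_ops" shows "norm (op_adj T o\<^sub>L T) = (norm T)\<^sup>2"
proof (rule antisym)
  have "norm (op_adj T o\<^sub>L T) \<le> norm (op_adj T) * norm T" by (rule norm_blinfun_compose)
  then show "norm (op_adj T o\<^sub>L T) \<le> (norm T)\<^sup>2" by (simp add: norm_op_adj[OF T] power2_eq_square)
qed (rule norm_le_adjoint(2)[OF ell2_opsD(1)[OF T]])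

lift_definition mulC_op :: "complex \<Rightarrow> (ell2 \<Rightarrow>\<^sub>L ell2)" is mulC
proof -
  fix c show "bounded_linear (mulC c)"
    by (rule bounded_linear_intro[of _ "cmod c"]) (simp_all add: mulC_simps norm_mulC)
qed

declare mulC_op.rep_eq [simp]

lemma adjoint_ops_intros:
  "adjoint_ops T T' \<Longrightarrow> adjoint_ops U U' \<Longrightarrow> adjoint_ops (T + U) (T' + U')"
  "adjoint_ops T T' \<Longrightarrow> adjoint_ops U U' \<Longrightarrow> adjoint_ops (T - U) (T' - U')"
  "adjoint_ops T T' \<Longrightarrow> adjoint_ops U U' \<Longrightarrow> adjoint_ops (T o\<^sub>L U) (U' o\<^sub>L T')"
  "adjoint_ops 0 0" "adjoint_ops (mulC_op c) (mulC_op (cnj c))"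
  "adjoint_ops T T' \<Longrightarrow> adjoint_ops (- T) (- T')"
  by (simp_all add: adjoint_ops_def blinfun.add_left blinfun.diff_left blinfun.minus_left inner_add_left inner_add_right
      inner_diff_left inner_diff_right inner_mulC)

lemma mulC_diff: "mulC c (x - y) = mulC c x - mulC c y"
  by transfer (simp add: algebra_simps)

lemma ell2_ops_closed:
  assumes "T \<in> ell2_ops" "U \<in> ell2_ops"
  shows "T + U \<in> ell2_ops" "T - U \<in> ell2_ops" "T o\<^sub>L U \<in> ell2_ops" "- T \<in> ell2_ops" "mulC_op c o\<^sub>L T \<in> ell2_ops"
  by (rule ell2_opsI[OF _ adjoint_ops_intros(1)[OF assms[THEN ell2_opsD(1)]]];
      simp add: ell2_opsD assms mulC_simps mulC_diff blinfun.add_left blinfun.diff_left blinfun.minus_left mult.commute)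
    (rule ell2_opsI[OF _ adjoint_ops_intros(2)[OF assms[THEN ell2_opsD(1)]]]
      ell2_opsI[OF _ adjoint_ops_intros(3)[OF assms[THEN ell2_opsD(1)]]]
      ell2_opsI[OF _ adjoint_ops_intros(6)[OF ell2_opsD(1)[OF assms(1)]]]
      ell2_opsI[OF _ adjoint_ops_intros(3)[OF adjoint_ops_intros(5) ell2_opsD(1)[OF assms(1)]]];
      simp add: ell2_opsD assms mulC_simps mulC_diff blinfun.add_left blinfun.diff_left blinfun.minus_left mult.commute)+

lemma zero_in_ell2_ops: "0 \<in> ell2_ops"
  by (rule ell2_opsI[OF _ adjoint_ops_intros(4)]) (simp add: mulC_simps)

lemma op_adj_simps:
  assumes "T \<in> ell2_ops" "U \<in> ell2_ops"
  shows "op_adj (T + U) = op_adj T + op_adj U" "op_adj (T - U) = op_adj T - op_adj U"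
    "op_adj (T o\<^sub>L U) = op_adj U o\<^sub>L op_adj T" "op_adj (mulC_op c o\<^sub>L T) = mulC_op (cnj c) o\<^sub>L op_adj T"
proof -
  note a = ell2_opsD(1)[OF assms(1)] ell2_opsD(1)[OF assms(2)]
  show "op_adj (T + U) = op_adj T + op_adj U" "op_adj (T - U) = op_adj T - op_adj U"
    "op_adj (T o\<^sub>L U) = op_adj U o\<^sub>L op_adj T"
    by (rule op_adj_eq[OF adjoint_ops_intros(1)[OF a]] op_adj_eq[OF adjoint_ops_intros(2)[OF a]]
        op_adj_eq[OF adjoint_ops_intros(3)[OF a]])+
  have "op_adj (mulC_op c o\<^sub>L T) = op_adj T o\<^sub>L mulC_op (cnj c)"
    by (intro op_adj_eq adjoint_ops_intros a)
  also have "\<dots> = mulC_op (cnj c) o\<^sub>L op_adj T"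
    using ell2_opsD(2)[OF op_adj_in_ops(1)[OF assms(1)]] by (intro blinfun_eqI) simp
  finally show "op_adj (mulC_op c o\<^sub>L T) = mulC_op (cnj c) o\<^sub>L op_adj T" .
qed

lemma norm_mulC_op_compose: "norm (mulC_op c o\<^sub>L T) = cmod c * norm T"
proof (rule antisym)
  show "norm (mulC_op c o\<^sub>L T) \<le> cmod c * norm T"
    by (rule norm_blinfun_bound) (simp_all add: norm_mulC mult.assoc mult_left_mono norm_blinfun)
  show "cmod c * norm T \<le> norm (mulC_op c o\<^sub>L T)"
  proof (cases "c = 0")
    case False
    have "norm T \<le> norm (mulC_op c o\<^sub>L T) / cmod c"
    proof (rule norm_blinfun_bound)
      fix x
      have "cmod c * norm (T x) = norm ((mulC_op c o\<^sub>L T) x)" by (simp add: norm_mulC)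
      also have "\<dots> \<le> norm (mulC_op c o\<^sub>L T) * norm x" by (rule norm_blinfun)
      finally show "norm (T x) \<le> norm (mulC_op c o\<^sub>L T) / cmod c * norm x"
        using False by (simp add: field_simps)
    qed simp
    then show ?thesis using False by (simp add: field_simps)
  qed simp
qed

text \<open>Taking adjoints is isometric, so the adjoints form a Cauchy sequence as well, and their
  limit is the adjoint of the limit.\<close>

lemma ell2_ops_complete:
  assumes "\<And>n. X n \<in> ell2_ops" "Cauchy X"
  shows "\<exists>T\<in>ell2_ops. X \<longlonglongrightarrow> T"
proof -
  obtain T where T: "X \<longlonglongrightarrow> T" using assms(2) Cauchy_convergent_iff convergent_def by blast
  have "Cauchy (\<lambda>n. op_adj (X n))"
  proof (rule CauchyI)
    fix e :: real assume "0 < e"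
    have "norm (op_adj (X m) - op_adj (X n)) = norm (X m - X n)" for m n
      using norm_op_adj[OF ell2_ops_closed(2)[OF assms(1) assms(1)]] op_adj_simps(2)[OF assms(1) assms(1)] by metis
    then show "\<exists>M. \<forall>m\<ge>M. \<forall>n\<ge>M. norm (op_adj (X m) - op_adj (X n)) < e"
      using CauchyD[OF assms(2) \<open>0 < e\<close>] by simp
  qed
  then obtain T' where T': "(\<lambda>n. op_adj (X n)) \<longlonglongrightarrow> T'" using Cauchy_convergent_iff convergent_def by blast
  have app: "(\<lambda>n. X n x) \<longlonglongrightarrow> T x" "(\<lambda>n. op_adj (X n) x) \<longlonglongrightarrow> T' x" for x
    using T T' by (auto intro: blinfun.tendsto)
  have "T \<in> ell2_ops"
  proof (rule ell2_opsI)
    show "T (mulC c x) = mulC c (T x)" for c x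
    proof (rule LIMSEQ_unique)
      show "(\<lambda>n. X n (mulC c x)) \<longlonglongrightarrow> T (mulC c x)" by (rule app)
      have "(\<lambda>n. mulC_op c (X n x)) \<longlonglongrightarrow> mulC_op c (T x)" by (intro blinfun.tendsto app tendsto_const)
      then show "(\<lambda>n. X n (mulC c x)) \<longlonglongrightarrow> mulC c (T x)" using ell2_opsD(2)[OF assms(1)] by simp
    qed
    show "adjoint_ops T T'"
      unfolding adjoint_ops_def
    proof (intro allI)
      fix x y
      have "inner (X n x) y = inner x (op_adj (X n) y)" for n
        using ell2_opsD(1)[OF assms(1)] by (simp add: adjoint_ops_def)
      moreover have "(\<lambda>n. inner (X n x) y) \<longlonglongrightarrow> inner (T x) y" "(\<lambda>n. inner x (op_adj (X n) y)) \<longlonglongrightarrow> inner x (T' y)"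
        by (intro tendsto_inner app tendsto_const)+
      ultimately show "inner (T x) y = inner x (T' y)" by (simp add: LIMSEQ_unique)
    qed
  qed
  then show ?thesis using T by blast
qed

text \<open>The universal property concerns algebras whose elements have type
  \<open>sequence_operator\<close>. That type admits all sequences, so an operator is given the
  default value 0 at those that are not square-summable.\<close>

definition encode :: "(ell2 \<Rightarrow>\<^sub>L ell2) \<Rightarrow> sequence_operator" where
  "encode T f = (if summable (\<lambda>n. (cmod (f n))\<^sup>2) then seq_of (T (ell2_of f)) else (\<lambda>_. 0))"

lemma inj_encode: "inj encode"
proof (rule injI, rule blinfun_eqI)
  fix T U x assume "encode T = encode U"
  then have "encode T (seq_of x) = encode U (seq_of x)" by simp
  then show "blinfun_apply T x = blinfun_apply U x"
    by (simp add: encode_def seq_of_summable seq_of_inverse seq_of_inject)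
qed

definition decode :: "sequence_operator \<Rightarrow> (ell2 \<Rightarrow>\<^sub>L ell2)" where "decode = inv_into UNIV encode"

lemma decode_encode [simp]: "decode (encode T) = T"
  by (simp add: decode_def inj_encode)

definition operator_algebra :: "sequence_operator cstar" where
  "operator_algebra = \<lparr>carrier = encode ` ell2_ops, mult = (\<lambda>x y. encode (decode x o\<^sub>L decode y)),
     one = undefined, zero = encode 0, add = (\<lambda>x y. encode (decode x + decode y)),
     smult = (\<lambda>c x. encode (mulC_op c o\<^sub>L decode x)),
     adj = (\<lambda>x. encode (op_adj (decode x))), nrm = (\<lambda>x. norm (decode x))\<rparr>"

lemma operator_algebra_simps [simp]:
  "carrier operator_algebra = encode ` ell2_ops"
  "encode T \<otimes>\<^bsub>operator_algebra\<^esub> encode U = encode (T o\<^sub>L U)"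
  "encode T \<oplus>\<^bsub>operator_algebra\<^esub> encode U = encode (T + U)"
  "\<zero>\<^bsub>operator_algebra\<^esub> = encode 0"
  "c \<odot>\<^bsub>operator_algebra\<^esub> encode T = encode (mulC_op c o\<^sub>L T)"
  "adj operator_algebra (encode T) = encode (op_adj T)"
  "nrm operator_algebra (encode T) = norm T"
  by (simp_all add: operator_algebra_def)

lemmas blinfun_compose_add = bounded_bilinear.add_left[OF bounded_bilinear_blinfun_compose]
  bounded_bilinear.add_right[OF bounded_bilinear_blinfun_compose]

lemma blinfun_compose_assoc: "(T o\<^sub>L U) o\<^sub>L V = T o\<^sub>L (U o\<^sub>L V)"
  by (rule blinfun_eqI) simp

lemma complex_algebra_operator: "complex_algebra operator_algebra"
proof -
  have "abelian_group operator_algebra"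
  proof (rule abelian_groupI)
    fix x assume "x \<in> carrier operator_algebra"
    then obtain T where T: "x = encode T" "T \<in> ell2_ops" by auto
    then show "\<exists>y\<in>carrier operator_algebra. y \<oplus>\<^bsub>operator_algebra\<^esub> x = \<zero>\<^bsub>operator_algebra\<^esub>"
      by (intro bexI[of _ "encode (- T)"]) (auto simp: ell2_ops_closed)
  qed (auto simp: ell2_ops_closed zero_in_ell2_ops add_ac)
  \<comment> \<open>This is part of the axioms of any complex algebra, and the universal algebra on
    arbitrary data is one.\<close>
  moreover have "cring complex_ring"
    by (rule module.axioms(1)[OF complex_algebra.axioms(1)[OF complex_algebra_universal[of undefined undefined]]])
  moreover have "mulC_op (c + d) = mulC_op c + mulC_op d" "mulC_op (c * d) = mulC_op c o\<^sub>L mulC_op d"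
    "mulC_op 1 o\<^sub>L T = T" for c d and T :: "ell2 \<Rightarrow>\<^sub>L ell2"
    by (auto intro!: blinfun_eqI simp: mulC_simps blinfun.add_left)
  ultimately have "module complex_ring operator_algebra"
    by (intro moduleI) (auto simp: ell2_ops_closed blinfun_compose_add blinfun_compose_assoc)
  moreover have "T o\<^sub>L (mulC_op c o\<^sub>L U) = mulC_op c o\<^sub>L (T o\<^sub>L U)" if "T \<in> ell2_ops" for T U :: "ell2 \<Rightarrow>\<^sub>L ell2" and c
    using ell2_opsD(2)[OF that] by (intro blinfun_eqI) simp
  ultimately show ?thesis
    by (intro complex_algebra.intro complex_algebra_axioms.intro)
      (auto simp: ell2_ops_closed blinfun_compose_add blinfun_compose_assoc)
qed

lemma operator_minus:
  assumes "T \<in> ell2_ops" "U \<in> ell2_ops"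
  shows "encode T \<ominus>\<^bsub>operator_algebra\<^esub> encode U = encode (T - U)"
proof -
  interpret complex_algebra operator_algebra by (rule complex_algebra_operator)
  have "\<ominus>\<^bsub>operator_algebra\<^esub> encode U = encode (- U)"
    by (rule M.minus_equality) (use assms in \<open>auto simp: ell2_ops_closed\<close>)
  then show ?thesis by (simp add: M.minus_eq)
qed

lemma cstar_algebra_operator: "cstar_algebra operator_algebra"
proof (intro cstar_algebra.intro cstar_algebra_axioms.intro complex_algebra_operator)
  have d: "cdist operator_algebra (encode T) (encode U) = dist T U" if "T \<in> ell2_ops" "U \<in> ell2_ops" for T U
    using that by (simp add: cdist_def operator_minus dist_norm)
  interpret Metric_space "carrier operator_algebra" "cdist operator_algebra"
  proof
    fix x y
    show "0 \<le> cdist operator_algebra x y"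
      by (cases "x \<in> carrier operator_algebra \<and> y \<in> carrier operator_algebra") (auto simp: d, auto simp: cdist_def)
    show "cdist operator_algebra x y = cdist operator_algebra y x"
      by (cases "x \<in> carrier operator_algebra \<and> y \<in> carrier operator_algebra") (auto simp: d dist_commute, auto simp: cdist_def)
  qed (auto simp: d dist_triangle)
  show mcomplete
    unfolding mcomplete_def
  proof (intro allI impI)
    fix x assume x: "MCauchy x"
    define X where "X n = decode (x n)" for n
    have X: "X n \<in> ell2_ops" "x n = encode (X n)" for n
    proof -
      have "x n \<in> encode ` ell2_ops" using x unfolding MCauchy_def by auto
      then show "X n \<in> ell2_ops" "x n = encode (X n)" by (auto simp: X_def)
    qed
    have "Cauchy X"
      using x X unfolding MCauchy_def Cauchy_def by (auto simp: d)
    then obtain T where T: "T \<in> ell2_ops" "X \<longlonglongrightarrow> T" using ell2_ops_complete[of X, OF X(1)] by blast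
    have "(\<lambda>n. cdist operator_algebra (x n) (encode T)) \<longlonglongrightarrow> 0"
      using tendsto_dist[OF T(2) tendsto_const[of T]] X T(1) by (simp add: d)
    then have "limitin mtopology x (encode T) sequentially"
      using X T(1) unfolding limitin_metric_dist_null by auto
    then show "\<exists>l. limitin mtopology x l sequentially" by blast
  qed
qed (auto simp: op_adj_in_ops op_adj_simps ell2_ops_closed norm_triangle_ineq norm_mulC_op_compose
    norm_blinfun_compose op_cstar_identity inj_encode[THEN inj_eq])

section \<open>Operators given by partial injections of the index set\<close>

lemma sum_reindexed_le:
  assumes "inj_on \<sigma> D" "summable (\<lambda>n. (cmod (f n))\<^sup>2)" "finite N"
  shows "(\<Sum>n\<in>N. (cmod (if n \<in> D then f (\<sigma> n) else 0))\<^sup>2) \<le> (\<Sum>n. (cmod (f n))\<^sup>2)"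
proof -
  have "(\<Sum>n\<in>N. (cmod (if n \<in> D then f (\<sigma> n) else 0))\<^sup>2) = (\<Sum>n\<in>N \<inter> D. (cmod (f (\<sigma> n)))\<^sup>2)"
    using assms(3) by (intro sum.mono_neutral_cong_right) auto
  also have "\<dots> = (\<Sum>m\<in>\<sigma> ` (N \<inter> D). (cmod (f m))\<^sup>2)"
    using inj_on_subset[OF assms(1)] by (subst sum.reindex) auto
  also have "\<dots> \<le> (\<Sum>n. (cmod (f n))\<^sup>2)"
    using assms(2,3) by (intro sum_le_suminf) auto
  finally show ?thesis .
qed

lemma summable_reindexed:
  assumes "inj_on \<sigma> D" "summable (\<lambda>n. (cmod (f n))\<^sup>2)"
  shows "summable (\<lambda>n. (cmod (if n \<in> D then f (\<sigma> n) else 0))\<^sup>2)"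
  by (rule bounded_imp_summable) (simp, rule sum_reindexed_le[OF assms], simp)

text \<open>Without injectivity of \<open>\<sigma>\<close> the reindexed sequence need not be
  square-summable; the default 0 keeps the operation total.\<close>

lift_definition pull :: "nat set \<Rightarrow> (nat \<Rightarrow> nat) \<Rightarrow> ell2 \<Rightarrow> ell2"
  is "\<lambda>D \<sigma> f n. if inj_on \<sigma> D then if n \<in> D then f (\<sigma> n) else 0 else 0"
proof -
  fix D :: "nat set" and \<sigma> :: "nat \<Rightarrow> nat" and f :: "nat \<Rightarrow> complex"
  assume "summable (\<lambda>n. (cmod (f n))\<^sup>2)"
  then show "summable (\<lambda>n. (cmod (if inj_on \<sigma> D then if n \<in> D then f (\<sigma> n) else 0 else 0))\<^sup>2)"
    using summable_reindexed[of \<sigma> D f] by (cases "inj_on \<sigma> D") simp_all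
qed

lemma norm_pull: "norm (pull D \<sigma> x) \<le> norm x"
proof (cases "inj_on \<sigma> D")
  case True
  have "(norm (pull D \<sigma> x))\<^sup>2 \<le> (norm x)\<^sup>2"
    unfolding norm_ell2_sq
  proof (rule suminf_le_const[OF seq_of_summable])
    fix N
    show "(\<Sum>n<N. (cmod (seq_of (pull D \<sigma> x) n))\<^sup>2) \<le> (\<Sum>n. (cmod (seq_of x n))\<^sup>2)"
      using sum_reindexed_le[OF True seq_of_summable[of x], of "{..<N}"] True by (simp add: pull.rep_eq)
  qed
  then show ?thesis by (rule power2_le_imp_le) simp
next
  case False
  then have "pull D \<sigma> x = 0" by transfer simp
  then show ?thesis by simp
qed

text \<open>Pulling back along a partial injection \<open>\<sigma>\<close> with domain \<open>D\<close>. All members of the concrete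
  Cuntz-Krieger family that shows \<open>p {v} \<noteq> 0\<close> are of this form or adjoints of such operators.\<close>

lift_definition pull_op :: "nat set \<Rightarrow> (nat \<Rightarrow> nat) \<Rightarrow> (ell2 \<Rightarrow>\<^sub>L ell2)" is pull
proof -
  fix D \<sigma>
  show "bounded_linear (pull D \<sigma>)"
  proof (rule bounded_linear_intro[of _ 1])
    show "pull D \<sigma> (x + y) = pull D \<sigma> x + pull D \<sigma> y" for x y by transfer (simp add: fun_eq_iff)
    show "pull D \<sigma> (r *\<^sub>R x) = r *\<^sub>R pull D \<sigma> x" for r x by transfer (simp add: fun_eq_iff)
  qed (simp add: norm_pull)
qed

lemma seq_of_pull_op:
  "inj_on \<sigma> D \<Longrightarrow> seq_of (pull_op D \<sigma> x) n = (if n \<in> D then seq_of x (\<sigma> n) else 0)"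
  by (simp add: pull_op.rep_eq pull.rep_eq)

lemma ell2_ops_eqI:
  fixes T U :: "ell2 \<Rightarrow>\<^sub>L ell2"
  assumes "\<And>x n. seq_of (blinfun_apply T x) n = seq_of (blinfun_apply U x) n" shows "T = U"
  using assms by (intro blinfun_eqI) (simp add: seq_of_inject[symmetric] fun_eq_iff)

lemma inner_ell2_has_sum: "((\<lambda>n. inner (seq_of x n) (seq_of y n)) has_sum inner x y) UNIV"
proof (rule norm_summable_imp_has_sum)
  have "summable (\<lambda>n. inner (seq_of x n) (seq_of y n))"
    by (intro summable_inner seq_of_summable)
  then show "(\<lambda>n. inner (seq_of x n) (seq_of y n)) sums inner x y"
    by (simp add: inner_ell2.rep_eq summable_sums)
  show "summable (\<lambda>n. norm (inner (seq_of x n) (seq_of y n)))"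
  proof (rule summable_comparison_test')
    show "summable (\<lambda>n. (cmod (seq_of x n))\<^sup>2 + (cmod (seq_of y n))\<^sup>2)"
      by (intro summable_add seq_of_summable)
    fix n
    have "\<bar>inner (seq_of x n) (seq_of y n)\<bar> \<le> cmod (seq_of x n) * cmod (seq_of y n)" by (rule Cauchy_Schwarz_ineq2)
    also have "\<dots> \<le> (cmod (seq_of x n))\<^sup>2 + (cmod (seq_of y n))\<^sup>2"
    proof -
      have "0 \<le> (cmod (seq_of x n) - cmod (seq_of y n))\<^sup>2" "0 \<le> cmod (seq_of x n) * cmod (seq_of y n)" by simp_all
      then show ?thesis unfolding power2_diff by linarith
    qed
    finally show "norm (norm (inner (seq_of x n) (seq_of y n))) \<le> (cmod (seq_of x n))\<^sup>2 + (cmod (seq_of y n))\<^sup>2" by simp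
  qed
qed

text \<open>Both inner products are the same sum, indexed by \<open>D\<close> or by its image under
  \<open>\<sigma>\<close>. \<open>has_sum\<close> permits reindexing along the bijection between
  these two sets.\<close>

lemma adjoint_pull_op:
  assumes \<sigma>: "inj_on \<sigma> D"
  shows "adjoint_ops (pull_op D \<sigma>) (pull_op (\<sigma> ` D) (inv_into D \<sigma>))"
  unfolding adjoint_ops_def
proof (intro allI)
  fix x y
  let ?g = "\<lambda>n. inner (seq_of (pull_op D \<sigma> x) n) (seq_of y n)"
  let ?h = "\<lambda>m. inner (seq_of x m) (seq_of (pull_op (\<sigma> ` D) (inv_into D \<sigma>) y) m)"
  have inv: "inj_on (inv_into D \<sigma>) (\<sigma> ` D)" by (rule inj_on_inv_into) simp
  have "(?g has_sum inner (pull_op D \<sigma> x) y) UNIV" by (rule inner_ell2_has_sum)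
  then have "(?g has_sum inner (pull_op D \<sigma> x) y) D"
    by (rule has_sum_cong_neutral[THEN iffD1, rotated -1]) (auto simp: seq_of_pull_op \<sigma>)
  moreover have "?g n = (?h \<circ> \<sigma>) n" if "n \<in> D" for n
    using that \<sigma> by (simp add: seq_of_pull_op inv)
  ultimately have "((?h \<circ> \<sigma>) has_sum inner (pull_op D \<sigma> x) y) D"
    using has_sum_cong[of D ?g "?h \<circ> \<sigma>"] by blast
  then have "(?h has_sum inner (pull_op D \<sigma> x) y) (\<sigma> ` D)" by (simp add: has_sum_reindex[OF \<sigma>])
  then have "(?h has_sum inner (pull_op D \<sigma> x) y) UNIV"
    by (rule has_sum_cong_neutral[THEN iffD1, rotated -1]) (auto simp: seq_of_pull_op inv)
  then show "inner (pull_op D \<sigma> x) y = inner x (pull_op (\<sigma> ` D) (inv_into D \<sigma>) y)"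
    using inner_ell2_has_sum by (rule has_sum_unique)
qed

lemma seq_of_mulC: "seq_of (mulC c x) n = c * seq_of x n"
  by (simp add: mulC.rep_eq)

lemma pull_op_in_ops:
  assumes "inj_on \<sigma> D" shows "pull_op D \<sigma> \<in> ell2_ops"
proof (rule ell2_opsI[OF _ adjoint_pull_op[OF assms]])
  show "pull_op D \<sigma> (mulC c x) = mulC c (pull_op D \<sigma> x)" for c x
    by (simp add: seq_of_inject[symmetric] fun_eq_iff seq_of_pull_op assms seq_of_mulC)
qed

definition proj_op :: "nat set \<Rightarrow> (ell2 \<Rightarrow>\<^sub>L ell2)" where "proj_op D = pull_op D id"

lemma seq_of_proj_op: "seq_of (proj_op D x) n = (if n \<in> D then seq_of x n else 0)"
  by (simp add: proj_op_def seq_of_pull_op)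

lemma proj_op_in_ops: "proj_op D \<in> ell2_ops"
  unfolding proj_op_def by (rule pull_op_in_ops) simp

lemma op_adj_proj_op: "op_adj (proj_op D) = proj_op D"
proof -
  have "op_adj (proj_op D) = pull_op (id ` D) (inv_into D id)"
    unfolding proj_op_def by (rule op_adj_eq[OF adjoint_pull_op]) simp
  also have "\<dots> = proj_op D"
    by (rule ell2_ops_eqI) (simp add: seq_of_pull_op[OF inj_on_inv_into] seq_of_proj_op inv_into_f_f[of id D, simplified] subset_refl)
  finally show ?thesis .
qed

lemma seq_of_add: "seq_of (x + y) n = seq_of x n + seq_of y n"
  by transfer simp

lemma seq_of_0: "seq_of 0 n = 0"
  by transfer simp

lemma proj_op_simps:
  "proj_op D o\<^sub>L proj_op D' = proj_op (D \<inter> D')" "proj_op {} = 0"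
  "proj_op (D \<union> D') = proj_op D + proj_op D' - proj_op (D \<inter> D')"
  "D' \<subseteq> D \<Longrightarrow> proj_op D - proj_op D' = proj_op (D - D')"
  "D \<inter> D' = {} \<Longrightarrow> proj_op (D \<union> D') = proj_op D + proj_op D'"
  by (rule ell2_ops_eqI; auto simp: seq_of_proj_op blinfun.add_left blinfun.diff_left seq_of_add seq_of_diff seq_of_0)+

lemma pull_op_compose:
  assumes "inj_on \<sigma> D"
  shows "pull_op D \<sigma> o\<^sub>L pull_op (\<sigma> ` D) (inv_into D \<sigma>) = proj_op D"
    "pull_op (\<sigma> ` D) (inv_into D \<sigma>) o\<^sub>L pull_op D \<sigma> = proj_op (\<sigma> ` D)"
  by (rule ell2_ops_eqI; auto simp: seq_of_proj_op seq_of_pull_op assms inj_on_inv_into f_inv_into_f inv_into_into)+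

lemma finsum_operator:
  assumes "finite I" "\<And>i. i \<in> I \<Longrightarrow> f i \<in> ell2_ops"
  shows "(\<Sum>i\<in>I. f i) \<in> ell2_ops \<and> finsum operator_algebra (\<lambda>i. encode (f i)) I = encode (\<Sum>i\<in>I. f i)"
proof -
  interpret complex_algebra operator_algebra by (rule complex_algebra_operator)
  show ?thesis
    using assms
  proof (induction I rule: finite_induct)
    case empty
    then show ?case using M.finsum_empty zero_in_ell2_ops by simp
  next
    case (insert i I)
    then have "finsum operator_algebra (\<lambda>i. encode (f i)) (insert i I)
      = encode (f i) \<oplus>\<^bsub>operator_algebra\<^esub> finsum operator_algebra (\<lambda>i. encode (f i)) I"
      by (intro M.finsum_insert) auto
    then show ?case using insert by (simp add: ell2_ops_closed)
  qed
qed

section \<open>A Cuntz-Krieger family with nonzero vertex projections\<close>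

context ultragraph
begin

text \<open>The positions of the basis vectors that belong to the vertex \<open>v\<close>. There are
  infinitely many, so that they can accommodate a copy of the points of the range of every edge
  starting at \<open>v\<close>.\<close>

definition point :: "'v \<Rightarrow> nat \<Rightarrow> nat" where
  "point v k = prod_encode (to_nat_on (verts G) v, k)"

definition points :: "'v set \<Rightarrow> nat set" where "points B = {point v k | v k. v \<in> B}"

text \<open>The disjoint union of the points of \<open>rng G e\<close> over all edges
  \<open>e\<close> with source \<open>v\<close>. A bijective numbering of it distributes the points
  of \<open>v\<close> among these edges.\<close>

definition fibre :: "'v \<Rightarrow> ('e \<times> nat) set" where
  "fibre v = {(e, n). e \<in> out_edges G v \<and> n \<in> points (rng G e)}"

definition edge_map :: "'e \<Rightarrow> nat \<Rightarrow> nat" where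
  "edge_map e n = point (src G e) (to_nat_on (fibre (src G e)) (e, n))"

lemma point_inject: "v \<in> verts G \<Longrightarrow> w \<in> verts G \<Longrightarrow> point v k = point w l \<longleftrightarrow> v = w \<and> k = l"
  using inj_on_to_nat_on[OF countable_verts] by (auto simp: point_def inj_on_def)

lemma points_Int: "B \<subseteq> verts G \<Longrightarrow> C \<subseteq> verts G \<Longrightarrow> points (B \<inter> C) = points B \<inter> points C"
  by (auto simp: points_def) (metis point_inject subsetD)

lemma points_Un: "points (B \<union> C) = points B \<union> points C"
  by (auto simp: points_def)

lemma countable_fibre: "countable (fibre v)"
proof (rule countable_subset)
  show "fibre v \<subseteq> edges G \<times> UNIV" by (auto simp: fibre_def out_edges_def)
  show "countable (edges G \<times> (UNIV :: nat set))" using countable_edges by simp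
qed

text \<open>Ranges are nonempty and every vertex carries infinitely many points, so the fibre is
  countably infinite and its numbering exhausts the natural numbers. This surjectivity yields the
  vertex relation.\<close>

lemma fibre_bij: "out_edges G v \<noteq> {} \<Longrightarrow> bij_betw (to_nat_on (fibre v)) (fibre v) UNIV"
proof (rule to_nat_on_infinite[OF countable_fibre])
  assume "out_edges G v \<noteq> {}"
  then obtain e where e: "e \<in> out_edges G v" by blast
  then have "e \<in> edges G" by (simp add: out_edges_def)
  then obtain w where w: "w \<in> rng G e" "w \<in> verts G" using rng_nonempty rng_subset by blast
  have "inj (\<lambda>k. (e, point w k))" using point_inject[OF w(2) w(2)] by (auto simp: inj_def)
  then have "infinite (range (\<lambda>k. (e, point w k)))" using finite_imageD by blast
  moreover have "range (\<lambda>k. (e, point w k)) \<subseteq> fibre v" using e w by (auto simp: fibre_def points_def)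
  ultimately show "infinite (fibre v)" using infinite_super by blast
qed

lemma mem_fibre: "e \<in> edges G \<Longrightarrow> n \<in> points (rng G e) \<Longrightarrow> (e, n) \<in> fibre (src G e)"
  by (simp add: fibre_def out_edges_def)

lemma edge_map_inject:
  assumes "e \<in> edges G" "f \<in> edges G" "n \<in> points (rng G e)" "m \<in> points (rng G f)" "edge_map e n = edge_map f m"
  shows "e = f \<and> n = m"
proof -
  have "src G e = src G f \<and> to_nat_on (fibre (src G e)) (e, n) = to_nat_on (fibre (src G f)) (f, m)"
    using assms point_inject[OF src_in_verts src_in_verts] unfolding edge_map_def by blast
  moreover have "(e, n) \<in> fibre (src G e)" "(f, m) \<in> fibre (src G f)" using assms mem_fibre by auto
  ultimately have "(e, n) = (f, m)"
    by (intro inj_onD[OF inj_on_to_nat_on[OF countable_fibre, of "src G e"]]) auto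
  then show ?thesis by simp
qed

lemma inj_on_edge_map: "e \<in> edges G \<Longrightarrow> inj_on (edge_map e) (points (rng G e))"
  using edge_map_inject by (blast intro: inj_onI)

definition edge_range :: "'e \<Rightarrow> nat set" where "edge_range e = edge_map e ` points (rng G e)"

lemma edge_range_disjoint: "e \<in> edges G \<Longrightarrow> f \<in> edges G \<Longrightarrow> e \<noteq> f \<Longrightarrow> edge_range e \<inter> edge_range f = {}"
  using edge_map_inject by (fastforce simp: edge_range_def)

lemma edge_range_cover:
  assumes "out_edges G v \<noteq> {}" shows "(\<Union>e\<in>out_edges G v. edge_range e) = points {v}"
proof (intro equalityI subsetI)
  fix n assume "n \<in> (\<Union>e\<in>out_edges G v. edge_range e)"
  then show "n \<in> points {v}" by (auto simp: edge_range_def points_def edge_map_def out_edges_def)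
next
  fix n assume "n \<in> points {v}"
  then obtain k where k: "n = point v k" by (auto simp: points_def)
  obtain e m where em: "(e, m) \<in> fibre v" "to_nat_on (fibre v) (e, m) = k"
    using fibre_bij[OF assms] unfolding bij_betw_def by (metis UNIV_I imageE surj_pair)
  then have "e \<in> out_edges G v" "m \<in> points (rng G e)" "src G e = v" by (auto simp: fibre_def out_edges_def)
  moreover have "n = edge_map e m" using k em calculation by (simp add: edge_map_def)
  ultimately show "n \<in> (\<Union>e\<in>out_edges G v. edge_range e)" by (auto simp: edge_range_def)
qed

text \<open>Pulling back along \<open>edge_map e\<close> leads from sequences on the source side to
  sequences on the range side; an edge acts in the opposite direction, hence the adjoint.\<close>

definition edge_op :: "'e \<Rightarrow> (ell2 \<Rightarrow>\<^sub>L ell2)" where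
  "edge_op e = op_adj (pull_op (points (rng G e)) (edge_map e))"

lemma edge_op:
  assumes "e \<in> edges G"
  shows "edge_op e \<in> ell2_ops" "op_adj (edge_op e) o\<^sub>L edge_op e = proj_op (points (rng G e))"
    "edge_op e o\<^sub>L op_adj (edge_op e) = proj_op (edge_range e)"
    "edge_op e o\<^sub>L op_adj (edge_op e) o\<^sub>L edge_op e = edge_op e"
proof -
  note inj = inj_on_edge_map[OF assms]
  have eq: "edge_op e = pull_op (edge_map e ` points (rng G e)) (inv_into (points (rng G e)) (edge_map e))"
    unfolding edge_op_def by (rule op_adj_eq[OF adjoint_pull_op[OF inj]])
  have adj: "op_adj (edge_op e) = pull_op (points (rng G e)) (edge_map e)"
    unfolding edge_op_def by (rule op_adj_in_ops(2)[OF pull_op_in_ops[OF inj]])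
  show "edge_op e \<in> ell2_ops" unfolding edge_op_def by (rule op_adj_in_ops(1)[OF pull_op_in_ops[OF inj]])
  show 1: "op_adj (edge_op e) o\<^sub>L edge_op e = proj_op (points (rng G e))"
    unfolding adj unfolding eq by (rule pull_op_compose[OF inj])
  show 2: "edge_op e o\<^sub>L op_adj (edge_op e) = proj_op (edge_range e)"
    unfolding adj unfolding eq edge_range_def by (rule pull_op_compose[OF inj])
  show "edge_op e o\<^sub>L op_adj (edge_op e) o\<^sub>L edge_op e = edge_op e"
    unfolding 2 unfolding eq edge_range_def
    by (rule ell2_ops_eqI) (simp add: seq_of_proj_op seq_of_pull_op inj_on_inv_into)
qed

lemma ck_family_operator:
  "ck_family G operator_algebra (\<lambda>e. encode (edge_op e)) (\<lambda>B. encode (proj_op (points B)))"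
proof (intro ck_family.intro ck_family_axioms.intro cstar_algebra_operator)
  note simps = proj_op_in_ops edge_op op_adj_in_ops op_adj_proj_op ell2_ops_closed operator_minus proj_op_simps
  note sub = gverts_subset
  show "projection operator_algebra (encode (proj_op (points B)))" if "B \<in> gverts G" for B
    by (simp add: projection_def simps)
  show "partial_isometry operator_algebra (encode (edge_op e))" if "e \<in> edges G" for e
    using edge_op(4)[OF that] edge_op(3)[OF that] that by (simp add: partial_isometry_def simps)
  show "encode (edge_op e) \<otimes>\<^bsub>operator_algebra\<^esub> adj operator_algebra (encode (edge_op e)) \<otimes>\<^bsub>operator_algebra\<^esub>
      (encode (edge_op f) \<otimes>\<^bsub>operator_algebra\<^esub> adj operator_algebra (encode (edge_op f))) = \<zero>\<^bsub>operator_algebra\<^esub>"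
    if "e \<in> edges G" "f \<in> edges G" "e \<noteq> f" for e f
    using that by (simp add: simps edge_range_disjoint)
  show "encode (proj_op (points {})) = \<zero>\<^bsub>operator_algebra\<^esub>"
    by (simp add: points_def proj_op_simps)
  show "encode (proj_op (points B)) \<otimes>\<^bsub>operator_algebra\<^esub> encode (proj_op (points C)) = encode (proj_op (points (B \<inter> C)))"
    if "B \<in> gverts G" "C \<in> gverts G" for B C
    using that sub by (simp add: simps points_Int)
  show "encode (proj_op (points (B \<union> C))) = encode (proj_op (points B)) \<oplus>\<^bsub>operator_algebra\<^esub> encode (proj_op (points C))
      \<ominus>\<^bsub>operator_algebra\<^esub> encode (proj_op (points (B \<inter> C)))"
    if "B \<in> gverts G" "C \<in> gverts G" for B C
    using that sub by (simp add: operator_minus ell2_ops_closed proj_op_in_ops points_Int points_Un proj_op_simps(3))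
  show "adj operator_algebra (encode (edge_op e)) \<otimes>\<^bsub>operator_algebra\<^esub> encode (edge_op e) = encode (proj_op (points (rng G e)))"
    if "e \<in> edges G" for e
    using that by (simp add: simps)
  show "cstar_le operator_algebra (encode (edge_op e) \<otimes>\<^bsub>operator_algebra\<^esub> adj operator_algebra (encode (edge_op e)))
      (encode (proj_op (points {src G e})))" if e: "e \<in> edges G" for e
  proof -
    have "e \<in> out_edges G (src G e)" using e by (simp add: out_edges_def)
    then have "edge_range e \<subseteq> points {src G e}" using edge_range_cover[of "src G e"] by blast
    then show ?thesis
      unfolding cstar_le_def
      by (intro bexI[of _ "encode (proj_op (points {src G e} - edge_range e))"]) (simp_all add: simps e)
  qed
  show "encode (proj_op (points {v})) = finsum operator_algebra
      (\<lambda>e. encode (edge_op e) \<otimes>\<^bsub>operator_algebra\<^esub> adj operator_algebra (encode (edge_op e))) (out_edges G v)"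
    if v: "v \<in> verts G" "finite (out_edges G v)" "out_edges G v \<noteq> {}" for v
  proof -
    have E: "e \<in> edges G" if "e \<in> out_edges G v" for e using that by (simp add: out_edges_def)
    have "proj_op (\<Union>e\<in>F. edge_range e) = (\<Sum>e\<in>F. proj_op (edge_range e))" if "finite F" "F \<subseteq> edges G" for F
      using that
    proof (induction F rule: finite_induct)
      case (insert e F)
      then have "edge_range e \<inter> (\<Union>e\<in>F. edge_range e) = {}" using edge_range_disjoint by blast
      then show ?case using insert by (simp add: proj_op_simps)
    qed (simp add: proj_op_simps)
    then have "proj_op (points {v}) = (\<Sum>e\<in>out_edges G v. proj_op (edge_range e))"
      using v(2) E edge_range_cover[OF v(3)] by (metis subsetI)
    then have "encode (proj_op (points {v})) = finsum operator_algebra (\<lambda>e. encode (proj_op (edge_range e))) (out_edges G v)"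
      using finsum_operator[OF v(2), of "\<lambda>e. proj_op (edge_range e)"] proj_op_in_ops by simp
    also have "\<dots> = finsum operator_algebra
      (\<lambda>e. encode (edge_op e) \<otimes>\<^bsub>operator_algebra\<^esub> adj operator_algebra (encode (edge_op e))) (out_edges G v)"
    proof -
      interpret complex_algebra operator_algebra by (rule complex_algebra_operator)
      show ?thesis using E edge_op by (intro M.finsum_cong') (auto simp: proj_op_in_ops)
    qed
    finally show ?thesis .
  qed
qed

lemma universal_vertex_nonzero:
  assumes "universal_ck_family G A s p" "v \<in> verts G"
  shows "p {v} \<noteq> \<zero>\<^bsub>A\<^esub>"
proof
  interpret universal_ck_family G A s p by fact
  assume zero: "p {v} = \<zero>\<^bsub>A\<^esub>"
  obtain \<phi> where \<phi>: "star_hom A operator_algebra \<phi>" "\<forall>C\<in>gverts G. \<phi> (p C) = encode (proj_op (points C))"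
    using universal[OF ck_family_operator] by blast
  \<comment> \<open>That \<open>\<phi>\<close> maps zero to zero is not listed in
    \<open>star_hom\<close>; contractivity supplies it.\<close>
  have "nrm operator_algebra (\<phi> \<zero>\<^bsub>A\<^esub>) \<le> nrm A \<zero>\<^bsub>A\<^esub>"
    by (rule star_hom_nrm_le[OF cstar_algebra_axioms cstar_algebra_operator \<phi>(1)]) simp
  moreover have "\<phi> \<zero>\<^bsub>A\<^esub> = encode (proj_op (points {v}))"
    using \<phi>(2) gverts.vertex[OF assms(2)] zero by metis
  ultimately have "norm (proj_op (points {v})) \<le> 0" using nrm_eq_zero[of "\<zero>\<^bsub>A\<^esub>"] by simp
  then have "proj_op (points {v}) = 0" by simp
  moreover define x where "x = ell2_of (\<lambda>n. if n = point v 0 then 1 else 0)"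
  have "summable (\<lambda>n. (cmod (if n = point v 0 then 1 else 0))\<^sup>2)"
    by (rule summable_finite[of "{point v 0}"]) auto
  then have "seq_of x (point v 0) = 1" by (simp add: x_def ell2_of_inverse)
  moreover have "point v 0 \<in> points {v}" by (auto simp: points_def)
  ultimately show False using seq_of_proj_op[of "points {v}" x "point v 0"] by (simp add: seq_of_0)
qed

end

section \<open>Characters of the circle\<close>

lemma bounded_additive_zero:
  fixes H :: "real \<Rightarrow> complex"
  assumes add: "\<And>s t. H (s + t) = H s + H t" and bound: "\<And>t. norm (H t) \<le> B"
  shows "H t = 0"
proof (rule ccontr)
  assume "H t \<noteq> 0"
  have mult: "H (real m * t) = of_nat m * H t" for m
  proof (induction m)
    case 0
    show ?case using add[of 0 0] by simp
  next
    case (Suc m)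
    then show ?case using add[of "real m * t" t] by (simp add: algebra_simps)
  qed
  obtain m :: nat where "B / norm (H t) < real m" using reals_Archimedean2 by blast
  then have "B < real m * norm (H t)" using \<open>H t \<noteq> 0\<close> by (simp add: field_simps)
  then have "B < norm (H (real m * t))" by (simp add: mult norm_mult)
  then show False using bound[of "real m * t"] by simp
qed

text \<open>A continuous logarithm \<open>g\<close> of \<open>f\<close> is additive up to a
  constant. After subtraction of the linear function with the same increment over a period, the rest
  is additive and bounded, so it is 0.\<close>

lemma circle_character_logarithm:
  assumes cont: "continuous_on UNIV f" and nz: "\<And>t. f t \<noteq> 0"
    and mult: "\<And>s t :: real. f (s + t) = f s * f t" and period: "f (2 * pi) = (1 :: complex)"
  shows "\<exists>n::int. \<forall>t. f t = cis (of_int n * t)"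
proof -
  have "contractible (UNIV :: real set)" by (simp add: convex_imp_contractible)
  then obtain g where g: "continuous_on UNIV g" "\<And>t. f t = exp (g t)"
    by (rule continuous_logarithm_on_contractible[OF cont]) (use nz in auto)
  have "f 0 = 1" using mult[of 0 0] nz[of 0] by simp
  have g_add: "g (s + t) - g t = g s - g 0" for s t
  proof -
    \<comment> \<open>For fixed \<open>s\<close> all values are logarithms of \<open>f s\<close>, so
      distinct values have distance at least \<open>2 * pi\<close>; a continuous function with such
      a range is constant.\<close>
    have "(\<lambda>t. g (s + t) - g t) constant_on UNIV"
    proof (rule continuous_discrete_range_constant)
      have "continuous_on UNIV (\<lambda>t. g (s + t))"
        by (rule continuous_on_compose2[OF g(1)]) (auto intro!: continuous_intros)
      then show "continuous_on UNIV (\<lambda>t. g (s + t) - g t)" using g(1) by (intro continuous_on_diff)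
      fix x :: real
      have "2 * pi \<le> norm (g (s + y) - g y - (g (s + x) - g x))"
        if "g (s + y) - g y \<noteq> g (s + x) - g x" for y
      proof -
        have "exp (g (s + t) - g t) = f s" for t
          using mult[of s t] nz[of t] by (simp add: exp_diff g(2)[symmetric])
        then have "exp (g (s + y) - g y) = exp (g (s + x) - g x)" by simp
        then obtain n :: int where n: "g (s + y) - g y = (g (s + x) - g x) + of_int (2 * n) * pi * \<i>"
          by (auto simp: exp_eq)
        then have "norm (g (s + y) - g y - (g (s + x) - g x)) = \<bar>of_int (2 * n)\<bar> * pi"
          by (simp add: norm_mult)
        moreover have "n \<noteq> 0" using n that by auto
        then have "1 \<le> \<bar>real_of_int n\<bar>" by linarith
        then have "2 * pi \<le> \<bar>real_of_int (2 * n)\<bar> * pi" by (intro mult_right_mono) (simp_all add: abs_mult)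
        ultimately show ?thesis by simp
      qed
      then show "\<exists>e>0. \<forall>y. y \<in> UNIV \<and> g (s + y) - g y \<noteq> g (s + x) - g x \<longrightarrow>
          e \<le> norm (g (s + y) - g y - (g (s + x) - g x))"
        by (intro exI[of _ "2 * pi"]) simp
    qed simp
    then obtain c where "\<And>t. g (s + t) - g t = c" unfolding constant_on_def by blast
    then show ?thesis by (metis add.right_neutral)
  qed
  have "exp (g (2 * pi)) = exp (g 0)" using period \<open>f 0 = 1\<close> by (simp add: g(2)[symmetric])
  then obtain n :: int where n: "g (2 * pi) = g 0 + of_int (2 * n) * pi * \<i>" by (auto simp: exp_eq)
  \<comment> \<open>\<open>n\<close> is the winding number of \<open>f\<close>. Removing the
    corresponding linear part makes \<open>H\<close> periodic, so it is bounded by its values on one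
    period.\<close>
  define H where "H t = g t - g 0 - of_int n * complex_of_real t * \<i>" for t
  have H_add: "H (s + t) = H s + H t" for s t
    using g_add[of s t] by (simp add: H_def algebra_simps)
  have H_period: "H (2 * pi) = 0" using n by (simp add: H_def algebra_simps)
  have H_nat: "H (t + of_nat k * (2 * pi)) = H t" for t k
  proof (induction k)
    case (Suc k)
    have "H (t + of_nat (Suc k) * (2 * pi)) = H ((t + of_nat k * (2 * pi)) + 2 * pi)" by (simp add: algebra_simps)
    then show ?case using Suc H_period by (simp only: H_add) simp
  qed simp
  have "continuous_on {0..2 * pi} H"
    unfolding H_def by (intro continuous_intros continuous_on_subset[OF g(1)]) auto
  then have "bounded (H ` {0..2 * pi})" by (intro compact_imp_bounded compact_continuous_image) auto
  then obtain B where "\<forall>y\<in>H ` {0..2 * pi}. norm y \<le> B" unfolding bounded_iff by blast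
  then have B: "norm (H t) \<le> B" if "t \<in> {0..2 * pi}" for t using that by blast
  have "norm (H t) \<le> B" for t
  proof -
    define k where "k = \<lfloor>t / (2 * pi)\<rfloor>"
    define s where "s = t - of_int k * (2 * pi)"
    have "of_int k \<le> t / (2 * pi)" "t / (2 * pi) < of_int k + 1" by (simp_all add: k_def floor_correct)
    then have "s \<in> {0..2 * pi}" by (simp add: s_def field_simps)
    moreover have "H t = H s"
    proof (cases "0 \<le> k")
      case True
      then show ?thesis using H_nat[of s "nat k"] by (simp add: s_def)
    next
      case False
      then show ?thesis using H_nat[of t "nat (- k)"] by (simp add: s_def)
    qed
    ultimately show ?thesis using B by simp
  qed
  then have "H t = 0" for t using bounded_additive_zero[of H B t] H_add by blast
  then have gt: "g t = g 0 + of_int n * complex_of_real t * \<i>" for t using H_def[of t] by (simp add: algebra_simps)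
  have "f t = f 0 * exp (of_int n * complex_of_real t * \<i>)" for t
    unfolding g(2) exp_add[symmetric] gt[of t] ..
  then have "f t = cis (of_int n * t)" for t
    using \<open>f 0 = 1\<close> by (simp add: cis_conv_exp mult_ac)
  then show ?thesis by blast
qed

lemma circle_characters:
  assumes "\<tau> \<in> characters circle_group circle_topology"
  shows "\<exists>n::int. \<forall>z\<in>sphere 0 1. \<tau> z = z powi n"
proof -
  have \<tau>: "\<And>z. z \<in> sphere 0 1 \<Longrightarrow> \<tau> z \<in> sphere 0 1"
    "\<And>z w. z \<in> sphere 0 1 \<Longrightarrow> w \<in> sphere 0 1 \<Longrightarrow> \<tau> (z * w) = \<tau> z * \<tau> w"
    using assms by (auto simp: characters_def hom_def circle_group_def)
  have cont: "continuous_on (sphere 0 1) \<tau>"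
    using assms by (simp add: characters_def)
  have cis: "cis t \<in> sphere 0 1" for t by simp
  have "continuous_on UNIV (\<lambda>t. \<tau> (cis t))"
    by (rule continuous_on_compose2[OF cont]) (auto intro: continuous_intros)
  moreover have "\<tau> (cis t) \<noteq> 0" for t using \<tau>(1)[OF cis[of t]] by auto
  moreover have "\<tau> (cis (s + t)) = \<tau> (cis s) * \<tau> (cis t)" for s t
    using \<tau>(2)[OF cis cis] by (simp add: cis_mult)
  moreover have "\<tau> (cis (2 * pi)) = 1"
  proof -
    have "\<tau> 1 * \<tau> 1 = \<tau> 1" using \<tau>(2)[of 1 1] by simp
    moreover have "\<tau> 1 \<noteq> 0" using \<tau>(1)[of 1] by auto
    ultimately show ?thesis by simp
  qed
  ultimately obtain n :: int where n: "\<And>t. \<tau> (cis t) = cis (of_int n * t)"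
    using circle_character_logarithm[of "\<lambda>t. \<tau> (cis t)"] by blast
  have "\<tau> z = z powi n" if "z \<in> sphere 0 1" for z
  proof -
    have "cis (Arg z) = z" using rcis_cmod_Arg[of z] that by (simp add: rcis_def)
    then show ?thesis using n[of "Arg z"] cis_power_int[of "Arg z" n] by simp
  qed
  then show ?thesis by blast
qed

lemma power_int_character: "(\<lambda>z. z powi n) \<in> characters circle_group circle_topology"
proof -
  have "continuous_on (sphere 0 1) (\<lambda>z :: complex. z powi n)"
    by (intro continuous_intros) auto
  then show ?thesis
    by (auto simp: characters_def hom_def circle_group_def norm_power_int power_int_mult_distrib)
qed

section \<open>Spectral subspaces of the gauge action\<close>

text \<open>The syntactic counterpart of the adjoint; it makes the set of values of terms closed
  under \<open>star\<close>, as \<open>values_dense\<close> requires.\<close>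

primrec adj_term :: "('v, 'e) lpa_gen alg_term \<Rightarrow> ('v, 'e) lpa_gen alg_term" where
  "adj_term (Gen g) = Gen (case g of Edge e \<Rightarrow> Ghost e | Ghost e \<Rightarrow> Edge e | Proj B \<Rightarrow> Proj B)"
| "adj_term Zero = Zero"
| "adj_term (Add t u) = Add (adj_term t) (adj_term u)"
| "adj_term (Mult t u) = Mult (adj_term u) (adj_term t)"
| "adj_term (Scale c t) = Scale (cnj c) (adj_term t)"

locale gauge_ck_family = universal_ck_family G A s p + ultragraph G
  for G :: "('v, 'e) ultragraph" and A :: "'a cstar" (structure)
    and s :: "'e \<Rightarrow> 'a" and p :: "'v set \<Rightarrow> 'a" +
  fixes \<gamma> :: "complex \<Rightarrow> 'a \<Rightarrow> 'a"
  assumes gauge: "gauge_action G A s p \<gamma>"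
begin

sublocale C: leavitt_family G ck_value
  by (rule ck_leavitt_family) unfold_locales

lemma p_adj: "B \<in> gverts G \<Longrightarrow> adj A (p B) = p B"
  using proj by (simp add: projection_def)

lemma gen_values:
  "e \<in> edges G \<Longrightarrow> C.S e \<in> E" "e \<in> edges G \<Longrightarrow> C.T e \<in> E" "B \<in> gverts G \<Longrightarrow> C.P B \<in> E"
  "e \<in> edges G \<Longrightarrow> star (C.S e) = C.T e" "e \<in> edges G \<Longrightarrow> star (C.T e) = C.S e"
  "B \<in> gverts G \<Longrightarrow> star (C.P B) = C.P B"
  using s_closed p_closed adj_closed adj_adj p_adj by simp_all

lemma adj_term_value:
  "valid_term t \<Longrightarrow> valid_term (adj_term t) \<and> term_value ck_value t \<in> E
     \<and> term_value ck_value (adj_term t) = star (term_value ck_value t)"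
proof (induction t)
  case (Gen g)
  then show ?case
    by (cases g) (auto simp: lpa_gens_def s_closed p_closed adj_closed adj_adj p_adj)
next
  case Zero
  then show ?case using E_0 star_0 by simp
next
  case (Add t u)
  then show ?case by (simp add: E_add star_add)
next
  case (Mult t u)
  then show ?case by (simp add: E_mult_left star_mult)
next
  case (Scale c t)
  then show ?case by (simp add: E_scale star_scale)
qed

lemma star_mono:
  "set a \<subseteq> edges G \<Longrightarrow> set b \<subseteq> edges G \<Longrightarrow> B \<in> gverts G \<Longrightarrow>
    C.mono a B b \<in> E \<and> star (C.mono a B b) = C.mono b B a"
proof (induction a B b rule: mono_term.induct)
  case (1 e a B b)
  then show ?case using gen_values(1,4)[of e] by (simp add: E_mult_left star_mult C.mono_Cons_right del: ck_value_simps)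
next
  case (2 B f b)
  then show ?case using gen_values(2,5)[of f] by (simp add: E_mult_left star_mult C.mono_Cons_right del: ck_value_simps)
next
  case (3 B)
  then show ?case using gen_values(3,6)[of B] by simp
qed

lemma component_E_star: "x \<in> C.component n \<Longrightarrow> x \<in> E \<and> star x \<in> C.component (- n)"
  unfolding C.component_def
proof (induction rule: vs.span_induct_alt)
  case base
  then show ?case using E_0 star_0 by (simp add: vs.span_zero)
next
  case (step c u v)
  obtain a B b where u: "u = C.mono a B b" "set a \<subseteq> edges G" "set b \<subseteq> edges G" "B \<in> gverts G"
    "int (length a) - int (length b) = n" using step(1) by (auto simp: C.monomials_def)
  note * = star_mono[OF u(2-4), folded u(1)]
  have "star u \<in> C.monomials (- n)" unfolding conjunct2[OF *] using u by (intro C.monomialsI) auto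
  then show ?case using * step.IH
    by (simp add: E_add E_scale star_add star_scale vs.span_add vs.span_scale vs.span_base)
qed

lemmas component_E = component_E_star[THEN conjunct1] and component_star = component_E_star[THEN conjunct2]

text \<open>The limits of values of terms form a closed star-subalgebra that contains the
  generators, so \<open>generated\<close> applies.\<close>

lemma values_dense:
  assumes "a \<in> carrier A" "0 < \<epsilon>"
  shows "\<exists>t. valid_term t \<and> nm (emb A a - term_value ck_value t) < \<epsilon>"
proof -
  define X where "X = {a \<in> carrier A. \<forall>\<epsilon>>0. \<exists>t. valid_term t \<and> nm (emb A a - term_value ck_value t) < \<epsilon>}"
  note valE = adj_term_value[THEN conjunct2, THEN conjunct1]
  have gen: "a \<in> X" if "a \<in> carrier A" "valid_term t" "emb A a = term_value ck_value t" for a t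
    using that unfolding X_def by (auto intro!: exI[of _ t])
  have "closed_star_subalgebra A X"
    unfolding closed_star_subalgebra_def linear_subspace_def
  proof (intro conjI ballI allI)
    show "X \<subseteq> carrier A" by (auto simp: X_def)
    show "\<zero> \<in> X" by (rule gen[of _ Zero]) simp_all
    fix x assume x: "x \<in> X"
    then have xA: "x \<in> carrier A" and ap: "\<And>\<epsilon>. 0 < \<epsilon> \<Longrightarrow> \<exists>t. valid_term t \<and> nm (emb A x - term_value ck_value t) < \<epsilon>"
      by (auto simp: X_def)
    show "c \<odot> x \<in> X" for c
      unfolding X_def
    proof (intro CollectI conjI allI impI)
      show "c \<odot> x \<in> carrier A" using xA by simp
      fix \<epsilon> :: real assume "0 < \<epsilon>"
      then have "0 < \<epsilon> / (cmod c + 1)" by (simp add: add_nonneg_pos)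
      then obtain t where t: "valid_term t" "nm (emb A x - term_value ck_value t) < \<epsilon> / (cmod c + 1)" using ap by blast
      have dE: "emb A x - term_value ck_value t \<in> E" using xA valE[OF t(1)] by (intro E_diff) auto
      have "emb A (c \<odot> x) - term_value ck_value (Scale c t) = ofc c * (emb A x - term_value ck_value t)"
        using xA by (simp add: emb_scale right_diff_distrib)
      then have "nm (emb A (c \<odot> x) - term_value ck_value (Scale c t)) = cmod c * nm (emb A x - term_value ck_value t)"
        using nm_scale[OF dE] by simp
      also have "\<dots> \<le> (cmod c + 1) * nm (emb A x - term_value ck_value t)"
        using nm_nonneg[OF dE] by (intro mult_right_mono) auto
      also have "\<dots> < \<epsilon>"
      proof -
        have "0 < cmod c + 1" by (simp add: add_nonneg_pos)
        then show ?thesis using t(2) by (simp add: pos_less_divide_eq mult.commute)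
      qed
      finally show "\<exists>t. valid_term t \<and> nm (emb A (c \<odot> x) - term_value ck_value t) < \<epsilon>"
        using t(1) by (intro exI[of _ "Scale c t"]) simp
    qed
    show "adj A x \<in> X"
      unfolding X_def
    proof (intro CollectI conjI allI impI)
      show "adj A x \<in> carrier A" using xA by (rule adj_closed)
      fix \<epsilon> :: real assume "0 < \<epsilon>"
      then obtain t where t: "valid_term t" "nm (emb A x - term_value ck_value t) < \<epsilon>" using ap by blast
      have dE: "emb A x - term_value ck_value t \<in> E" using xA valE[OF t(1)] by (intro E_diff) auto
      have "emb A (adj A x) - term_value ck_value (adj_term t) = star (emb A x - term_value ck_value t)"
        using xA adj_term_value[OF t(1)] by (simp add: star_diff)
      then show "\<exists>t. valid_term t \<and> nm (emb A (adj A x) - term_value ck_value t) < \<epsilon>"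
        using t adj_term_value[OF t(1)] nm_star[OF dE] by (intro exI[of _ "adj_term t"]) simp
    qed
    fix y assume y: "y \<in> X"
    then have yA: "y \<in> carrier A" and ap': "\<And>\<epsilon>. 0 < \<epsilon> \<Longrightarrow> \<exists>t. valid_term t \<and> nm (emb A y - term_value ck_value t) < \<epsilon>"
      by (auto simp: X_def)
    show "x \<oplus> y \<in> X"
      unfolding X_def
    proof (intro CollectI conjI allI impI)
      show "x \<oplus> y \<in> carrier A" using xA yA by simp
      fix \<epsilon> :: real assume "0 < \<epsilon>"
      then obtain t u where t: "valid_term t" "nm (emb A x - term_value ck_value t) < \<epsilon> / 2"
        and u: "valid_term u" "nm (emb A y - term_value ck_value u) < \<epsilon> / 2"
        using ap[of "\<epsilon> / 2"] ap'[of "\<epsilon> / 2"] by auto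
      have eq: "emb A (x \<oplus> y) - term_value ck_value (Add t u)
        = (emb A x - term_value ck_value t) + (emb A y - term_value ck_value u)"
        using xA yA by (simp add: emb_add)
      have E: "emb A x - term_value ck_value t \<in> E" "emb A y - term_value ck_value u \<in> E"
        using xA yA valE t u by (auto intro!: E_diff)
      have "nm (emb A (x \<oplus> y) - term_value ck_value (Add t u)) < \<epsilon>"
        unfolding eq using nm_triangle[OF E] t(2) u(2) by linarith
      then show "\<exists>t. valid_term t \<and> nm (emb A (x \<oplus> y) - term_value ck_value t) < \<epsilon>"
        using t u by (intro exI[of _ "Add t u"]) simp
    qed
    show "x \<otimes> y \<in> X"
      unfolding X_def
    proof (intro CollectI conjI allI impI)
      show "x \<otimes> y \<in> carrier A" using xA yA by (rule m_closed)
      fix \<epsilon> :: real assume "0 < \<epsilon>"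
      \<comment> \<open>The error of the product is \<open>x\<close> times the error of
        \<open>y\<close> plus the error of \<open>x\<close> times the value of \<open>u\<close>, in
        norm at most \<open>2 * M * \<delta>\<close>. The cap \<open>\<delta> \<le> 1\<close> bounds
        the norm of the value of \<open>u\<close> by that of \<open>y\<close> plus 1.\<close>
      define M where "M = nm (emb A x) + nm (emb A y) + 1"
      have M: "1 \<le> M" "nm (emb A x) \<le> M" "nm (emb A y) + 1 \<le> M"
        using nm_nonneg[of "emb A x"] nm_nonneg[of "emb A y"] xA yA by (simp_all add: M_def)
      define \<delta> where "\<delta> = min 1 (\<epsilon> / (2 * M))"
      have \<delta>: "0 < \<delta>" "\<delta> \<le> 1" "2 * M * \<delta> \<le> \<epsilon>"
        using \<open>0 < \<epsilon>\<close> M(1) by (simp_all add: \<delta>_def min_def field_simps)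
      obtain t u where t: "valid_term t" "nm (emb A x - term_value ck_value t) < \<delta>"
        and u: "valid_term u" "nm (emb A y - term_value ck_value u) < \<delta>"
        using ap[OF \<delta>(1)] ap'[OF \<delta>(1)] by auto
      let ?d = "emb A x - term_value ck_value t" and ?e = "emb A y - term_value ck_value u"
      have E: "?d \<in> E" "?e \<in> E" "emb A x \<in> E" "emb A y \<in> E" "term_value ck_value u \<in> E"
        using xA yA valE t u by (auto intro!: E_diff)
      have "term_value ck_value u = emb A y - ?e" by simp
      then have "nm (term_value ck_value u) \<le> nm (emb A y) + nm ?e" using nm_triangle_diff[OF E(4,2)] by simp
      then have nu: "nm (term_value ck_value u) \<le> M" using u \<delta> M by linarith
      have "emb A (x \<otimes> y) - term_value ck_value (Mult t u) = emb A x * ?e + ?d * term_value ck_value u"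
        using xA yA by (simp add: emb_mult algebra_simps)
      then have "nm (emb A (x \<otimes> y) - term_value ck_value (Mult t u)) \<le> nm (emb A x * ?e) + nm (?d * term_value ck_value u)"
        using nm_triangle[of "emb A x * ?e" "?d * term_value ck_value u"] E by (simp add: E_mult_left)
      also have "\<dots> \<le> nm (emb A x) * nm ?e + nm ?d * nm (term_value ck_value u)"
        using E by (intro add_mono nm_mult)
      also have "nm (emb A x) * nm ?e \<le> M * nm ?e" using M(2) nm_nonneg[OF E(2)] by (rule mult_right_mono)
      also have "M * nm ?e < M * \<delta>" using u(2) M(1) by simp
      also have "nm ?d * nm (term_value ck_value u) \<le> nm ?d * M" using nu nm_nonneg[OF E(1)] by (rule mult_left_mono)
      also have "nm ?d * M < \<delta> * M" using t(2) M(1) by simp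
      finally have "nm (emb A (x \<otimes> y) - term_value ck_value (Mult t u)) < M * \<delta> + \<delta> * M" by simp
      also have "M * \<delta> + \<delta> * M = 2 * M * \<delta>" by (simp add: algebra_simps)
      also note \<delta>(3)
      finally have "nm (emb A (x \<otimes> y) - term_value ck_value (Mult t u)) < \<epsilon>" .
      then show "\<exists>t. valid_term t \<and> nm (emb A (x \<otimes> y) - term_value ck_value t) < \<epsilon>"
        using t u by (intro exI[of _ "Mult t u"]) simp
    qed
  next
    interpret Metric_space "carrier A" "cdist A" by (rule metric_space)
    show "closedin mtopology X"
      unfolding closedin_metric
    proof (intro conjI allI impI)
      show "X \<subseteq> carrier A" by (auto simp: X_def)
      fix x assume "x \<in> carrier A - X"
      then obtain \<epsilon> where \<epsilon>: "0 < \<epsilon>" "\<And>t. valid_term t \<Longrightarrow> \<epsilon> \<le> nm (emb A x - term_value ck_value t)" and xA: "x \<in> carrier A"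
        unfolding X_def by (auto simp: not_less)
      have "y \<notin> X" if y: "y \<in> mball x (\<epsilon> / 2)" for y
      proof
        assume "y \<in> X"
        then obtain t where t: "valid_term t" "nm (emb A y - term_value ck_value t) < \<epsilon> / 2"
          using \<epsilon>(1) unfolding X_def by (auto dest: spec[of _ "\<epsilon> / 2"])
        have yA: "y \<in> carrier A" and d: "nm (emb A x - emb A y) < \<epsilon> / 2" using y by (auto simp: cdist_nm)
        have "nm (emb A x - term_value ck_value t) \<le> nm (emb A x - emb A y) + nm (emb A y - term_value ck_value t)"
          using nm_triangle[of "emb A x - emb A y" "emb A y - term_value ck_value t"] xA yA valE[OF t(1)]
          by (simp add: E_diff)
        then show False using \<epsilon>(2)[OF t(1)] d t(2) by linarith
      qed
      then show "\<exists>r>0. disjnt X (mball x r)"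
        using \<epsilon>(1) by (intro exI[of _ "\<epsilon> / 2"]) (auto simp: disjnt_def)
    qed
  qed
  moreover have "s ` edges G \<subseteq> X"
    using s_closed by (auto intro!: gen[of _ "Gen (Edge _)"] simp: lpa_gens_def)
  moreover have "p ` gverts G \<subseteq> X"
    using p_closed by (auto intro!: gen[of _ "Gen (Proj _)"] simp: lpa_gens_def)
  ultimately have "X = carrier A" by (rule generated)
  then show ?thesis using assms by (auto simp: X_def)
qed

definition act :: "complex \<Rightarrow> 'a cstar_unitization \<Rightarrow> 'a cstar_unitization" where
  "act z u = emb A (\<gamma> z (coordinate A u))"

lemma gauge_hom: "z \<in> sphere 0 1 \<Longrightarrow> star_hom A A (\<gamma> z)"
  using gauge by (simp add: gauge_action_def cstar_action_def circle_group_def)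

lemma gauge_closed: "z \<in> sphere 0 1 \<Longrightarrow> x \<in> carrier A \<Longrightarrow> \<gamma> z x \<in> carrier A"
  using gauge_hom unfolding star_hom_def by blast

lemma act_simps:
  assumes "z \<in> sphere 0 1" "x \<in> E" "y \<in> E"
  shows "act z x \<in> E" "act z (x + y) = act z x + act z y" "act z (x * y) = act z x * act z y"
    "act z (ofc c * x) = ofc c * act z x" "act z (star x) = star (act z x)" "nm (act z x) \<le> nm x"
proof -
  obtain a b where ab: "a \<in> carrier A" "b \<in> carrier A" "x = emb A a" "y = emb A b" using assms by blast
  note hom = gauge_hom[OF assms(1), unfolded star_hom_def]
  note closed = gauge_closed[OF assms(1) ab(1)] gauge_closed[OF assms(1) ab(2)]
  show "act z x \<in> E" using closed ab by (simp add: act_def)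
  show "act z (x + y) = act z x + act z y"
    using hom ab closed by (simp add: act_def emb_add[symmetric])
  show "act z (x * y) = act z x * act z y"
    using hom ab closed by (simp add: act_def emb_mult[symmetric] m_closed)
  show "act z (ofc c * x) = ofc c * act z x"
    using hom ab closed by (simp add: act_def emb_scale[symmetric])
  show "act z (star x) = star (act z x)"
    using hom ab closed by (simp add: act_def adj_closed)
  show "nm (act z x) \<le> nm x"
    using star_hom_nrm_le[OF cstar_algebra_axioms cstar_algebra_axioms gauge_hom[OF assms(1)] ab(1)] ab closed
    by (simp add: act_def)
qed

lemma act_0: "z \<in> sphere 0 1 \<Longrightarrow> act z 0 = 0"
  using act_simps(4)[of z 0 0 0] E_0 by simp

lemma act_gens:
  assumes "z \<in> sphere 0 1"
  shows "e \<in> edges G \<Longrightarrow> act z (C.S e) = ofc z * C.S e" "e \<in> edges G \<Longrightarrow> act z (C.T e) = ofc (1 / z) * C.T e"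
    "B \<in> gverts G \<Longrightarrow> act z (C.P B) = C.P B"
proof -
  have g: "e \<in> edges G \<Longrightarrow> \<gamma> z (s e) = z \<odot> s e" "B \<in> gverts G \<Longrightarrow> \<gamma> z (p B) = p B" for e B
    using gauge assms by (auto simp: gauge_action_def)
  show S: "act z (C.S e) = ofc z * C.S e" if "e \<in> edges G" for e
    using that g s_closed by (simp add: act_def emb_scale)
  have "z * cnj z = 1" using assms complex_norm_square[of z] by simp
  moreover have "z \<noteq> 0" using assms by auto
  ultimately have "cnj z = 1 / z" by (simp add: eq_divide_eq mult.commute)
  then show "act z (C.T e) = ofc (1 / z) * C.T e" if "e \<in> edges G"
    using that act_simps(5)[OF assms gen_values(1)[OF that] gen_values(1)[OF that]] S[OF that] gen_values(1,2,4)[of e]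
    by (simp add: star_scale del: ck_value_simps)
  show "act z (C.P B) = C.P B" if "B \<in> gverts G"
    using that g p_closed by (simp add: act_def)
qed

lemma act_component:
  assumes "z \<in> sphere 0 1" "x \<in> C.component n"
  shows "act z x = ofc (z powi n) * x"
proof -
  have z: "z \<noteq> 0" using assms(1) by auto
  have mono: "act z (C.mono a B b) = term_value (C.rescaled z) (mono_term a B b)"
    if "set a \<subseteq> edges G" "set b \<subseteq> edges G" "B \<in> gverts G" for a B b
    using that
  proof (induction a B b rule: mono_term.induct)
    case (1 e a B b)
    then show ?case
      using act_simps(3)[OF assms(1) gen_values(1)[of e] conjunct1[OF star_mono[of a b B]]] act_gens(1)[OF assms(1), of e]
      by (simp del: ck_value_simps)
  next
    case (2 B f b)
    then show ?case
      using act_simps(3)[OF assms(1) conjunct1[OF star_mono[of "[]" b B]] gen_values(2)[of f]] act_gens(2)[OF assms(1), of f]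
      by (simp del: ck_value_simps)
  next
    case (3 B)
    then show ?case using act_gens(3)[OF assms(1), of B] by (simp del: ck_value_simps)
  qed
  have "x \<in> E \<and> act z x = ofc (z powi n) * x"
    using assms(2) unfolding C.component_def
  proof (induction rule: vs.span_induct_alt)
    case base
    then show ?case using act_0[OF assms(1)] E_0 by simp
  next
    case (step c u v)
    obtain a B b where u: "u = C.mono a B b" "set a \<subseteq> edges G" "set b \<subseteq> edges G" "B \<in> gverts G"
      "int (length a) - int (length b) = n" using step(1) by (auto simp: C.monomials_def)
    have uE: "u \<in> E" using star_mono[OF u(2-4)] u(1) by simp
    have "act z u = ofc (z powi n) * u"
      using mono[OF u(2-4)] C.rescaled_mono_term[OF z, of a B b] u(1,5) by simp
    then have "act z (ofc c * u + v) = ofc c * (ofc (z powi n) * u) + ofc (z powi n) * v"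
      using uE step.IH by (simp add: act_simps[OF assms(1)] E_scale)
    then show ?case using uE step.IH
      by (simp add: E_add E_scale semiring_class.distrib_left mult.commute)
  qed
  then show ?thesis by simp
qed

text \<open>Averaging \<open>u\<close> with \<open>z\<^sup>-\<^sup>n \<gamma>\<^sub>z(u)\<close>, where \<open>z\<close> is chosen with \<open>z\<^sup>k\<^sup>-\<^sup>n = - 1\<close>, is a contraction
  that fixes degree \<open>n\<close> and kills degree \<open>k\<close>.\<close>

lemma drop_components:
  assumes "finite F" "n \<notin> F" "a \<in> E" "\<And>z. z \<in> sphere 0 1 \<Longrightarrow> act z a = ofc (z powi n) * a"
    and "x \<in> C.component n" "\<And>k. f k \<in> C.component k" "nm (a - (x + (\<Sum>k\<in>F. f k))) \<le> \<epsilon>"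
  shows "nm (a - x) \<le> \<epsilon>"
  using assms(1,2,6,7)
proof (induction F arbitrary: f rule: finite_induct)
  case (insert k F)
  have "k \<noteq> n" using insert by auto
  define z where "z = cis (pi / of_int (k - n))"
  have z: "z \<in> sphere 0 1" "z \<noteq> 0" by (simp_all add: z_def)
  have "z powi (k - n) = cis pi" using \<open>k \<noteq> n\<close> by (simp add: z_def cis_power_int)
  then have zk: "z powi (- n) * z powi k = - 1" using z(2) by (simp add: power_int_add[symmetric])
  have zn: "z powi (- n) * z powi n = 1" using z(2) by (simp add: power_int_add[symmetric])
  have zcm: "cmod (z powi (- n)) = 1" using z(1) by (simp add: norm_power_int)
  define D where "D u = ofc (1 / 2) * (u + ofc (z powi (- n)) * act z u)" for u
  \<comment> \<open>The other degrees are merely multiplied by scalars, so the remaining sum is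
    again one of homogeneous elements; this is why \<open>f\<close> varies in the induction.\<close>
  define g where "g j = ofc ((1 + z powi (- n) * z powi j) / 2) * f j" for j
  have Dc: "D u = ofc ((1 + z powi (- n) * z powi j) / 2) * u" if "act z u = ofc (z powi j) * u" for u j
    unfolding D_def that by (simp add: ofc_add semiring_class.distrib_left semiring_class.distrib_right add_divide_distrib)
  have Da: "D a = a" using Dc[OF assms(4)[OF z(1)]] by (simp add: zn del: power_int_minus)
  have Dx: "D x = x" using Dc[OF act_component[OF z(1) assms(5)]] by (simp add: zn del: power_int_minus)
  have Df: "D (f j) = g j" for j
    unfolding g_def by (rule Dc[OF act_component[OF z(1) insert.prems(2)]])
  have gk: "g k = 0" by (simp add: g_def zk del: power_int_minus)
  have D_add: "D (u + v) = D u + D v" if "u \<in> E" "v \<in> E" for u v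
    using that by (simp add: D_def act_simps[OF z(1)] semiring_class.distrib_left add_ac)
  have D_diff: "D (u - v) = D u - D v" if "u \<in> E" "v \<in> E" for u v
  proof -
    have "D (u - v) + D v = D u" using D_add[of "u - v" v] that by (simp add: E_diff)
    then show ?thesis by (simp add: eq_diff_eq)
  qed
  have fE: "f j \<in> E" for j using component_E[OF insert.prems(2)] .
  have sumE: "(\<Sum>j\<in>I. f j) \<in> E \<and> D (\<Sum>j\<in>I. f j) = (\<Sum>j\<in>I. g j)" if "finite I" for I
    using that
  proof (induction I rule: finite_induct)
    case empty
    show ?case using E_0 by (simp add: D_def act_0[OF z(1)])
  next
    case (insert i I)
    then show ?case using fE[of i] by (simp add: E_add D_add Df)
  qed
  have D_nm: "nm (D u) \<le> nm u" if "u \<in> E" for u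
  proof -
    note E = act_simps(1)[OF z(1) that that] E_scale[OF act_simps(1)[OF z(1) that that], of "z powi (- n)"]
    have "nm (D u) = nm (u + ofc (z powi (- n)) * act z u) / 2"
      using that E unfolding D_def by (subst nm_scale) (simp_all add: E_add norm_divide)
    also have "nm (u + ofc (z powi (- n)) * act z u) \<le> nm u + nm (ofc (z powi (- n)) * act z u)"
      using that E by (intro nm_triangle)
    also have "nm (ofc (z powi (- n)) * act z u) \<le> nm u"
      using nm_scale[OF E(1), of "z powi (- n)"] act_simps(6)[OF z(1) that that] zcm by simp
    finally show ?thesis by simp
  qed
  have xE: "x \<in> E" using component_E[OF assms(5)] .
  have fin: "finite (insert k F)" using insert by simp
  note s = sumE[OF fin]
  have "D (a - (x + (\<Sum>j\<in>insert k F. f j))) = a - (x + (\<Sum>j\<in>insert k F. g j))"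
    using s assms(3) xE by (simp only: D_diff[OF assms(3) E_add[OF xE conjunct1[OF s]]] D_add[OF xE conjunct1[OF s]] Da Dx simp_thms)
  then have "nm (a - (x + (\<Sum>j\<in>insert k F. g j))) \<le> \<epsilon>"
    using D_nm[OF E_diff[OF assms(3) E_add[OF xE conjunct1[OF s]]]] insert.prems(3) by simp
  then have "nm (a - (x + (\<Sum>j\<in>F. g j))) \<le> \<epsilon>" using insert.hyps gk by simp
  moreover have "g j \<in> C.component j" for j
    unfolding g_def using insert.prems(2) by (rule C.component_scale)
  ultimately show ?case using insert.IH[of g] insert.prems(1) by blast
qed simp

lemma component_dense:
  assumes "a \<in> E" "\<And>z. z \<in> sphere 0 1 \<Longrightarrow> act z a = ofc (z powi n) * a" "0 < \<epsilon>"
  shows "\<exists>x\<in>C.component n. nm (a - x) \<le> \<epsilon>"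
proof -
  obtain t where t: "valid_term t" "nm (a - term_value ck_value t) < \<epsilon>"
    using values_dense[OF _ assms(3)] assms(1) by blast
  obtain f F where f: "finite F" "\<forall>n. f n \<in> C.component n" "\<forall>n. n \<notin> F \<longrightarrow> f n = 0" "term_value ck_value t = sum f F"
    using C.term_value_homogeneous[OF t(1)] by blast
  have "sum f F = f n + sum f (F - {n})"
    using f(1,3) by (cases "n \<in> F") (simp_all add: sum.remove)
  then have "nm (a - (f n + sum f (F - {n}))) \<le> \<epsilon>" using t f(4) by simp
  then have "nm (a - f n) \<le> \<epsilon>"
    by (intro drop_components[of "F - {n}" n a "f n" f]) (use f assms in auto)
  then show ?thesis using f(2) by blast
qed

end

section \<open>Comparison of the Leavitt path algebra with the C*-algebra\<close>

context gauge_ck_family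
begin

sublocale L: leavitt_family G lpa_value
  by (rule lpa_value_family)

definition spectral :: "int \<Rightarrow> 'a cstar_unitization set" where
  "spectral n = {a \<in> E. \<forall>z\<in>sphere 0 1. act z a = ofc (z powi n) * a}"

lemma emb_eigenspace:
  assumes "\<And>z. z \<in> sphere 0 1 \<Longrightarrow> \<tau> z = z powi n"
  shows "emb A ` eigenspace circle_group A \<gamma> \<tau> = spectral n"
proof -
  have "\<gamma> z a = \<tau> z \<odot> a \<longleftrightarrow> act z (emb A a) = ofc (z powi n) * emb A a"
    if "a \<in> carrier A" "z \<in> sphere 0 1" for a z
    using that assms[OF that(2)] gauge_closed[OF that(2,1)]
    by (simp add: act_def emb_scale[symmetric] emb_eq_iff)
  then show ?thesis
    by (auto simp: eigenspace_def spectral_def circle_group_def image_iff)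
qed

lemma emb_fixed_algebra: "emb A ` fixed_algebra circle_group A \<gamma> = spectral 0"
proof -
  have "fixed_algebra circle_group A \<gamma> = eigenspace circle_group A \<gamma> (\<lambda>z. z powi 0)"
    unfolding fixed_algebra_def eigenspace_def by auto
  then show ?thesis using emb_eigenspace[of "\<lambda>z. z powi 0" 0] by simp
qed

lemma component_spectral: "x \<in> C.component n \<Longrightarrow> x \<in> spectral n"
  using component_E act_component by (auto simp: spectral_def)

abbreviation "products n \<equiv> {star u * v | u v. u \<in> spectral n \<and> v \<in> spectral n}"

lemma spectral_0_subspace: "vs.subspace (spectral 0)"
proof (rule vs.subspaceI)
  show "0 \<in> spectral 0" using E_0 act_0 by (simp add: spectral_def)
  fix x assume x: "x \<in> spectral 0"
  then have xE: "x \<in> E" by (simp add: spectral_def)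
  show "ofc c * x \<in> spectral 0" for c
    using x xE act_simps(4)[OF _ xE xE, of _ c] E_scale[OF xE, of c] unfolding spectral_def by simp
  fix y assume y: "y \<in> spectral 0"
  then have yE: "y \<in> E" by (simp add: spectral_def)
  show "x + y \<in> spectral 0"
    using x y act_simps(2)[OF _ xE yE] E_add[OF xE yE] unfolding spectral_def by simp
qed

lemma products_spectral: "vs.span (products n) \<subseteq> spectral 0"
proof (rule vs.span_minimal[OF _ spectral_0_subspace], safe)
  fix u v assume u: "u \<in> spectral n" and v: "v \<in> spectral n"
  have uv: "u \<in> E" "v \<in> E" using u v by (auto simp: spectral_def)
  have "act z (star u * v) = star u * v" if z: "z \<in> sphere 0 1" for z
  proof -
    have "z \<noteq> 0" "cnj z * z = 1" using z complex_norm_square[of z] by (auto simp: mult.commute)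
    then have "cnj (z powi n) * z powi n = 1"
      by (metis complex_cnj_power_int power_int_mult_distrib power_int_1_left)
    moreover have "act z (star u * v) = (ofc (cnj (z powi n)) * star u) * (ofc (z powi n) * v)"
      using u v z uv by (simp add: act_simps[OF z] E_star star_scale spectral_def)
    ultimately show ?thesis by (simp only: ofc_mult_ofc) simp
  qed
  then show "star u * v \<in> spectral 0" using uv by (simp add: spectral_def E_mult_left)
qed

text \<open>Products of the adjoint eigenspace with the eigenspace always lie in the fixed point
  algebra, so density alone is left; and an integer \<open>n\<close> stands for each
  character.\<close>

lemma saturated_iff:
  "saturated circle_group circle_topology A \<gamma> \<longleftrightarrow>
   (\<forall>n. \<forall>a\<in>spectral 0. \<forall>\<epsilon>>0. \<exists>y\<in>vs.span (products n). nm (a - y) < \<epsilon>)"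
proof -
  interpret Metric_space "carrier A" "cdist A" by (rule metric_space)
  let ?B = "\<lambda>\<tau>. linear_span A (set_prod A (adj A ` eigenspace circle_group A \<gamma> \<tau>) (eigenspace circle_group A \<gamma> \<tau>))"
  have fixed_sub: "fixed_algebra circle_group A \<gamma> \<subseteq> carrier A" by (auto simp: fixed_algebra_def)
  have main: "(?B \<tau> \<subseteq> fixed_algebra circle_group A \<gamma> \<and> fixed_algebra circle_group A \<gamma> \<subseteq> Abstract_Topology.closure_of mtopology (?B \<tau>)) \<longleftrightarrow>
      (\<forall>a\<in>spectral 0. \<forall>\<epsilon>>0. \<exists>y\<in>vs.span (products n). nm (a - y) < \<epsilon>)"
    if \<tau>: "\<And>z. z \<in> sphere 0 1 \<Longrightarrow> \<tau> z = z powi n" for \<tau> n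
  proof -
    have eq: "emb A ` eigenspace circle_group A \<gamma> \<tau> = spectral n"
      by (rule emb_eigenspace) (rule \<tau>)
    have eig: "eigenspace circle_group A \<gamma> \<tau> \<subseteq> carrier A" by (auto simp: eigenspace_def)
    then have eig': "adj A ` eigenspace circle_group A \<gamma> \<tau> \<subseteq> carrier A" using adj_closed by auto
    have "emb A ` adj A ` eigenspace circle_group A \<gamma> \<tau> = star ` emb A ` eigenspace circle_group A \<gamma> \<tau>"
      using eig by (auto simp: image_image intro!: image_cong)
    then have adj_eig: "emb A ` adj A ` eigenspace circle_group A \<gamma> \<tau> = star ` spectral n"
      unfolding eq .
    have "emb A ` set_prod A (adj A ` eigenspace circle_group A \<gamma> \<tau>) (eigenspace circle_group A \<gamma> \<tau>) = products n"
      unfolding emb_set_prod[OF eig' eig] adj_eig eq by blast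
    then have B: "emb A ` ?B \<tau> = vs.span (products n)"
      using emb_linear_span[OF set_prod_subset_carrier[OF eig' eig]] by simp
    have BA: "?B \<tau> \<subseteq> carrier A" by (intro linear_span_closed set_prod_subset_carrier eig eig')
    have "emb A ` ?B \<tau> \<subseteq> emb A ` fixed_algebra circle_group A \<gamma>"
      unfolding B emb_fixed_algebra by (rule products_spectral)
    then have 1: "?B \<tau> \<subseteq> fixed_algebra circle_group A \<gamma>"
      using inj_on_image_subset_iff[of "emb A" "carrier A" "?B \<tau>" "fixed_algebra circle_group A \<gamma>"] BA fixed_sub
      by (simp add: inj_on_def emb_eq_iff)
    have "fixed_algebra circle_group A \<gamma> \<subseteq> Abstract_Topology.closure_of mtopology (?B \<tau>) \<longleftrightarrow>
      (\<forall>a\<in>fixed_algebra circle_group A \<gamma>. \<forall>\<epsilon>>0. \<exists>y\<in>?B \<tau>. cdist A a y < \<epsilon>)"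
      using fixed_sub BA unfolding metric_closure_of by (force simp: subset_iff)
    also have "\<dots> \<longleftrightarrow> (\<forall>a\<in>fixed_algebra circle_group A \<gamma>. \<forall>\<epsilon>>0. \<exists>y\<in>?B \<tau>. nm (emb A a - emb A y) < \<epsilon>)"
      using fixed_sub BA by (auto simp: cdist_nm subset_iff)
    also have "\<dots> \<longleftrightarrow> (\<forall>a\<in>emb A ` fixed_algebra circle_group A \<gamma>. \<forall>\<epsilon>>0. \<exists>y\<in>emb A ` ?B \<tau>. nm (a - y) < \<epsilon>)"
      by simp
    finally show ?thesis using 1 unfolding B emb_fixed_algebra by blast
  qed
  show ?thesis
  proof
    assume sat: "saturated circle_group circle_topology A \<gamma>"
    show "\<forall>n. \<forall>a\<in>spectral 0. \<forall>\<epsilon>>0. \<exists>y\<in>vs.span (products n). nm (a - y) < \<epsilon>"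
    proof
      fix n
      show "\<forall>a\<in>spectral 0. \<forall>\<epsilon>>0. \<exists>y\<in>vs.span (products n). nm (a - y) < \<epsilon>"
        using sat power_int_character[of n] main[of "\<lambda>z. z powi n" n] unfolding saturated_def Let_def by blast
    qed
  next
    assume dense: "\<forall>n. \<forall>a\<in>spectral 0. \<forall>\<epsilon>>0. \<exists>y\<in>vs.span (products n). nm (a - y) < \<epsilon>"
    show "saturated circle_group circle_topology A \<gamma>"
      unfolding saturated_def Let_def
    proof
      fix \<tau> assume "\<tau> \<in> characters circle_group circle_topology"
      then obtain n where n: "\<And>z. z \<in> sphere 0 1 \<Longrightarrow> \<tau> z = z powi n" using circle_characters by blast
      show "?B \<tau> \<subseteq> fixed_algebra circle_group A \<gamma> \<and> fixed_algebra circle_group A \<gamma> \<subseteq> Abstract_Topology.closure_of mtopology (?B \<tau>)"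
        by (rule main[of \<tau> n, THEN iffD2]) (use n dense in auto)
    qed
  qed
qed

lemma lift_C:
  "lift ck_value ` L.component n = C.component n"
  by (rule lift_component[OF C.leavitt_family_axioms])

lemma L_range: "x \<in> L.component n \<Longrightarrow> x \<in> lpa_range"
  using component_subset_range by blast

lemma lift_products:
  assumes "x \<in> vs.span {x * y | x y. x \<in> L.component (- n) \<and> y \<in> L.component n}"
  shows "x \<in> lpa_range \<and> lift ck_value x \<in> vs.span {x * y | x y. x \<in> C.component (- n) \<and> y \<in> C.component n}"
  using assms
proof (induction rule: vs.span_induct_alt)
  case base
  show ?case using lift_0[OF C.leavitt_family_axioms] by (simp add: vs.span_zero)
next
  case (step c u v)
  obtain x y where u: "u = x * y" "x \<in> L.component (- n)" "y \<in> L.component n" using step(1) by blast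
  note fam = C.leavitt_family_axioms
  note uy = lift_mult[OF fam L_range[OF u(2)] L_range[OF u(3)], folded u(1)]
  have "lift ck_value x \<in> C.component (- n)" "lift ck_value y \<in> C.component n"
    using u(2,3) lift_C by blast+
  then have "lift ck_value u \<in> {x * y | x y. x \<in> C.component (- n) \<and> y \<in> C.component n}"
    unfolding uy(2) by blast
  then show ?case
    using step.IH lift_add[OF fam lift_scale(1)[OF fam uy(1), of c]] lift_scale(2)[OF fam uy(1), of c]
    by (simp add: vs.span_add vs.span_scale vs.span_base)
qed

text \<open>The image of degree 0 is dense in the fixed point algebra, and each of its elements is
  exactly a sum of products of degrees \<open>- n\<close> and \<open>n\<close>, whose first factors
  are adjoints of elements of degree \<open>n\<close>.\<close>

lemma saturated_if_strongly_graded: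
  assumes strong: "\<forall>n. \<forall>B\<in>gverts G. L.P B \<in> vs.span {x * y | x y. x \<in> L.component (- n) \<and> y \<in> L.component n}"
  shows "saturated circle_group circle_topology A \<gamma>"
  unfolding saturated_iff
proof (intro allI ballI impI)
  fix n a and \<epsilon> :: real assume a: "a \<in> spectral 0" and "0 < \<epsilon>"
  then obtain x where x: "x \<in> C.component 0" "nm (a - x) \<le> \<epsilon> / 2"
    using component_dense[of a 0 "\<epsilon> / 2"] by (auto simp: spectral_def)
  obtain \<xi> where \<xi>: "\<xi> \<in> L.component 0" "x = lift ck_value \<xi>" using x(1) lift_C[of 0] by blast
  have "\<xi> \<in> vs.span {x * y | x y. x \<in> L.component (- n) \<and> y \<in> L.component n}"
    using strong \<xi>(1) unfolding L.strongly_graded_iff[symmetric] by (metis add.left_inverse)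
  then have "x \<in> vs.span {x * y | x y. x \<in> C.component (- n) \<and> y \<in> C.component n}"
    using lift_products \<xi>(2) by blast
  moreover have "{x * y | x y. x \<in> C.component (- n) \<and> y \<in> C.component n} \<subseteq> products n"
  proof safe
    fix x y assume "x \<in> C.component (- n)" "y \<in> C.component n"
    then show "\<exists>u v. x * y = star u * v \<and> u \<in> spectral n \<and> v \<in> spectral n"
      using component_star[of x "- n"] component_spectral star_star[OF component_E[of x "- n"]] by force
  qed
  ultimately have "x \<in> vs.span (products n)" using vs.span_mono by blast
  moreover have "nm (a - x) < \<epsilon>" using x(2) \<open>0 < \<epsilon>\<close> by simp
  ultimately show "\<exists>y\<in>vs.span (products n). nm (a - y) < \<epsilon>" by blast
qed

lemma lift_injective_component_0:
  assumes "\<xi> \<in> L.component 0" "lift ck_value \<xi> = 0"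
  shows "\<xi> = 0"
proof (rule L.ideal_component_0[where K = "{\<xi> \<in> lpa_range. lift ck_value \<xi> = 0}"])
  note fam = C.leavitt_family_axioms
  have gen: "lpa_value g \<in> lpa_range" "lift ck_value (lpa_value g) = ck_value g" if "g \<in> lpa_gens G" for g
    using lift_gen[OF fam that] by auto
  fix x assume x: "x \<in> {\<xi> \<in> lpa_range. lift ck_value \<xi> = 0}"
  show "L.T e * x * L.S f \<in> {\<xi> \<in> lpa_range. lift ck_value \<xi> = 0}" if "e \<in> edges G" "f \<in> edges G" for e f
    using x that gen[of "Ghost e"] gen[of "Edge f"] by (simp add: lpa_gens_def lift_mult[OF fam])
  show "L.P {v} * x \<in> {\<xi> \<in> lpa_range. lift ck_value \<xi> = 0}" if "v \<in> verts G" for v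
    using x that gen[of "Proj {v}"] gverts.vertex[OF that] by (simp add: lpa_gens_def lift_mult[OF fam])
  show "ofc c * x \<in> {\<xi> \<in> lpa_range. lift ck_value \<xi> = 0}" for c
    using x by (simp add: lift_scale[OF fam])
next
  fix v assume v: "v \<in> verts G"
  have "lift ck_value (L.P {v}) = emb A (p {v})"
    using lift_gen[OF C.leavitt_family_axioms, of "Proj {v}"] gverts.vertex[OF v] by (simp add: lpa_gens_def)
  moreover have "emb A (p {v}) \<noteq> 0"
    using universal_vertex_nonzero[OF universal_ck_family_axioms v] p_closed[OF gverts.vertex[OF v]]
      emb_eq_iff[of "p {v}" \<zero>] by simp
  ultimately show "L.P {v} \<notin> {\<xi> \<in> lpa_range. lift ck_value \<xi> = 0}" by simp
next
  show "\<xi> \<in> {\<xi> \<in> lpa_range. lift ck_value \<xi> = 0}" using assms L_range by blast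
qed (rule assms(1))

text \<open>Both factors are approximated by homogeneous elements of the image, with the error split
  as \<open>star a * b - star x * y = star a * (b - y) + star (a - x) * y\<close>.\<close>

lemma products_approx:
  assumes "y \<in> vs.span (products n)"
  shows "y \<in> E \<and> (\<forall>\<epsilon>>0. \<exists>\<xi>\<in>vs.span {x * y | x y. x \<in> L.component (- n) \<and> y \<in> L.component n}.
    nm (y - lift ck_value \<xi>) \<le> \<epsilon>)"
  using assms
proof (induction rule: vs.span_induct_alt)
  case base
  then show ?case using lift_0[OF C.leavitt_family_axioms] E_0
    by (auto intro!: bexI[of _ 0] simp: vs.span_zero)
next
  case (step c u v)
  note fam = C.leavitt_family_axioms
  obtain a b where ab: "u = star a * b" "a \<in> spectral n" "b \<in> spectral n" using step(1) by blast
  have E: "a \<in> E" "b \<in> E" using ab by (auto simp: spectral_def)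
  show ?case
  proof (intro conjI allI impI)
    show "ofc c * u + v \<in> E" using step.IH E by (simp add: ab(1) E_add E_scale E_mult_left)
    fix \<epsilon> :: real assume "0 < \<epsilon>"
    \<comment> \<open>Chosen so that \<open>M * \<delta>\<close> bounds the error of the product
      times the modulus of \<open>c\<close>. The 1 in the first factor comes from
      \<open>nm y \<le> nm b + 1\<close>, which uses \<open>\<delta> \<le> 1\<close>; the 1 in the
      second keeps \<open>M\<close> positive.\<close>
    define M where "M = (nm a + nm b + 1) * (cmod c + 1)"
    have nn: "0 \<le> nm a" "0 \<le> nm b" using E nm_nonneg by auto
    have "0 < M" using nn by (simp add: M_def add_nonneg_pos)
    define \<delta> where "\<delta> = min 1 (\<epsilon> / (2 * M))"
    have \<delta>: "0 < \<delta>" "\<delta> \<le> 1" "M * \<delta> \<le> \<epsilon> / 2" using \<open>0 < \<epsilon>\<close> \<open>0 < M\<close> by (simp_all add: \<delta>_def min_def field_simps)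
    obtain x where x: "x \<in> C.component n" "nm (a - x) \<le> \<delta>"
      using component_dense[OF E(1) _ \<delta>(1), of n] ab(2) by (auto simp: spectral_def)
    obtain y where y: "y \<in> C.component n" "nm (b - y) \<le> \<delta>"
      using component_dense[OF E(2) _ \<delta>(1), of n] ab(3) by (auto simp: spectral_def)
    obtain \<eta> where \<eta>: "\<eta> \<in> vs.span {x * y | x y. x \<in> L.component (- n) \<and> y \<in> L.component n}" "nm (v - lift ck_value \<eta>) \<le> \<epsilon> / 2"
      using conjunct2[OF step.IH, rule_format, of "\<epsilon> / 2"] \<open>0 < \<epsilon>\<close> by auto
    have img: "star x \<in> lift ck_value ` L.component (- n)" "y \<in> lift ck_value ` L.component n"
      unfolding lift_C using component_star[OF x(1)] y(1) by auto
    obtain \<alpha> where \<alpha>: "\<alpha> \<in> L.component (- n)" "lift ck_value \<alpha> = star x" using img(1) by (elim imageE) simp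
    obtain \<beta> where \<beta>: "\<beta> \<in> L.component n" "lift ck_value \<beta> = y" using img(2) by (elim imageE) simp
    define \<xi> where "\<xi> = ofc c * (\<alpha> * \<beta>) + \<eta>"
    have "\<alpha> * \<beta> \<in> {x * y | x y. x \<in> L.component (- n) \<and> y \<in> L.component n}" using \<alpha> \<beta> by blast
    then have \<xi>: "\<xi> \<in> vs.span {x * y | x y. x \<in> L.component (- n) \<and> y \<in> L.component n}"
      unfolding \<xi>_def by (intro vs.span_add[OF _ \<eta>(1)] vs.span_scale vs.span_base)
    note range = L_range[OF \<alpha>(1)] L_range[OF \<beta>(1)]
    note \<alpha>\<beta> = lift_mult[OF fam range, unfolded \<alpha>(2) \<beta>(2)]
    have lift_\<xi>: "lift ck_value \<xi> = ofc c * (star x * y) + lift ck_value \<eta>"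
      unfolding \<xi>_def using lift_add(2)[OF fam lift_scale(1)[OF fam \<alpha>\<beta>(1), of c] conjunct1[OF lift_products[OF \<eta>(1)]]]
        lift_scale(2)[OF fam \<alpha>\<beta>(1), of c] \<alpha>\<beta>(2) by simp
    have vE: "v \<in> E" "lift ck_value \<eta> \<in> E"
    proof -
      show "v \<in> E" using step.IH by blast
      obtain t where "valid_term t" "\<eta> = term_value lpa_value t"
        using conjunct1[OF lift_products[OF \<eta>(1)]] unfolding emb_carrier_leavitt by blast
      then show "lift ck_value \<eta> \<in> E" using lift_term_value[OF fam] adj_term_value by simp
    qed
    have E': "x \<in> E" "y \<in> E" "a - x \<in> E" "b - y \<in> E" using component_E x(1) y(1) E by (auto intro: E_diff)
    have uE: "u - star x * y \<in> E" using E E' by (simp add: ab(1) E_diff E_mult_left)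
    have "nm (u - star x * y) \<le> nm (star a * (b - y)) + nm (star (a - x) * y)"
    proof -
      have "u - star x * y = star a * (b - y) + star (a - x) * y"
        using E E' by (simp add: ab(1) star_diff right_diff_distrib left_diff_distrib)
      then show ?thesis using nm_triangle[of "star a * (b - y)" "star (a - x) * y"] E' by (simp add: E_mult_left)
    qed
    also have "nm (star a * (b - y)) \<le> nm a * \<delta>"
      using nm_mult[OF E_star[OF E(1)] E'(4)] mult_left_mono[OF y(2) nn(1)] by (simp add: nm_star[OF E(1)])
    also have "nm (star (a - x) * y) \<le> \<delta> * (nm b + 1)"
    proof -
      have "nm y \<le> nm b + nm (b - y)" using nm_triangle_diff[OF E(2) E'(4)] by simp
      then have "nm y \<le> nm b + 1" using y(2) \<delta>(2) by linarith
      then have "nm (a - x) * nm y \<le> \<delta> * (nm b + 1)" using x(2) nm_nonneg[OF E'(3)] nm_nonneg[OF E'(2)] \<delta>(1) by (intro mult_mono) auto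
      then show ?thesis using nm_mult[OF E_star[OF E'(3)] E'(2)] by (simp add: nm_star[OF E'(3)])
    qed
    finally have "nm (u - star x * y) \<le> (nm a + nm b + 1) * \<delta>" by (simp add: algebra_simps)
    then have "cmod c * nm (u - star x * y) \<le> (cmod c + 1) * ((nm a + nm b + 1) * \<delta>)"
      using nn \<delta>(1) nm_nonneg[OF uE] by (intro mult_mono) auto
    also have "\<dots> = M * \<delta>" by (simp add: M_def mult_ac)
    finally have cu: "cmod c * nm (u - star x * y) \<le> \<epsilon> / 2" using \<delta>(3) by linarith
    have "(ofc c * u + v) - lift ck_value \<xi> = ofc c * (u - star x * y) + (v - lift ck_value \<eta>)"
      by (simp add: lift_\<xi> right_diff_distrib)
    then have "nm ((ofc c * u + v) - lift ck_value \<xi>) \<le> nm (ofc c * (u - star x * y)) + nm (v - lift ck_value \<eta>)"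
      using nm_triangle[OF E_scale[OF uE] E_diff[OF vE], of c] by (simp only:)
    also have "\<dots> \<le> \<epsilon> / 2 + \<epsilon> / 2" using cu \<eta>(2) by (intro add_mono) (simp_all add: nm_scale[OF uE])
    finally show "\<exists>\<xi>\<in>vs.span {x * y | x y. x \<in> L.component (- n) \<and> y \<in> L.component n}.
      nm (ofc c * u + v - lift ck_value \<xi>) \<le> \<epsilon>" using \<xi> by (intro bexI[of _ \<xi>]) simp
  qed
qed

text \<open>An element \<open>\<eta>\<close> of the ideal close to \<open>P B\<close> has an image that is invertible in the corner of \<open>p B\<close>.
  It also satisfies a polynomial relation, so this inverse is a polynomial in it; hence \<open>P B\<close> itself
  lies in the ideal, first up to the kernel of \<open>lift\<close> and then by injectivity in degree zero.\<close>

lemma strongly_graded_if_saturated: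
  assumes sat: "saturated circle_group circle_topology A \<gamma>" and B: "B \<in> gverts G"
  shows "L.P B \<in> vs.span {x * y | x y. x \<in> L.component (- n) \<and> y \<in> L.component n}" (is "_ \<in> vs.span ?I")
proof -
  note fam = C.leavitt_family_axioms
  have PB: "L.P B \<in> L.component 0" "C.P B \<in> C.component 0"
    using L.monomialsI[of "[]" "[]" B 0] C.monomialsI[of "[]" "[]" B 0] B
    by (auto intro: L.component_mono C.component_mono simp del: ck_value_simps)
  have lift_P: "lift ck_value (L.P B) = C.P B" using lift_gen[OF fam, of "Proj B"] B by (simp add: lpa_gens_def)
  have PE: "C.P B \<in> E" "L.P B \<in> lpa_range" using component_E[OF PB(2)] L_range[OF PB(1)] by auto
  have PP: "C.P B * C.P B = C.P B" "L.P B * L.P B = L.P B" using C.P_mult[OF B B] L.P_mult[OF B B] by simp_all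
  have I_left: "w * x \<in> vs.span ?I" if "w \<in> L.component 0" "x \<in> vs.span ?I" for w x
    using that(2)
  proof (rule L.mult_span_subset)
    fix m assume "m \<in> ?I"
    then obtain x y where m: "m = x * y" "x \<in> L.component (- n)" "y \<in> L.component n" by blast
    have "w * x \<in> L.component (- n)" using L.component_mult[OF that(1) m(2)] by simp
    then have "w * x * y \<in> ?I" using m(3) by blast
    then show "w * m \<in> vs.span ?I" unfolding m(1) mult.assoc[symmetric] by (rule vs.span_base)
  qed
  have I_right: "x * w \<in> vs.span ?I" if "w \<in> L.component 0" "x \<in> vs.span ?I" for w x
    using that(2)
  proof (rule L.span_mult_subset)
    fix m assume "m \<in> ?I"
    then obtain x y where m: "m = x * y" "x \<in> L.component (- n)" "y \<in> L.component n" by blast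
    have "y * w \<in> L.component n" using L.component_mult[OF m(3) that(1)] by simp
    then have "x * (y * w) \<in> ?I" using m(2) by blast
    then show "m * w \<in> vs.span ?I" unfolding m(1) mult.assoc by (rule vs.span_base)
  qed
  have I_0: "vs.span ?I \<subseteq> L.component 0"
  proof -
    have "?I \<subseteq> vs.span (L.monomials 0)"
      using L.component_mult[of _ "- n" _ n] by (auto simp: L.component_def)
    then show ?thesis unfolding L.component_def by (rule vs.span_minimal) simp
  qed
  \<comment> \<open>The errors 1/2 here and 1/4 in the next choice add up to less than 1, the
    distance at which \<open>cancel\<close> works.\<close>
  obtain y where y: "y \<in> vs.span (products n)" "nm (C.P B - y) < 1 / 2"
    using sat component_spectral[OF PB(2)] unfolding saturated_iff by (meson half_gt_zero zero_less_one)
  obtain \<eta>0 where \<eta>0: "\<eta>0 \<in> vs.span ?I" "nm (y - lift ck_value \<eta>0) \<le> 1 / 4"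
    using conjunct2[OF products_approx[OF y(1)], rule_format, of "1 / 4"] by auto
  \<comment> \<open>Compression by \<open>P B\<close> stays in the ideal, does not increase the
    distance of the image from \<open>P B\<close>, and makes \<open>P B\<close> a two-sided unit for
    the element.\<close>
  define \<eta> where "\<eta> = L.P B * \<eta>0 * L.P B"
  have \<eta>I: "\<eta> \<in> vs.span ?I" unfolding \<eta>_def by (intro I_left I_right PB(1) \<eta>0(1))
  have \<eta>_0: "\<eta> \<in> L.component 0" using \<eta>I I_0 by blast
  have r0: "\<eta>0 \<in> lpa_range" using lift_products[OF \<eta>0(1)] by blast
  have lift_E: "lift ck_value x \<in> E" if "x \<in> L.component m" for x m
  proof -
    have "lift ck_value x \<in> C.component m" using that lift_C by blast
    then show ?thesis by (rule component_E)
  qed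
  define z where "z = lift ck_value \<eta>"
  have zE: "z \<in> E" unfolding z_def by (rule lift_E[OF \<eta>_0])
  have z_eq: "z = C.P B * lift ck_value \<eta>0 * C.P B"
    unfolding z_def \<eta>_def using lift_mult[OF fam] PE(2) r0 lift_P by simp
  have Pz: "C.P B * z = z" "z * C.P B = z"
    unfolding z_eq by (simp_all add: mult.assoc PP del: ck_value_simps) (simp add: mult.assoc[symmetric] PP del: ck_value_simps)
  have close: "nm (C.P B - z) < 1"
  proof -
    let ?d = "C.P B - lift ck_value \<eta>0"
    have yE: "y \<in> E" "lift ck_value \<eta>0 \<in> E" using y(1) products_spectral[of n] lift_E[OF subsetD[OF I_0 \<eta>0(1)]] by (auto simp: spectral_def)
    have dE: "?d \<in> E" using PE(1) yE(2) by (rule E_diff)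
    have "nm ?d \<le> nm (C.P B - y) + nm (y - lift ck_value \<eta>0)"
      using nm_triangle[of "C.P B - y" "y - lift ck_value \<eta>0"] PE(1) yE by (simp add: E_diff del: ck_value_simps)
    then have d1: "nm ?d < 1" using y(2) \<eta>0(2) by linarith
    have nP: "nm (C.P B) \<le> 1"
    proof -
      have "adjoint_pair (C.P B) (C.P B)" using adjoint_E[OF PE(1)] gen_values(6)[OF B] by simp
      then have "bnd 1 (C.P B)" using PP(1) by (rule bnd_idempotent)
      then show ?thesis using bnd_nm[OF PE(1), of 1] by simp
    qed
    have "C.P B - z = C.P B * ?d * C.P B"
      unfolding z_eq by (simp only: right_diff_distrib left_diff_distrib PP(1))
    then have "nm (C.P B - z) \<le> nm (C.P B * ?d) * nm (C.P B)"
      using nm_mult[OF E_mult_left[OF dE] PE(1)] by simp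
    also have "\<dots> \<le> nm (C.P B * ?d) * 1" using nP nm_nonneg[OF E_mult_left[OF dE]] by (rule mult_left_mono)
    also have "\<dots> \<le> nm (C.P B) * nm ?d" using nm_mult[OF PE(1) dE] by simp
    also have "\<dots> \<le> 1 * nm ?d" using nP nm_nonneg[OF dE] by (rule mult_right_mono)
    finally show ?thesis using d1 by simp
  qed
  \<comment> \<open>From \<open>z * w = 0\<close> follows \<open>w = (P B - z) * w\<close>, which
    would have smaller norm than \<open>w\<close> unless \<open>w = 0\<close>. This injectivity on
    the corner takes the place of an inverse of \<open>z\<close>.\<close>
  have cancel: "w = 0" if "w \<in> E" "C.P B * w = w" "z * w = 0" for w
  proof (rule ccontr)
    assume "w \<noteq> 0"
    then have pos: "0 < nm w" using nm_nonneg[OF that(1)] nm_eq_0[OF that(1)] by linarith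
    have "w = (C.P B - z) * w" using that by (simp add: left_diff_distrib del: ck_value_simps)
    then have "nm w \<le> nm (C.P B - z) * nm w" using nm_mult[OF E_diff[OF PE(1) zE] that(1)] by simp
    also have "\<dots> < 1 * nm w" using close pos by (rule mult_strict_right_mono)
    finally show False by simp
  qed
  have cancel_power: "w = 0" if "w \<in> E" "C.P B * w = w" "z ^ i * w = 0" for w i
    using that
  proof (induction i)
    case (Suc i)
    have "z ^ i * w = 0"
    proof (rule cancel)
      show "z ^ i * w \<in> E" using Suc.prems(1) by (rule E_mult_left)
      show "z * (z ^ i * w) = 0" using Suc.prems(3) by (simp add: mult.assoc)
      show "C.P B * (z ^ i * w) = z ^ i * w"
        using Suc.prems(2) Pz(1) by (cases i) (simp_all add: mult.assoc[symmetric] del: ck_value_simps)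
    qed
    then show ?case using Suc by blast
  qed simp
  obtain c k m where c: "k \<le> m" "c k \<noteq> 0" "(\<Sum>i=k..m. ofc (c i) * \<eta> ^ Suc i) = 0"
    by (rule L.powers_dependent[OF \<eta>_0])
  have \<eta>_pow: "\<eta> ^ Suc i \<in> vs.span ?I" "\<eta> ^ Suc i \<in> lpa_range \<and> lift ck_value (\<eta> ^ Suc i) = z ^ Suc i" for i
  proof (induction i)
    case 0
    {
      case 1 show ?case using \<eta>I by simp
    next
      case 2 show ?case using L_range[OF \<eta>_0] by (simp add: z_def)
    }
  next
    case (Suc i)
    {
      case 1 show ?case using I_left[OF \<eta>_0 Suc(1)] by simp
    next
      case 2 show ?case using lift_mult[OF fam L_range[OF \<eta>_0] conjunct1[OF Suc(2)]] Suc(2) by (simp add: z_def)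
    }
  qed
  \<comment> \<open>Formally the relation is \<open>\<eta> ^ Suc k\<close> times
    \<open>c k + \<rho>\<close>; in the corner the constant term becomes \<open>c k\<close> times
    \<open>P B\<close>.\<close>
  define \<rho> where "\<rho> = (\<Sum>i\<in>{k<..m}. ofc (c i) * \<eta> ^ (i - k))"
  have pos: "\<eta> ^ (i - k) \<in> vs.span ?I" "\<eta> ^ (i - k) \<in> lpa_range" "lift ck_value (\<eta> ^ (i - k)) = z ^ (i - k)" if "i \<in> {k<..m}" for i
  proof -
    have "i - k = Suc (i - k - 1)" using that unfolding greaterThanAtMost_iff by arith
    then show "\<eta> ^ (i - k) \<in> vs.span ?I" "\<eta> ^ (i - k) \<in> lpa_range" "lift ck_value (\<eta> ^ (i - k)) = z ^ (i - k)"
      using \<eta>_pow[of "i - k - 1"] by metis+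
  qed
  have \<rho>I: "\<rho> \<in> vs.span ?I" unfolding \<rho>_def using pos(1) by (intro vs.span_sum vs.span_scale)
  have \<rho>0: "\<rho> \<in> L.component 0" using \<rho>I I_0 by blast
  have lift_\<rho>: "lift ck_value \<rho> = (\<Sum>i\<in>{k<..m}. ofc (c i) * z ^ (i - k))"
    unfolding \<rho>_def using lift_sum[OF fam, of "{k<..m}" "\<lambda>i. ofc (c i) * \<eta> ^ (i - k)"] lift_scale[OF fam pos(2)] pos(3) by simp
  define w where "w = ofc (c k) * C.P B + lift ck_value \<rho>"
  have wE: "w \<in> E" unfolding w_def using PE(1) lift_E[OF \<rho>0] by (intro E_add E_scale)
  have Pw: "C.P B * w = w"
  proof -
    have "C.P B * z ^ (i - k) = z ^ (i - k)" if "i \<in> {k<..m}" for i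
      using that Pz(1) by (cases "i - k") (simp_all add: mult.assoc[symmetric] del: ck_value_simps)
    then have "C.P B * (ofc (c i) * z ^ (i - k)) = ofc (c i) * z ^ (i - k)" if "i \<in> {k<..m}" for i
      using that by (simp only: mult_ofc_left)
    then have "C.P B * lift ck_value \<rho> = lift ck_value \<rho>"
      unfolding lift_\<rho> sum_distrib_left by (intro sum.cong) auto
    moreover have "C.P B * (ofc (c k) * C.P B) = ofc (c k) * C.P B" by (simp only: mult_ofc_left PP(1))
    ultimately show ?thesis unfolding w_def by (simp only: semiring_class.distrib_left)
  qed
  have "z ^ Suc k * w = (\<Sum>i=k..m. ofc (c i) * z ^ Suc i)"
  proof -
    have "z ^ Suc k * C.P B = z ^ Suc k" using Pz(2) by (simp add: power_Suc2 mult.assoc del: power_Suc ck_value_simps)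
    then have "z ^ Suc k * (ofc (c k) * C.P B) = ofc (c k) * z ^ Suc k" by (simp only: mult_ofc_left)
    moreover have "z ^ Suc k * lift ck_value \<rho> = (\<Sum>i\<in>{k<..m}. ofc (c i) * z ^ Suc i)"
      unfolding lift_\<rho> sum_distrib_left mult_ofc_left power_add[symmetric] by (intro sum.cong) auto
    moreover have "(\<Sum>i=k..m. ofc (c i) * z ^ Suc i) = ofc (c k) * z ^ Suc k + (\<Sum>i\<in>{k<..m}. ofc (c i) * z ^ Suc i)"
      using c(1) by (rule sum.head)
    ultimately show ?thesis unfolding w_def by (simp only: semiring_class.distrib_left)
  qed
  also have "\<dots> = lift ck_value (\<Sum>i=k..m. ofc (c i) * \<eta> ^ Suc i)"
    using lift_sum[OF fam, of "{k..m}" "\<lambda>i. ofc (c i) * \<eta> ^ Suc i"] lift_scale[OF fam conjunct1[OF \<eta>_pow(2)]] \<eta>_pow(2)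
    by (simp del: power_Suc)
  also have "\<dots> = 0" using c(3) lift_0[OF fam] by simp
  finally have "w = 0" by (rule cancel_power[OF wE Pw])
  \<comment> \<open>Its image is \<open>w\<close>, which is 0. Injectivity in degree 0 lifts this to
    the Leavitt path algebra, where it says that \<open>P B\<close> is a multiple of
    \<open>\<rho>\<close>, an element of the ideal.\<close>
  define \<zeta> where "\<zeta> = ofc (c k) * L.P B + \<rho>"
  have "\<zeta> \<in> L.component 0" unfolding \<zeta>_def using PB(1) \<rho>0 by (intro L.component_add L.component_scale)
  moreover have "lift ck_value \<zeta> = 0"
    using lift_add(2)[OF fam lift_scale(1)[OF fam PE(2), of "c k"] L_range[OF \<rho>0]] lift_scale(2)[OF fam PE(2), of "c k"] lift_P \<open>w = 0\<close>
    by (simp add: \<zeta>_def w_def)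
  ultimately have "\<zeta> = 0" by (rule lift_injective_component_0)
  then have "ofc (c k) * L.P B = - \<rho>" by (simp add: \<zeta>_def eq_neg_iff_add_eq_0)
  then have "ofc (1 / c k) * (ofc (c k) * L.P B) \<in> vs.span ?I" using \<rho>I by (simp add: vs.span_neg vs.span_scale)
  then show ?thesis using c(2) by simp
qed

end

theorem theorem4p3:
  fixes G :: "('v, 'e) ultragraph"
    and A :: "'a cstar" and s :: "'e \<Rightarrow> 'a" and p :: "'v set \<Rightarrow> 'a"
    and \<gamma> :: "complex \<Rightarrow> 'a \<Rightarrow> 'a"
  assumes "ultragraph G"
    and "universal_ck_family G A s p"
    and "gauge_action G A s p \<gamma>"
  shows "saturated circle_group circle_topology A \<gamma>
    \<longleftrightarrow> strongly_graded (leavitt G) (leavitt_component G)"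
proof -
  interpret gauge_ck_family G A s p \<gamma>
    using assms by (simp add: gauge_ck_family_def gauge_ck_family_axioms_def)
  show ?thesis
    unfolding strongly_graded_leavitt_iff
    using saturated_if_strongly_graded strongly_graded_if_saturated by blast
qed

end
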